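(* Let $n$ be an integer and let $k=\lfloor n/6\rfloor$ and $l=n-6k$. The maximum number of vertices of a $3$-boundary regular critical graph in the plane with boundary of size $n$ is equal to $$f_3(n)=6k^2+6k+2l(k+1)-r,$$ where $r=0$ if $n$ is a multiple of $6$ and $r=2$ otherwise. Furthermore, the combinatorial structure (the isomorphism type as an abstract graph) of the $3$-boundary regular critical graphs with boundary of size $n$ which maximise the number of vertices is unique.
   Context: Graphs are drawn in the Euclidean plane so that each edge is a straight line segment; edges are allowed to cross each other, and the intersection point of two edges is a vertex of the graph. A boundary point is a vertex incident to only one edge; the set of boundary points is finite, and its cardinality is the size of the boundary. Vertices of degree $2$ are not allowed, the graph is bounded (entirely contained in a bounded open set of the plane), and it has countably many vertices. Such a graph is critical if, at each non-boundary vertex, the sum of the unit vectors of the edges extending from that vertex is zero. It is $3$-boundary regular if every non-boundary vertex has degree $3$. The number of vertices counts all vertices, including boundary points. For $n\ge 3$, $f_3(n)$ denotes the supremum of the numbers of vertices of $3$-boundary regular critical graphs in the plane with $n$ boundary points.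
   Formalization: The vertices are additionally required to have no accumulation point in the plane, so the bounded graph has finitely many vertices; with countably infinite graphs allowed, pruned self-similar 120-degree trees have n boundary points and infinitely many vertices, so the formula would fail. *)

theory Defs
  imports "HOL-Analysis.Analysis" "HOL-Library.Extended_Nat"
begin

text \<open>
  A straight-line graph in the Euclidean plane (modelled by the type \<open>complex\<close>) is a set \<open>V\<close> of
  points together with a set \<open>E\<close> of two-element subsets of \<open>V\<close>; the edge \<open>{u, v}\<close> is drawn as the
  closed segment from \<open>u\<close> to \<open>v\<close>, which is the convex hull of \<open>{u, v}\<close>. As a point where two
  edges meet is a vertex, edges are taken to be cut at every vertex they pass through.
\<close>

definition drawing :: "complex set \<Rightarrow> complex set set \<Rightarrow> complex set" where
  "drawing V E = V \<union> (\<Union>e\<in>E. convex hull e)"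

definition incident_edges :: "complex set set \<Rightarrow> complex \<Rightarrow> complex set set" where
  "incident_edges E v = {e \<in> E. v \<in> e}"

definition vertex_degree :: "complex set set \<Rightarrow> complex \<Rightarrow> nat" where
  "vertex_degree E v = card (incident_edges E v)"

definition neighbours :: "complex set set \<Rightarrow> complex \<Rightarrow> complex set" where
  "neighbours E v = {w. {v, w} \<in> E}"

definition boundary_points :: "complex set \<Rightarrow> complex set set \<Rightarrow> complex set" where
  "boundary_points V E = {v \<in> V. vertex_degree E v = 1}"

text \<open>
  The vertices are required to have no accumulation point in the plane. This is the usual
  convention for drawings of countable graphs, and it cannot be dropped here: three copies of the
  infinite binary tree in which every edge splits into two edges turned by \<open>\<plusminus>60\<close> degrees and
  shortened by the factor \<open>2/5\<close>, joined at their roots at angles of \<open>120\<close> degrees, form a bounded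
  crossing-free straight-line graph with countably many vertices, all of degree 3 and all
  balanced; pruning it produces such graphs with infinitely many vertices and any number of
  boundary points. Together with boundedness the condition makes \<open>V\<close> finite
  (lemma \<open>plane_graph_finite\<close>), so that \<open>vertex_degree\<close> is the true degree and all sums over
  neighbours are finite.
\<close>

definition plane_graph :: "complex set \<Rightarrow> complex set set \<Rightarrow> bool" where
  "plane_graph V E \<longleftrightarrow>
     countable V \<and>
     (\<forall>e\<in>E. e \<subseteq> V \<and> card e = 2) \<and>
     (\<forall>u v. {u, v} \<in> E \<longrightarrow> open_segment u v \<inter> V = {}) \<and>
     (\<forall>e\<in>E. \<forall>e'\<in>E. e \<noteq> e' \<longrightarrow> convex hull e \<inter> convex hull e' \<subseteq> V) \<and>
     bounded (drawing V E) \<and>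
     (\<forall>p. \<not> p islimpt V) \<and>
     finite (boundary_points V E) \<and>
     (\<forall>v\<in>V. vertex_degree E v \<noteq> 2)"

text \<open>For \<open>w \<noteq> v\<close>, \<open>sgn (w - v)\<close> is the unit vector pointing from \<open>v\<close> towards \<open>w\<close>.\<close>

definition critical :: "complex set \<Rightarrow> complex set set \<Rightarrow> bool" where
  "critical V E \<longleftrightarrow>
     plane_graph V E \<and>
     (\<forall>v \<in> V - boundary_points V E. (\<Sum>w\<in>neighbours E v. sgn (w - v)) = 0)"

definition three_boundary_regular :: "complex set \<Rightarrow> complex set set \<Rightarrow> bool" where
  "three_boundary_regular V E \<longleftrightarrow> (\<forall>v \<in> V - boundary_points V E. vertex_degree E v = 3)"

definition critical3 :: "nat \<Rightarrow> (complex set \<times> complex set set) set" where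
  "critical3 n =
     {(V, E). critical V E \<and> three_boundary_regular V E \<and> card (boundary_points V E) = n}"

definition num_vertices :: "complex set \<times> complex set set \<Rightarrow> enat" where
  "num_vertices G = (if finite (fst G) then enat (card (fst G)) else \<infinity>)"

definition f3 :: "nat \<Rightarrow> enat" where
  "f3 n = (SUP G\<in>critical3 n. num_vertices G)"

definition maximisers3 :: "nat \<Rightarrow> (complex set \<times> complex set set) set" where
  "maximisers3 n = {G \<in> critical3 n. num_vertices G = f3 n}"

definition graph_isomorphic ::
    "complex set \<times> complex set set \<Rightarrow> complex set \<times> complex set set \<Rightarrow> bool" where
  "graph_isomorphic G H \<longleftrightarrow>
     (\<exists>f. bij_betw f (fst G) (fst H) \<and>
          (\<forall>u \<in> fst G. \<forall>v \<in> fst G. {u, v} \<in> snd G \<longleftrightarrow> {f u, f v} \<in> snd H))"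

lemma plane_graph_finite:
  assumes "plane_graph V E"
  shows "finite V" and "finite E"
proof -
  have "bounded V"
    using assms unfolding plane_graph_def drawing_def by (meson bounded_subset sup_ge1)
  moreover have "\<forall>p. \<not> p islimpt V"
    using assms by (simp add: plane_graph_def)
  ultimately show "finite V"
    using bounded_infinite_imp_islimpt[of V V] by blast
  moreover have "E \<subseteq> Pow V"
    using assms by (auto simp: plane_graph_def)
  ultimately show "finite E"
    by (meson finite_Pow_iff finite_subset)
qed

end

theory Submission
  imports Defs
begin

text \<open>
  At an interior vertex the three edges enclose angles of 120 degrees, so after a rotation the edges
  of a component have only three directions, one of them vertical. Deleting the vertical edges leaves
  zigzags that are monotone in the abscissa. For disjoint such arcs the relation \<open>above\<close> is acyclic,
  so there is a topmost zigzag, and its upward edges end in leaves. Removing it and comparing the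
  numbers of leaves in each of the six directions shows by induction that the number \<open>m\<close> of interior
  vertices is at most the area of the lattice hexagon having these numbers as sides. In the case of
  equality all upward leaves hang from the top zigzag at every stage, so that the graph can be rebuilt
  from the six numbers in only one way.

  If the sides are \<open>p\<^sub>0\<close>, \<open>p\<^sub>1\<close>, \<open>p\<^sub>2\<close> and \<open>p\<^sub>0 + d\<close>, \<open>p\<^sub>1 + d\<close>, \<open>p\<^sub>2 + d\<close> with sum \<open>n\<close>, six times the area
  is \<open>n\<^sup>2 - 3 d\<^sup>2 - 2 ((p\<^sub>0 - p\<^sub>1)\<^sup>2 + (p\<^sub>1 - p\<^sub>2)\<^sup>2 + (p\<^sub>2 - p\<^sub>0)\<^sup>2)\<close>. Hence \<open>6 m \<le> n\<^sup>2\<close>, and \<open>m\<close> has the parity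
  of \<open>n\<close>; this gives the upper bound, which is attained by honeycomb patches. For a maximiser
  \<open>n\<^sup>2 - 6 m \<le> 7\<close>, which leaves one hexagon up to rotation and no room for components of different
  orientation.
\<close>

section \<open>Ranking arcs by height\<close>

text \<open>Edge lengths are arbitrary and the graph may be disconnected, so it need not lie on a
  common lattice, and the hexagon cannot be drawn around it. The dual picture survives
  combinatorially: an interior vertex corresponds to a unit triangle and a zigzag to a row of
  triangles, and stripping the top zigzag changes the leaf numbers as stripping the top row changes
  the sides of the hexagon. Area minus interior vertices thereby becomes a sum, over all stages, of
  three nonnegative defects: upward leaves that do not hang from the top zigzag, and the failure of
  its right or left end to be a source leaf although the net has such leaves. Equality annihilates
  all of them, and then the leaf numbers dictate every zigzag. The induction must survive deletion,
  so geometry enters it only through two real functions that restrict to subnets: the abscissa,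
  which orders a zigzag, and a rank, which says which zigzag is higher. The rank has to be
  constructed once, from the drawing.\<close>

lemma separating_real:
  fixes A B :: "real set"
  assumes "finite A" "finite B" "\<And>a b. a \<in> A \<Longrightarrow> b \<in> B \<Longrightarrow> a < b"
  obtains q where "\<And>a. a \<in> A \<Longrightarrow> a < q" "\<And>b. b \<in> B \<Longrightarrow> q < b"
proof (cases "A = {}")
  case True
  show ?thesis
  proof (cases "B = {}")
    case True
    with \<open>A = {}\<close> show ?thesis using that by blast
  next
    case False
    have "Min B - 1 < b" if "b \<in> B" for b
      using Min_le[OF assms(2) that] by linarith
    with \<open>A = {}\<close> show ?thesis using that[of "Min B - 1"] by blast
  qed
next
  case False
  note A = False
  show ?thesis
  proof (cases "B = {}")
    case True
    have "a < Max A + 1" if "a \<in> A" for a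
      using Max_ge[OF assms(1) that] by linarith
    with True show ?thesis using that[of "Max A + 1"] by blast
  next
    case False
    have "Max A < Min B"
      using assms A False by (meson Max_in Min_in)
    then obtain q where "Max A < q" "q < Min B" using dense by blast
    then show ?thesis
      using that[of q] Max_ge[OF assms(1)] Min_le[OF assms(2)] by (meson le_less_trans less_le_trans)
  qed
qed

text \<open>Let \<open>Q\<close> be an arc whose right end is leftmost. Every arc that overlaps
  \<open>Q\<close> in abscissa reaches the vertical line through this end, so the place of
  \<open>Q\<close> can be read off on one line. The induction ranks the other arcs and then inserts
  \<open>Q\<close>. \<open>J e e'\<close> stands for \<open>e'\<close> continuing \<open>e\<close>
  to the right.\<close>

lemma arcs_rank:
  fixes lft rgt :: "'e \<Rightarrow> real" and f :: "'e \<Rightarrow> real \<Rightarrow> real" and J :: "'e \<Rightarrow> 'e \<Rightarrow> bool"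
  assumes "finite A"
    and "\<And>e. e \<in> A \<Longrightarrow> lft e < rgt e"
    and "\<And>e. e \<in> A \<Longrightarrow> continuous_on {lft e..rgt e} (f e)"
    and "\<And>e e'. \<lbrakk>e \<in> A; e' \<in> A; J e e'\<rbrakk> \<Longrightarrow> rgt e = lft e' \<and> f e (rgt e) = f e' (rgt e)"
    and "\<And>e e' e''. \<lbrakk>e \<in> A; e' \<in> A; e'' \<in> A; J e e'; J e e''\<rbrakk> \<Longrightarrow> e' = e''"
    and "\<And>e e' t. \<lbrakk>e \<in> A; e' \<in> A; e \<noteq> e'; t \<in> {lft e..rgt e}; t \<in> {lft e'..rgt e'}; f e t = f e' t\<rbrakk>
      \<Longrightarrow> t = rgt e \<and> J e e' \<or> t = rgt e' \<and> J e' e"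
  shows "\<exists>h :: 'e \<Rightarrow> real.
      (\<forall>e\<in>A. \<forall>e'\<in>A. J e e' \<longrightarrow> h e = h e') \<and>
      (\<forall>e\<in>A. \<forall>e'\<in>A. \<forall>t \<in> {lft e..rgt e} \<inter> {lft e'..rgt e'}. f e t < f e' t \<longrightarrow> h e < h e')"
  using assms
proof (induction "card A" arbitrary: A)
  case 0
  then show ?case by simp
next
  case (Suc n)
  note lr = Suc.prems(2) and cont = Suc.prems(3) and J1 = Suc.prems(4) and J2 = Suc.prems(5)
    and meet = Suc.prems(6)
  have "A \<noteq> {}" using Suc.hyps(2) by auto
  then obtain Q where Q: "Q \<in> A" and Qmin: "\<And>e. e \<in> A \<Longrightarrow> rgt Q \<le> rgt e"
  proof -
    have "Min (rgt ` A) \<in> rgt ` A" using \<open>A \<noteq> {}\<close> Suc.prems(1) by (intro Min_in) auto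
    then obtain Q where "Q \<in> A" "rgt Q = Min (rgt ` A)" by auto
    then show ?thesis using that Suc.prems(1) by simp
  qed
  define B where "B = A - {Q}"
  have BA: "B \<subseteq> A" by (auto simp: B_def)
  have "\<exists>h :: 'e \<Rightarrow> real.
      (\<forall>e\<in>B. \<forall>e'\<in>B. J e e' \<longrightarrow> h e = h e') \<and>
      (\<forall>e\<in>B. \<forall>e'\<in>B. \<forall>t \<in> {lft e..rgt e} \<inter> {lft e'..rgt e'}. f e t < f e' t \<longrightarrow> h e < h e')"
  proof (rule Suc.hyps(1))
    show "n = card B" using Suc.hyps(2) Q Suc.prems(1) by (simp add: B_def)
    show "finite B" using Suc.prems(1) by (simp add: B_def)
    show "lft e < rgt e" if "e \<in> B" for e using lr that BA by blast
    show "continuous_on {lft e..rgt e} (f e)" if "e \<in> B" for e using cont that BA by blast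
    show "rgt e = lft e' \<and> f e (rgt e) = f e' (rgt e)" if "e \<in> B" "e' \<in> B" "J e e'" for e e'
      using J1 that BA by blast
    show "e' = e''" if "e \<in> B" "e' \<in> B" "e'' \<in> B" "J e e'" "J e e''" for e e' e''
      using J2 that BA by blast
    show "t = rgt e \<and> J e e' \<or> t = rgt e' \<and> J e' e"
      if "e \<in> B" "e' \<in> B" "e \<noteq> e'" "t \<in> {lft e..rgt e}" "t \<in> {lft e'..rgt e'}" "f e t = f e' t"
      for e e' t
      using meet[of e e' t] that BA by blast
  qed
  then obtain h :: "'e \<Rightarrow> real" where
    hJ: "\<And>e e'. \<lbrakk>e \<in> B; e' \<in> B; J e e'\<rbrakk> \<Longrightarrow> h e = h e'" and
    hl: "\<And>e e' t. \<lbrakk>e \<in> B; e' \<in> B; t \<in> {lft e..rgt e}; t \<in> {lft e'..rgt e'}; f e t < f e' t\<rbrakk> \<Longrightarrow> h e < h e'"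
    by blast
  define r where "r = rgt Q"
  have rQ: "r \<in> {lft Q..rgt Q}" using lr[OF Q] by (simp add: r_def)
  \<comment> \<open>Two arcs over a common abscissa cannot change places before \<open>r\<close>:
    equal heights would mean a joint, where one arc ends and the other begins, while both cover all
    of \<open>{t..r}\<close>. The intermediate value theorem moves the comparison from
    \<open>t\<close> to \<open>r\<close>.\<close>
  have push: "f P r \<noteq> f Q r \<and> r \<in> {lft P..rgt P} \<and> (f P r < f Q r \<longleftrightarrow> f P t < f Q t)"
    if P: "P \<in> B" and t: "t \<in> {lft P..rgt P}" "t \<in> {lft Q..rgt Q}" "f P t \<noteq> f Q t" for P t
  proof -
    have PA: "P \<in> A" and PQ: "P \<noteq> Q" using P by (auto simp: B_def)
    have tr: "t \<le> r" using t by (simp add: r_def)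
    have rP: "r \<in> {lft P..rgt P}" using t tr Qmin[OF PA] by (simp add: r_def)
    have ne: "f P u \<noteq> f Q u" if u: "u \<in> {t..r}" for u
    proof
      assume eq: "f P u = f Q u"
      then have "t < u" using u t(3) by (cases "t = u") auto
      have "u \<in> {lft P..rgt P}" "u \<in> {lft Q..rgt Q}" using u t rP rQ by auto
      from meet[OF PA Q PQ this eq] show False
        using J1[OF PA Q] J1[OF Q PA] t \<open>t < u\<close> by auto
    qed
    have "continuous_on {t..r} (\<lambda>u. f P u - f Q u)"
      by (intro continuous_on_diff continuous_on_subset[OF cont[OF PA]] continuous_on_subset[OF cont[OF Q]])
         (use t rP rQ in auto)
    then have IVT1: "f P t - f Q t \<le> 0 \<Longrightarrow> 0 \<le> f P r - f Q r \<Longrightarrow> \<exists>u\<in>{t..r}. f P u - f Q u = 0"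
      and IVT2: "f P r - f Q r \<le> 0 \<Longrightarrow> 0 \<le> f P t - f Q t \<Longrightarrow> \<exists>u\<in>{t..r}. f P u - f Q u = 0"
      using IVT'[of "\<lambda>u. f P u - f Q u" t 0 r] IVT2'[of "\<lambda>u. f P u - f Q u" r 0 t] tr by force+
    have "f P r < f Q r \<longleftrightarrow> f P t < f Q t"
      using IVT1 IVT2 ne by (smt (verit))
    then show ?thesis using ne[of r] tr rP by auto
  qed
  \<comment> \<open>If \<open>Q\<close> is continued by an arc, its height is forced and is
    consistent because the two agree at \<open>r\<close>. Otherwise the arcs below and above
    \<open>Q\<close> at \<open>r\<close> are already ranked apart, and any number in between will
    do.\<close>
  obtain q where qJ: "\<And>e. e \<in> B \<Longrightarrow> J Q e \<Longrightarrow> h e = q"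
    and ql: "\<And>P t. \<lbrakk>P \<in> B; t \<in> {lft P..rgt P}; t \<in> {lft Q..rgt Q}; f P t < f Q t\<rbrakk> \<Longrightarrow> h P < q"
    and qg: "\<And>P t. \<lbrakk>P \<in> B; t \<in> {lft P..rgt P}; t \<in> {lft Q..rgt Q}; f Q t < f P t\<rbrakk> \<Longrightarrow> q < h P"
  proof (cases "\<exists>e\<in>B. J Q e")
    case True
    then obtain Q' where Q': "Q' \<in> B" "J Q Q'" by blast
    then have Q'A: "Q' \<in> A" using BA by blast
    have v: "r = lft Q'" "f Q r = f Q' r" using J1[OF Q Q'A Q'(2)] by (auto simp: r_def)
    have r': "r \<in> {lft Q'..rgt Q'}" using v lr[OF Q'A] by auto
    show ?thesis
    proof
      show "h e = h Q'" if "e \<in> B" "J Q e" for e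
        using that J2 Q Q' BA by (metis subsetD)
      show "h P < h Q'" if "P \<in> B" "t \<in> {lft P..rgt P}" "t \<in> {lft Q..rgt Q}" "f P t < f Q t" for P t
        using push[OF that(1-3)] that(4) hl[OF that(1) Q'(1) _ r'] v by auto
      show "h Q' < h P" if "P \<in> B" "t \<in> {lft P..rgt P}" "t \<in> {lft Q..rgt Q}" "f Q t < f P t" for P t
        using push[OF that(1-3)] that(4) hl[OF Q'(1) that(1) r'] v by auto
    qed
  next
    case False
    define X where "X = {P \<in> B. \<exists>t \<in> {lft P..rgt P} \<inter> {lft Q..rgt Q}. f P t < f Q t}"
    define Y where "Y = {P \<in> B. \<exists>t \<in> {lft P..rgt P} \<inter> {lft Q..rgt Q}. f Q t < f P t}"
    have "a < b" if ab: "a \<in> h ` X" "b \<in> h ` Y" for a b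
    proof -
      obtain P R where P: "P \<in> X" "a = h P" and R: "R \<in> Y" "b = h R" using ab by blast
      have "f P r < f Q r" "r \<in> {lft P..rgt P}" using P push unfolding X_def by fastforce+
      moreover have "f Q r < f R r" "r \<in> {lft R..rgt R}" using R push unfolding Y_def
        by (fastforce dest!: push)+
      ultimately show ?thesis using hl[of P R r] P R unfolding X_def Y_def by auto
    qed
    moreover have "finite (h ` X)" "finite (h ` Y)" using Suc.prems(1) by (auto simp: X_def Y_def B_def)
    ultimately obtain q where "\<And>a. a \<in> h ` X \<Longrightarrow> a < q" "\<And>b. b \<in> h ` Y \<Longrightarrow> q < b"
      by (metis separating_real)
    then show ?thesis using that[of q] False unfolding X_def Y_def by blast
  qed
  have noJ: False if "e \<in> A" "J e Q" for e
    using J1[OF that(1) Q that(2)] Qmin[OF that(1)] lr[OF Q] by auto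
  define k where "k = h(Q := q)"
  have kQ: "k Q = q" and kB: "\<And>e. e \<in> B \<Longrightarrow> k e = h e" by (auto simp: k_def B_def)
  have AB: "e = Q \<or> e \<in> B" if "e \<in> A" for e using that by (auto simp: B_def)
  show ?case
  proof (intro exI[of _ k] conjI ballI impI)
    fix e e' assume "e \<in> A" "e' \<in> A" "J e e'"
    then show "k e = k e'"
      using AB[of e] AB[of e'] noJ hJ qJ kQ kB by metis
  next
    fix e e' t assume *: "e \<in> A" "e' \<in> A" "t \<in> {lft e..rgt e} \<inter> {lft e'..rgt e'}" "f e t < f e' t"
    then have "e \<noteq> e'" by auto
    then show "k e < k e'"
      using AB[OF *(1)] AB[OF *(2)] * hl[of e e' t] ql[of e t] qg[of e' t] kQ kB by auto
  qed
qed

section \<open>Hexagonal nets\<close>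

text \<open>Strict growth of \<open>x\<close> forbids repetitions, which bounds the length of a
  chain by the size of the field. A longest chain through \<open>a\<close> cannot be prolonged at
  either end.\<close>

lemma maximal_chain:
  fixes x :: "'a \<Rightarrow> real"
  assumes "finite R" and mono: "\<And>u v. (u, v) \<in> R \<Longrightarrow> x u < x v" and "(a, b) \<in> R"
  obtains p where "2 \<le> length p" "a \<in> set p" "successively (\<lambda>u v. (u, v) \<in> R) p"
    "hd p \<notin> Range R" "last p \<notin> Domain R"
proof -
  let ?C = "\<lambda>p. 2 \<le> length p \<and> a \<in> set p \<and> successively (\<lambda>u v. (u, v) \<in> R) p"
  have len: "length p \<le> card (Field R)" if "?C p" for p
  proof -
    have "successively (\<lambda>u v. x u < x v) p"
      using that successively_mono[of "\<lambda>u v. (u, v) \<in> R" p "\<lambda>u v. x u < x v"] mono by blast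
    then have "sorted_wrt (\<lambda>u v. x u < x v) p"
      by (subst successively_conv_sorted_wrt[symmetric]) (auto simp: transp_def)
    then have "distinct p" by (auto simp: sorted_wrt_iff_nth_less distinct_conv_nth nat_neq_iff) fastforce+
    have "v \<in> Field R" if v: "v \<in> set p" for v
    proof -
      obtain i where i: "i < length p" "v = p ! i" using v by (auto simp: in_set_conv_nth)
      show ?thesis
      proof (cases "Suc i < length p")
        case True
        then have "(p ! i, p ! Suc i) \<in> R" using \<open>?C p\<close> by (auto simp: successively_conv_nth)
        then show ?thesis using i by (auto simp: Field_def)
      next
        case False
        then obtain j where "i = Suc j" using i \<open>?C p\<close> by (cases i) auto
        then have "(p ! j, p ! i) \<in> R" using \<open>?C p\<close> i by (auto simp: successively_conv_nth)
        then show ?thesis using i by (auto simp: Field_def)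
      qed
    qed
    then have "set p \<subseteq> Field R" by blast
    then have "card (set p) \<le> card (Field R)" using assms(1) by (intro card_mono finite_Field)
    then show ?thesis using \<open>distinct p\<close> by (simp add: distinct_card)
  qed
  have "?C [a, b]" using assms(3) by simp
  then obtain p where p: "?C p" and pmax: "\<And>q. ?C q \<Longrightarrow> length q \<le> length p"
    using ex_has_greatest_nat[of ?C "[a, b]" length "Suc (card (Field R))"] len le_imp_less_Suc by blast
  have "p \<noteq> []" using p by auto
  have "hd p \<notin> Range R"
  proof
    assume "hd p \<in> Range R"
    then obtain c where "(c, hd p) \<in> R" by blast
    then have "?C (c # p)" using p \<open>p \<noteq> []\<close> by (auto simp: successively_Cons)
    from pmax[OF this] show False by simp
  qed
  moreover have "last p \<notin> Domain R"
  proof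
    assume "last p \<in> Domain R"
    then obtain c where "(last p, c) \<in> R" by blast
    then have "?C (p @ [c])" using p \<open>p \<noteq> []\<close> by (auto simp: successively_append_iff)
    from pmax[OF this] show False by simp
  qed
  ultimately show ?thesis using that p by blast
qed

lemma card_split: "C = A \<union> B \<Longrightarrow> A \<inter> B = {} \<Longrightarrow> finite C \<Longrightarrow> card C = card A + card B"
  by (simp add: card_Un_disjoint)

lemma matching_card:
  assumes "single_valued E" "single_valued (E\<inverse>)"
  shows "card (Domain E) = card (Range E)"
proof -
  have "inj_on fst E" "inj_on snd E"
    using assms by (auto simp: single_valued_def inj_on_def)
  then have "card (fst ` E) = card (snd ` E)" by (simp add: card_image)
  then show ?thesis by (simp add: Domain_fst Range_snd)
qed

text \<open>The edges of a rotated critical graph, directed away from the vertices that have an upward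
  edge: \<open>E0\<close>, \<open>E1\<close>, \<open>E2\<close> contain the edges pointing in the directions 90, -30 and 210 degrees.
  A vertex in at least two of the domains (or of the ranges) is an interior vertex, the others are
  leaves. The abscissa is \<open>x\<close>; the zigzags formed by the edges in \<open>E1\<close> and \<open>E2\<close> are ranked by \<open>h\<close>,
  which is all that remains of planarity.\<close>

locale hexnet =
  fixes E0 E1 E2 :: "'a rel" and x h :: "'a \<Rightarrow> real"
  assumes finite_edges: "finite E0" "finite E1" "finite E2"
    and single_valued: "single_valued E0" "single_valued E1" "single_valued E2"
    and sv_converse: "single_valued (E0\<inverse>)" "single_valued (E1\<inverse>)" "single_valued (E2\<inverse>)"
    and bipartite:
      "(Domain E0 \<union> Domain E1 \<union> Domain E2) \<inter> (Range E0 \<union> Range E1 \<union> Range E2) = {}"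
    and sources: "Domain E0 \<inter> Domain E1 = Domain E1 \<inter> Domain E2"
      "Domain E0 \<inter> Domain E2 = Domain E1 \<inter> Domain E2"
    and sinks: "Range E0 \<inter> Range E1 = Range E1 \<inter> Range E2"
      "Range E0 \<inter> Range E2 = Range E1 \<inter> Range E2"
    and x0: "(u, v) \<in> E0 \<Longrightarrow> x u = x v"
    and x1: "(u, v) \<in> E1 \<Longrightarrow> x u < x v"
    and x2: "(u, v) \<in> E2 \<Longrightarrow> x v < x u"
    and h0: "(u, v) \<in> E0 \<Longrightarrow> u \<in> Domain E1 \<Longrightarrow> v \<in> Range E1 \<Longrightarrow> h u < h v"
    and h1: "(u, v) \<in> E1 \<Longrightarrow> h u = h v"
    and h2: "(u, v) \<in> E2 \<Longrightarrow> h u = h v"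

definition inner_count :: "'a rel \<Rightarrow> 'a rel \<Rightarrow> nat" where
  "inner_count E0 E1 = card (Domain E0 \<inter> Domain E1) + card (Range E0 \<inter> Range E1)"

definition src_leaves :: "'a rel \<Rightarrow> 'a rel \<Rightarrow> nat" where
  "src_leaves E E' = card (Domain E - Domain E')"

definition sink_leaves :: "'a rel \<Rightarrow> 'a rel \<Rightarrow> nat" where
  "sink_leaves E E' = card (Range E - Range E')"

text \<open>The number of unit triangles in an equiangular lattice hexagon with sides \<open>a\<close>, \<open>c\<close>, \<open>b\<close>, \<open>_\<close>,
  \<open>d\<close>, \<open>_\<close> in cyclic order: a triangle of side \<open>a + c + b\<close> without three corners. It is dual to a
  patch of the honeycomb whose leaves in the six directions are counted by the sides.\<close>

definition hexagon_area :: "nat \<Rightarrow> nat \<Rightarrow> nat \<Rightarrow> nat \<Rightarrow> int" where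
  "hexagon_area a c b d = (int a + int c + int b)\<^sup>2 - (int a)\<^sup>2 - (int b)\<^sup>2 - (int d)\<^sup>2"

abbreviation net_area :: "'a rel \<Rightarrow> 'a rel \<Rightarrow> 'a rel \<Rightarrow> int" where
  "net_area E0 E1 E2 \<equiv> hexagon_area (src_leaves E2 E0) (sink_leaves E0 E1)
    (src_leaves E1 E0) (src_leaves E0 E1)"

text \<open>\<open>p\<close> is a topmost zigzag, listed from left to right.\<close>

locale hexnet_top = hexnet +
  fixes p
  assumes len: "2 \<le> length p"
    and chain: "successively (\<lambda>u v. (u, v) \<in> E1 \<union> E2\<inverse>) p"
    and no_left: "hd p \<notin> Range E1" "hd p \<notin> Domain E2"
    and no_right: "last p \<notin> Domain E1" "last p \<notin> Range E2"
    and top: "v \<in> set p \<Longrightarrow> w \<in> Field (E1 \<union> E2) \<Longrightarrow> h w \<le> h v"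

lemma (in hexnet) finite_ends: "finite (Domain E0)" "finite (Domain E1)" "finite (Domain E2)"
  "finite (Range E0)" "finite (Range E1)" "finite (Range E2)"
  using finite_edges by (auto intro: finite_Domain finite_Range)

lemma (in hexnet) ex_top:
  assumes "E1 \<union> E2 \<noteq> {}"
  obtains p where "hexnet_top E0 E1 E2 x h p"
proof -
  let ?R = "E1 \<union> E2\<inverse>"
  have Rmono: "x u < x v" if "(u, v) \<in> ?R" for u v using that x1 x2 by auto
  have Rh: "h u = h v" if "(u, v) \<in> ?R" for u v using that h1 h2 by force
  let ?F = "Field (E1 \<union> E2)"
  have FR: "?F = Domain ?R \<union> Range ?R" by (auto simp: Field_def)
  have fF: "finite ?F" using finite_edges by (intro finite_Field) auto
  have neF: "?F \<noteq> {}" using assms by (auto simp: Field_def)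
  have "Max (h ` ?F) \<in> h ` ?F" using fF neF by (intro Max_in) auto
  then obtain a where a: "a \<in> ?F" "h a = Max (h ` ?F)" by (metis (no_types, lifting) imageE)
  obtain a' b' where ab: "(a', b') \<in> ?R" "h a' = h a"
    using a(1) Rh unfolding FR by (metis DomainE RangeE UnE)
  have "finite ?R" using finite_edges by auto
  from maximal_chain[where x = x and R = ?R, OF this Rmono ab(1)] obtain p where p: "2 \<le> length p" "a' \<in> set p"
    "successively (\<lambda>u v. (u, v) \<in> ?R) p" "hd p \<notin> Range ?R" "last p \<notin> Domain ?R" by blast
  have "successively (\<lambda>u v. h u = h v) p"
    using successively_mono[OF p(3), of "\<lambda>u v. h u = h v"] Rh by blast
  then have "sorted_wrt (\<lambda>u v. h u = h v) p"
    by (subst successively_conv_sorted_wrt[symmetric]) (auto simp: transp_def)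
  then have "h v = h w" if "v \<in> set p" "w \<in> set p" for v w
    using that unfolding sorted_wrt_iff_nth_less in_set_conv_nth by (metis nat_neq_iff)
  then have hp: "h v = Max (h ` ?F)" if "v \<in> set p" for v using that p(2) a(2) ab(2) by metis
  have "hexnet_top E0 E1 E2 x h p"
    by unfold_locales (use p hp fF in auto)
  then show ?thesis using that by blast
qed

section \<open>Stripping the topmost zigzag\<close>

context hexnet_top
begin

abbreviation "P \<equiv> set p"

text \<open>Vertical edges rising from the zigzag are deleted with it, while those reaching it from
  below stay: their upper ends, the inner sinks of the zigzag, become upward leaves of the remaining
  net. For \<open>F1\<close> and \<open>F2\<close> a test of the source suffices, as these edges lie
  on the zigzag with both ends or with none.\<close>

definition "F0 = {(u, v) \<in> E0. u \<notin> P}"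
definition "F1 = {(u, v) \<in> E1. u \<notin> P}"
definition "F2 = {(u, v) \<in> E2. u \<notin> P}"

lemma p_nonempty: "p \<noteq> []" using len by auto

lemma step: "Suc i < length p \<Longrightarrow> (p ! i, p ! Suc i) \<in> E1 \<or> (p ! Suc i, p ! i) \<in> E2"
  using chain by (auto simp: successively_conv_nth)

lemma sorted: "sorted_wrt (\<lambda>u v. x u < x v) p"
proof -
  have "successively (\<lambda>u v. x u < x v) p"
    using successively_mono[OF chain, of "\<lambda>u v. x u < x v"] x1 x2 by blast
  then show ?thesis
    by (subst successively_conv_sorted_wrt[symmetric]) (auto simp: transp_def)
qed

lemma x_nth: "i < length p \<Longrightarrow> j < length p \<Longrightarrow> x (p ! i) < x (p ! j) \<longleftrightarrow> i < j"
  using sorted unfolding sorted_wrt_iff_nth_less by (metis less_asym nat_neq_iff order_less_irrefl)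

lemma distinct: "distinct p"
  unfolding distinct_conv_nth using x_nth by (metis nat_neq_iff order_less_irrefl)

lemma inj_x: "inj_on x P"
  by (auto simp: inj_on_def in_set_conv_nth) (metis x_nth nat_neq_iff order_less_irrefl)

lemma has_right: "v \<in> P \<Longrightarrow> v \<noteq> last p \<Longrightarrow> v \<in> Domain E1 \<union> Range E2"
proof -
  assume "v \<in> P" "v \<noteq> last p"
  then obtain i where i: "i < length p" "v = p ! i" by (auto simp: in_set_conv_nth)
  moreover have "i \<noteq> length p - 1" using i \<open>v \<noteq> last p\<close> p_nonempty by (auto simp: last_conv_nth)
  ultimately have "Suc i < length p" by auto
  from step[OF this] show ?thesis using i by blast
qed

lemma has_left: "v \<in> P \<Longrightarrow> v \<noteq> hd p \<Longrightarrow> v \<in> Range E1 \<union> Domain E2"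
proof -
  assume "v \<in> P" "v \<noteq> hd p"
  then obtain i where i: "i < length p" "v = p ! i" by (auto simp: in_set_conv_nth)
  then obtain j where "i = Suc j" using \<open>v \<noteq> hd p\<close> p_nonempty by (cases i) (auto simp: hd_conv_nth)
  then show ?thesis using step[of j] i by blast
qed

lemma hd_neq_last: "hd p \<noteq> last p"
  using distinct len p_nonempty by (auto simp: hd_conv_nth last_conv_nth nth_eq_iff_index_eq)

lemma P_in: "hd p \<in> P" "last p \<in> P" using p_nonempty by auto

lemma P_edge: "v \<in> P \<Longrightarrow> v \<in> Domain E1 \<union> Range E1 \<union> Domain E2 \<union> Range E2"
  using has_left has_right hd_neq_last by blast

text \<open>A vertex of the list with an edge to the right is not the last one, and
  single-valuedness identifies that edge with the step that the list takes; likewise on the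
  left.\<close>

lemma closed1: assumes "(u, v) \<in> E1" shows "u \<in> P \<longleftrightarrow> v \<in> P"
proof
  assume "u \<in> P"
  then obtain i where i: "i < length p" "u = p ! i" by (auto simp: in_set_conv_nth)
  have "u \<noteq> last p" using no_right assms by blast
  then have "Suc i < length p" using i p_nonempty by (metis last_conv_nth Suc_lessI diff_Suc_1)
  moreover have "(p ! Suc i, u) \<notin> E2" using bipartite assms by blast
  ultimately have "(u, p ! Suc i) \<in> E1" using step i by blast
  then show "v \<in> P" using assms single_valued(2) \<open>Suc i < length p\<close> by (metis single_valuedD nth_mem)
next
  assume "v \<in> P"
  then obtain i where i: "i < length p" "v = p ! i" by (auto simp: in_set_conv_nth)
  have "v \<noteq> hd p" using no_left assms by blast
  then obtain j where j: "i = Suc j" using i p_nonempty by (cases i) (auto simp: hd_conv_nth)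
  moreover have "(v, p ! j) \<notin> E2" using bipartite assms by blast
  ultimately have "(p ! j, v) \<in> E1" using step i by blast
  then have "u = p ! j" using assms sv_converse(2) by (meson converse_iff single_valuedD)
  then show "u \<in> P" using i j by simp
qed

lemma closed2: assumes "(u, v) \<in> E2" shows "u \<in> P \<longleftrightarrow> v \<in> P"
proof
  assume "v \<in> P"
  then obtain i where i: "i < length p" "v = p ! i" by (auto simp: in_set_conv_nth)
  have "v \<noteq> last p" using no_right assms by blast
  then have "Suc i < length p" using i p_nonempty by (metis last_conv_nth Suc_lessI diff_Suc_1)
  moreover have "(v, p ! Suc i) \<notin> E1" using bipartite assms by blast
  ultimately have "(p ! Suc i, v) \<in> E2" using step i by blast
  then have "u = p ! Suc i" using assms sv_converse(3) by (meson converse_iff single_valuedD)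
  then show "u \<in> P" using \<open>Suc i < length p\<close> by simp
next
  assume "u \<in> P"
  then obtain i where i: "i < length p" "u = p ! i" by (auto simp: in_set_conv_nth)
  have "u \<noteq> hd p" using no_left assms by blast
  then obtain j where j: "i = Suc j" using i p_nonempty by (cases i) (auto simp: hd_conv_nth)
  moreover have "(p ! j, u) \<notin> E1" using bipartite assms by blast
  ultimately have "(u, p ! j) \<in> E2" using step i by blast
  then show "v \<in> P" using assms single_valued(3) i j by (metis single_valuedD nth_mem Suc_lessD)
qed

lemma P_source: "v \<in> P \<Longrightarrow> v \<in> Domain E0 \<Longrightarrow> v \<in> Domain E1 \<and> v \<in> Domain E2"
  using P_edge bipartite sources by blast

lemma P_sink: "v \<in> P \<Longrightarrow> v \<in> Range E0 \<Longrightarrow> v \<in> Range E1 \<and> v \<in> Range E2"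
  using P_edge bipartite sinks by blast

text \<open>An upper end lying on a zigzag would be ranked above the topmost one.\<close>

lemma up_leaf: "E0 `` P \<inter> (Range E1 \<union> Range E2) = {}"
proof -
  have False if "u \<in> P" "(u, v) \<in> E0" "v \<in> Range E1" for u v
  proof -
    have "u \<in> Domain E1" using P_source that by blast
    then have "h u < h v" using h0 that by blast
    moreover have "h v \<le> h u" using top that by (auto simp: Field_def)
    ultimately show False by simp
  qed
  then show ?thesis using sinks by blast
qed

lemma up_notin: "E0 `` P \<inter> P = {}"
  using up_leaf P_sink by blast

lemma Domain_F: "Domain F0 = Domain E0 - P" "Domain F1 = Domain E1 - P" "Domain F2 = Domain E2 - P"
  by (auto simp: F0_def F1_def F2_def)

lemma Range_F1: "Range F1 = Range E1 - P" and Range_F2: "Range F2 = Range E2 - P"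
  using closed1 closed2 by (auto simp: F1_def F2_def)

lemma Range_F0: "Range F0 = Range E0 - E0 `` P"
  using sv_converse(1) by (auto simp: F0_def single_valued_def)

lemmas Ends_F = Domain_F Range_F0 Range_F1 Range_F2

lemma hexnet_F: "hexnet F0 F1 F2 x h"
proof
  show "finite F0" "finite F1" "finite F2"
    using finite_edges by (auto simp: F0_def F1_def F2_def intro: finite_subset)
  show "single_valued F0" "single_valued F1" "single_valued F2"
    "single_valued (F0\<inverse>)" "single_valued (F1\<inverse>)" "single_valued (F2\<inverse>)"
    using single_valued sv_converse
    by (auto simp: F0_def F1_def F2_def single_valued_def)
  show "(Domain F0 \<union> Domain F1 \<union> Domain F2) \<inter> (Range F0 \<union> Range F1 \<union> Range F2) = {}"
    using bipartite unfolding Ends_F by blast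
  show "Domain F0 \<inter> Domain F1 = Domain F1 \<inter> Domain F2"
    "Domain F0 \<inter> Domain F2 = Domain F1 \<inter> Domain F2"
    using sources unfolding Ends_F by blast+
  show "Range F0 \<inter> Range F1 = Range F1 \<inter> Range F2"
    "Range F0 \<inter> Range F2 = Range F1 \<inter> Range F2"
    using sinks up_leaf unfolding Ends_F by blast+
  show "h u < h v" if "(u, v) \<in> F0" "u \<in> Domain F1" "v \<in> Range F1" for u v
    using that h0 unfolding Ends_F F0_def by blast
qed (use x0 x1 x2 h1 h2 in \<open>auto simp: F0_def F1_def F2_def\<close>)

definition "L = card (Domain E0 \<inter> P)"
definition "R = card (Range E0 \<inter> P)"
definition "eps1 = (if last p \<in> Domain E2 then 1 else 0 :: nat)"
definition "eps3 = (if hd p \<in> Domain E1 then 1 else 0 :: nat)"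

lemma finite_ends_F: "finite (Domain F0)" "finite (Domain F1)" "finite (Domain F2)"
  "finite (Range F0)" "finite (Range F1)" "finite (Range F2)"
  using finite_ends by (auto simp: Ends_F)

text \<open>The \<open>E1\<close> edges match sources with sinks along the zigzag. Their sources are
  the inner ones and possibly the left end, their sinks the inner ones and possibly the right
  end.\<close>

lemma balance_P: "L + eps3 + eps1 = R + 1"
proof -
  let ?X = "E1 \<inter> (P \<times> P)"
  have "card (Domain ?X) = card (Range ?X)"
    using single_valued(2) sv_converse(2)
    by (intro matching_card) (auto simp: single_valued_def)
  moreover have "Domain ?X = Domain E1 \<inter> P" "Range ?X = Range E1 \<inter> P" using closed1 by blast+
  moreover have "Domain E1 \<inter> P = (Domain E0 \<inter> P) \<union> ({hd p} \<inter> Domain E1)"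
    using P_source has_left bipartite sources P_in by blast
  moreover have "(Domain E0 \<inter> P) \<inter> ({hd p} \<inter> Domain E1) = {}"
    using no_left sources by blast
  moreover have "Range E1 \<inter> P = (Range E0 \<inter> P) \<union> ({last p} \<inter> Range E1)"
    using P_sink has_right bipartite sinks P_in by blast
  moreover have "(Range E0 \<inter> P) \<inter> ({last p} \<inter> Range E1) = {}"
    using no_right sinks by blast
  ultimately have "L + card ({hd p} \<inter> Domain E1) = R + card ({last p} \<inter> Range E1)"
    unfolding L_def R_def by (simp add: card_Un_disjoint)
  moreover have "last p \<in> Range E1 \<longleftrightarrow> last p \<notin> Domain E2"
    using has_left[OF P_in(2) not_sym[OF hd_neq_last]] bipartite by blast
  moreover have "card ({hd p} \<inter> Domain E1) = eps3" by (simp add: eps3_def Int_insert_left)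
  moreover have "card ({last p} \<inter> Range E1) = (if last p \<in> Range E1 then 1 else 0)"
    by (simp add: Int_insert_left)
  ultimately show ?thesis unfolding eps1_def by auto
qed

lemma card_up: "card (E0 `` P) = L"
proof -
  let ?X = "E0 \<inter> (P \<times> UNIV)"
  have "card (Domain ?X) = card (Range ?X)"
    using single_valued(1) sv_converse(1)
    by (intro matching_card) (auto simp: single_valued_def)
  moreover have "Domain ?X = Domain E0 \<inter> P" "Range ?X = E0 `` P" by auto
  ultimately show ?thesis by (simp add: L_def)
qed

lemma up_leaves_F: "Range F0 - Range F1 = (Range E0 - Range E1 - E0 `` P) \<union> (Range E0 \<inter> P)"
  unfolding Ends_F using up_notin P_sink by blast

lemma up_leaves_subset: "E0 `` P \<subseteq> Range E0 - Range E1"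
  using up_leaf by blast

text \<open>The \<open>L\<close> leaves above the zigzag disappear, and its \<open>R\<close> inner
  sinks turn into upward leaves.\<close>

lemma count_up: "sink_leaves F0 F1 + L = sink_leaves E0 E1 + R"
proof -
  have "card (Range E0 - Range E1 - E0 `` P) + L = sink_leaves E0 E1"
    unfolding sink_leaves_def card_up[symmetric] using up_leaves_subset finite_ends
    by (simp add: card_Diff_subset card_mono finite_subset)
  moreover have "sink_leaves F0 F1 = card (Range E0 - Range E1 - E0 `` P) + R"
    unfolding sink_leaves_def up_leaves_F R_def using finite_ends P_sink
    by (intro card_Un_disjoint) auto
  ultimately show ?thesis by simp
qed

lemma up_le: "L \<le> sink_leaves E0 E1"
  unfolding sink_leaves_def card_up[symmetric] using up_leaves_subset finite_ends
  by (intro card_mono) auto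

lemma count_down: "src_leaves F0 F1 = src_leaves E0 E1"
proof -
  have "Domain F0 - Domain F1 = Domain E0 - Domain E1" unfolding Ends_F using P_source by blast
  then show ?thesis by (simp add: src_leaves_def)
qed

lemma count_left: "src_leaves E1 E0 = src_leaves F1 F0 + eps3"
proof -
  have "v = hd p" if "v \<in> P" "v \<in> Domain E1" "v \<notin> Domain E0" for v
    using has_left[OF that(1)] that(2,3) bipartite sources by blast
  moreover have "hd p \<notin> Domain E0" if "hd p \<in> Domain E1"
    using that no_left sources by blast
  ultimately have "Domain E1 - Domain E0 = (Domain F1 - Domain F0) \<union> ({hd p} \<inter> Domain E1)"
    unfolding Domain_F using P_in by blast
  moreover have "(Domain F1 - Domain F0) \<inter> ({hd p} \<inter> Domain E1) = {}"
    unfolding Ends_F using P_in by blast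
  ultimately have "src_leaves E1 E0 = src_leaves F1 F0 + card ({hd p} \<inter> Domain E1)"
    unfolding src_leaves_def using finite_ends finite_ends_F by (intro card_split) auto
  then show ?thesis by (simp add: eps3_def)
qed

lemma count_right: "src_leaves E2 E0 = src_leaves F2 F0 + eps1"
proof -
  have "v = last p" if "v \<in> P" "v \<in> Domain E2" "v \<notin> Domain E0" for v
    using has_right[OF that(1)] that(2,3) bipartite sources by blast
  moreover have "last p \<notin> Domain E0" if "last p \<in> Domain E2"
    using that no_right sources by blast
  ultimately have "Domain E2 - Domain E0 = (Domain F2 - Domain F0) \<union> ({last p} \<inter> Domain E2)"
    unfolding Domain_F using P_in by blast
  moreover have "(Domain F2 - Domain F0) \<inter> ({last p} \<inter> Domain E2) = {}"
    unfolding Ends_F using P_in by blast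
  ultimately have "src_leaves E2 E0 = src_leaves F2 F0 + card ({last p} \<inter> Domain E2)"
    unfolding src_leaves_def using finite_ends finite_ends_F by (intro card_split) auto
  then show ?thesis by (simp add: eps1_def)
qed

lemma count_interior: "inner_count E0 E1 = inner_count F0 F1 + L + R"
proof -
  have "Domain E0 \<inter> Domain E1 = (Domain F0 \<inter> Domain F1) \<union> (Domain E0 \<inter> P)"
    unfolding Ends_F using P_source by blast
  moreover have "(Domain F0 \<inter> Domain F1) \<inter> (Domain E0 \<inter> P) = {}" unfolding Ends_F by blast
  ultimately have "card (Domain E0 \<inter> Domain E1) = card (Domain F0 \<inter> Domain F1) + L"
    unfolding L_def using finite_ends finite_ends_F by (intro card_split) auto
  moreover have "Range E0 \<inter> Range E1 = (Range F0 \<inter> Range F1) \<union> (Range E0 \<inter> P)"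
    unfolding Ends_F using P_sink up_leaf by blast
  moreover have "(Range F0 \<inter> Range F1) \<inter> (Range E0 \<inter> P) = {}" unfolding Ends_F by blast
  ultimately have "card (Range E0 \<inter> Range E1) = card (Range F0 \<inter> Range F1) + R"
    unfolding R_def using finite_ends finite_ends_F by (intro card_split) auto
  then show ?thesis using \<open>card (Domain E0 \<inter> Domain E1) = _\<close> by (simp add: inner_count_def)
qed

text \<open>The last three summands are the defects: upward leaves hanging from elsewhere, and a
  right or left end that is not a source leaf although the net has such leaves. Without them the
  difference is the top row of the hexagon, one triangle for each of the \<open>L + R\<close> inner
  vertices of the zigzag.\<close>

lemma area_diff: "net_area E0 E1 E2 - net_area F0 F1 F2 = int (L + R) + 2 * (int (sink_leaves E0 E1) - int L)
    + 2 * (1 - int eps1) * int (src_leaves E2 E0) + 2 * (1 - int eps3) * int (src_leaves E1 E0)"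
proof -
  have e: "eps1 = 0 \<or> eps1 = 1" "eps3 = 0 \<or> eps3 = 1" by (auto simp: eps1_def eps3_def)
  define a where "a = src_leaves F2 F0"
  define b where "b = src_leaves F1 F0"
  define c where "c = sink_leaves F0 F1"
  have a: "int (src_leaves E2 E0) = int a + int eps1" using count_right by (simp add: a_def)
  have b: "int (src_leaves E1 E0) = int b + int eps3" using count_left by (simp add: b_def)
  have c: "int (sink_leaves E0 E1) = int c + int L - int R" using count_up by (simp add: c_def)
  have l: "int R = int L + int eps3 + int eps1 - 1" using balance_P by simp
  show ?thesis
    unfolding hexagon_area_def a b c count_down a_def[symmetric] b_def[symmetric] c_def[symmetric]
      of_nat_add l
    using e by (elim disjE) (simp_all add: power2_eq_square algebra_simps)
qed

text \<open>The surplus of the area over the interior vertices drops by exactly the defects. This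
  gives the bound by induction and lets equality pass down to the remaining net.\<close>

lemma area_step: "int (inner_count E0 E1) - net_area E0 E1 E2 + 2 * (int (sink_leaves E0 E1) - int L)
    + 2 * (1 - int eps1) * int (src_leaves E2 E0) + 2 * (1 - int eps3) * int (src_leaves E1 E0)
    = int (inner_count F0 F1) - net_area F0 F1 F2"
  using area_diff by (simp add: count_interior)

lemma defects_nonneg: "0 \<le> 2 * (int (sink_leaves E0 E1) - int L)"
  "0 \<le> 2 * (1 - int eps1) * int (src_leaves E2 E0)" "0 \<le> 2 * (1 - int eps3) * int (src_leaves E1 E0)"
  using up_le by (auto simp: eps1_def eps3_def)

lemma card_decrease: "card (F1 \<union> F2) < card (E1 \<union> E2)"
proof -
  have "Suc 0 < length p" using len by simp
  moreover from this have "p ! 0 \<in> P" "p ! Suc 0 \<in> P" by (auto intro: nth_mem)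
  ultimately obtain u v where uv: "(u, v) \<in> E1 \<union> E2" "u \<in> P"
    using step[of 0] by blast
  then have "(u, v) \<notin> F1 \<union> F2" by (auto simp: F1_def F2_def)
  then have "F1 \<union> F2 \<noteq> E1 \<union> E2" using uv by blast
  then have "F1 \<union> F2 \<subset> E1 \<union> E2" by (auto simp: F1_def F2_def)
  then show ?thesis using finite_edges by (intro psubset_card_mono) auto
qed

end

theorem hexnet_bound:
  assumes "hexnet E0 E1 E2 x h"
  shows "int (inner_count E0 E1) \<le> net_area E0 E1 E2"
  using assms
proof (induction "card (E1 \<union> E2)" arbitrary: E0 E1 E2 rule: less_induct)
  case less
  then interpret hexnet E0 E1 E2 x h by simp
  show ?case
  proof (cases "E1 \<union> E2 = {}")
    case True
    \<comment> \<open>Only vertical edges are left, each with a leaf at both ends, so the hexagon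
      has \<open>a = b = 0\<close> and \<open>c = d\<close> and its area vanishes.\<close>
    have "card (Domain E0) = card (Range E0)"
      using single_valued(1) sv_converse(1) by (rule matching_card)
    then show ?thesis using True
      by (simp add: inner_count_def src_leaves_def sink_leaves_def hexagon_area_def)
  next
    case False
    then obtain p where "hexnet_top E0 E1 E2 x h p" using ex_top by blast
    then interpret hexnet_top E0 E1 E2 x h p .
    have "int (inner_count F0 F1) \<le> net_area F0 F1 F2"
      using less.hyps[OF card_decrease hexnet_F] .
    then show ?thesis using area_step defects_nonneg by linarith
  qed
qed

section \<open>Uniqueness of extremal nets\<close>

lemma finite_order_iso:
  fixes x :: "'a \<Rightarrow> real" and y :: "'b \<Rightarrow> real"
  assumes "finite A" "finite B" "card A = card B" "inj_on x A" "inj_on y B"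
  shows "\<exists>g. bij_betw g A B \<and> (\<forall>v\<in>A. \<forall>w\<in>A. x v < x w \<longrightarrow> y (g v) < y (g w))"
  using assms
proof (induction "card A" arbitrary: A B)
  case 0
  then have "A = {}" "B = {}" by auto
  then show ?case by (auto simp: bij_betw_def)
next
  case (Suc n)
  have ne: "A \<noteq> {}" "B \<noteq> {}" using Suc.hyps(2) Suc.prems by auto
  have "Max (x ` A) \<in> x ` A" "Max (y ` B) \<in> y ` B" using Suc.prems ne by (auto intro!: Max_in)
  then obtain a b where a: "a \<in> A" "x a = Max (x ` A)" and b: "b \<in> B" "y b = Max (y ` B)"
    by (metis imageE)
  have xa: "x v \<le> x a" if "v \<in> A" for v using that a Suc.prems(1) by simp
  have yb: "y v < y b" if "v \<in> B - {b}" for v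
  proof -
    have "y v \<le> y b" using that b Suc.prems(2) by simp
    moreover have "y v \<noteq> y b" using that b(1) Suc.prems(5) by (metis Diff_iff inj_onD singletonI)
    ultimately show ?thesis by simp
  qed
  have "\<exists>g. bij_betw g (A - {a}) (B - {b}) \<and>
      (\<forall>v\<in>A - {a}. \<forall>w\<in>A - {a}. x v < x w \<longrightarrow> y (g v) < y (g w))"
    using Suc.hyps Suc.prems a b by (intro Suc.hyps(1)) (auto intro: inj_on_subset)
  then obtain g where g: "bij_betw g (A - {a}) (B - {b})"
    "\<And>v w. v \<in> A - {a} \<Longrightarrow> w \<in> A - {a} \<Longrightarrow> x v < x w \<Longrightarrow> y (g v) < y (g w)" by blast
  let ?g = "g(a := b)"
  have "bij_betw ?g (A - {a}) (B - {b})"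
    using g(1) bij_betw_cong[of "A - {a}" ?g g "B - {b}"] by auto
  moreover have "bij_betw ?g {a} {b}" by (simp add: bij_betw_def)
  ultimately have "bij_betw ?g ((A - {a}) \<union> {a}) ((B - {b}) \<union> {b})"
    by (rule bij_betw_combine) auto
  then have "bij_betw ?g A B" using a(1) b(1) by (simp add: insert_absorb)
  moreover have "y (?g v) < y (?g w)" if "v \<in> A" "w \<in> A" "x v < x w" for v w
  proof -
    have "v \<noteq> a" using xa[OF that(2)] that(3) by auto
    moreover have "g v \<in> B - {b}" using \<open>v \<noteq> a\<close> that(1) g(1) by (auto dest: bij_betwE)
    ultimately show ?thesis using g(2)[of v w] that yb by auto
  qed
  ultimately show ?case by blast
qed

lemma strict_mono_self_map:
  fixes K :: "nat set"
  assumes "finite K" "\<And>i. i \<in> K \<Longrightarrow> g i \<in> K"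
    and "\<And>i j. i \<in> K \<Longrightarrow> j \<in> K \<Longrightarrow> i < j \<Longrightarrow> g i < g j" and "i \<in> K"
  shows "g i = i"
proof (rule ccontr)
  assume ne: "g i \<noteq> i"
  let ?X = "{i \<in> K. g i \<noteq> i}"
  have X: "?X \<noteq> {}" "finite ?X" using ne assms by auto
  have low: "\<not> g j < j" if "j \<in> K" for j
    using that
  proof (induction j rule: less_induct)
    case (less j)
    then show ?case using assms(2)[of j] assms(3)[of "g j" j] less.IH[of "g j"] by auto
  qed
  have m: "Max ?X \<in> ?X" using X by (intro Max_in)
  let ?m = "Max ?X"
  have "?m < g ?m" using m low[of ?m] by auto
  then have "g ?m < g (g ?m)" using m assms(2,3) by auto
  then have "g ?m \<in> ?X" using m assms(2) by auto
  then have "g ?m \<le> ?m" using X by (intro Max_ge)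
  then show False using \<open>?m < g ?m\<close> by simp
qed

definition net_vertices :: "'a rel \<Rightarrow> 'a rel \<Rightarrow> 'a rel \<Rightarrow> 'a set" where
  "net_vertices E0 E1 E2 = Field E0 \<union> Field E1 \<union> Field E2"

text \<open>The order clause serves the induction: the upward leaves of the remaining net are the
  places where the next zigzag is glued on, and their order tells which inner sink goes
  where.\<close>

abbreviation net_iso :: "'a rel \<Rightarrow> 'a rel \<Rightarrow> 'a rel \<Rightarrow> ('a \<Rightarrow> real) \<Rightarrow>
    'b rel \<Rightarrow> 'b rel \<Rightarrow> 'b rel \<Rightarrow> ('b \<Rightarrow> real) \<Rightarrow> ('a \<Rightarrow> 'b) \<Rightarrow> bool" where
  "net_iso E0 E1 E2 x G0 G1 G2 y f \<equiv>
    bij_betw f (net_vertices E0 E1 E2) (net_vertices G0 G1 G2) \<and>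
    map_prod f f ` E0 = G0 \<and> map_prod f f ` E1 = G1 \<and> map_prod f f ` E2 = G2 \<and>
    (\<forall>v\<in>Range E0 - Range E1. \<forall>w\<in>Range E0 - Range E1. x v < x w \<longrightarrow> y (f v) < y (f w))"

context hexnet_top
begin

text \<open>Sources and sinks alternate along the zigzag. Its left end has no \<open>E2\<close> edge
  leaving it, so it is a source exactly if it lies in \<open>Domain E1\<close>.\<close>

lemma source_parity:
  "i < length p \<Longrightarrow> p ! i \<in> Domain E1 \<union> Domain E2 \<longleftrightarrow> (even i \<longleftrightarrow> hd p \<in> Domain E1)"
proof (induction i)
  case 0
  then show ?case using no_left p_nonempty by (simp add: hd_conv_nth)
next
  case (Suc i)
  have "p ! i \<in> Domain E1 \<union> Domain E2 \<longleftrightarrow> p ! Suc i \<notin> Domain E1 \<union> Domain E2"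
    using step[OF Suc.prems] bipartite by blast
  then show ?case using Suc by auto
qed

lemma inner_left: "0 < i \<Longrightarrow> i < length p \<Longrightarrow> p ! i \<in> Range E1 \<union> Domain E2"
  using has_left[of "p ! i"] distinct p_nonempty by (auto simp: hd_conv_nth nth_eq_iff_index_eq)

lemma inner_right: "Suc i < length p \<Longrightarrow> p ! i \<in> Domain E1 \<union> Range E2"
  using has_right[of "p ! i"] distinct p_nonempty by (auto simp: last_conv_nth nth_eq_iff_index_eq)

lemma source_nth:
  assumes "i < length p"
  shows "p ! i \<in> Domain E0 \<longleftrightarrow> 0 < i \<and> Suc i < length p \<and> (even i \<longleftrightarrow> hd p \<in> Domain E1)"
proof
  assume "p ! i \<in> Domain E0"
  then have "p ! i \<in> Domain E1" "p ! i \<in> Domain E2" using P_source assms by auto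
  then show "0 < i \<and> Suc i < length p \<and> (even i \<longleftrightarrow> hd p \<in> Domain E1)"
    using source_parity[OF assms] no_left no_right assms p_nonempty
    by (metis Suc_lessI UnI1 diff_Suc_1 gr0I hd_conv_nth last_conv_nth)
next
  assume "0 < i \<and> Suc i < length p \<and> (even i \<longleftrightarrow> hd p \<in> Domain E1)"
  then show "p ! i \<in> Domain E0"
    using source_parity[OF assms] inner_left[of i] inner_right[of i] bipartite sources assms by blast
qed

lemma sink_nth:
  assumes "i < length p"
  shows "p ! i \<in> Range E0 \<longleftrightarrow> 0 < i \<and> Suc i < length p \<and> (even i \<longleftrightarrow> hd p \<notin> Domain E1)"
proof
  assume "p ! i \<in> Range E0"
  then have *: "p ! i \<in> Range E1" "p ! i \<in> Range E2" using P_sink assms by auto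
  then have "p ! i \<notin> Domain E1 \<union> Domain E2" using bipartite by blast
  then show "0 < i \<and> Suc i < length p \<and> (even i \<longleftrightarrow> hd p \<notin> Domain E1)"
    using source_parity[OF assms] * no_left no_right assms p_nonempty
    by (metis Suc_lessI diff_Suc_1 gr0I hd_conv_nth last_conv_nth)
next
  assume "0 < i \<and> Suc i < length p \<and> (even i \<longleftrightarrow> hd p \<notin> Domain E1)"
  then show "p ! i \<in> Range E0"
    using source_parity[OF assms] inner_left[of i] inner_right[of i] sinks assms by blast
qed

lemma edge1_nth: "(u, v) \<in> E1 \<and> u \<in> P \<longleftrightarrow>
  (\<exists>i. Suc i < length p \<and> u = p ! i \<and> v = p ! Suc i \<and> (even i \<longleftrightarrow> hd p \<in> Domain E1))"
proof
  assume *: "(u, v) \<in> E1 \<and> u \<in> P"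
  then obtain i where i: "i < length p" "u = p ! i" by (auto simp: in_set_conv_nth)
  have "u \<noteq> last p" using no_right * by blast
  then have l: "Suc i < length p" using i p_nonempty by (metis last_conv_nth Suc_lessI diff_Suc_1)
  moreover have "(p ! Suc i, u) \<notin> E2" using bipartite * by blast
  ultimately have "(u, p ! Suc i) \<in> E1" using step i by blast
  then have "v = p ! Suc i" using * single_valued(2) by (metis single_valuedD)
  moreover have "even i \<longleftrightarrow> hd p \<in> Domain E1" using source_parity[OF i(1)] * i by blast
  ultimately show "\<exists>i. Suc i < length p \<and> u = p ! i \<and> v = p ! Suc i \<and> (even i \<longleftrightarrow> hd p \<in> Domain E1)"
    using i l by blast
next
  assume "\<exists>i. Suc i < length p \<and> u = p ! i \<and> v = p ! Suc i \<and> (even i \<longleftrightarrow> hd p \<in> Domain E1)"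
  then obtain i where i: "Suc i < length p" "u = p ! i" "v = p ! Suc i"
    "even i \<longleftrightarrow> hd p \<in> Domain E1" by blast
  then have "u \<in> Domain E1 \<union> Domain E2" using source_parity[of i] by simp
  then have "(v, u) \<notin> E2" using bipartite by blast
  then show "(u, v) \<in> E1 \<and> u \<in> P" using step[OF i(1)] i by auto
qed

lemma edge2_nth: "(u, v) \<in> E2 \<and> u \<in> P \<longleftrightarrow>
  (\<exists>i. Suc i < length p \<and> u = p ! Suc i \<and> v = p ! i \<and> (even i \<longleftrightarrow> hd p \<notin> Domain E1))"
proof
  assume *: "(u, v) \<in> E2 \<and> u \<in> P"
  then have "v \<in> P" using closed2 by blast
  then obtain i where i: "i < length p" "v = p ! i" by (auto simp: in_set_conv_nth)
  have "v \<noteq> last p" using no_right * by blast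
  then have l: "Suc i < length p" using i p_nonempty by (metis last_conv_nth Suc_lessI diff_Suc_1)
  moreover have v: "v \<notin> Domain E1 \<union> Domain E2" using bipartite * by blast
  ultimately have "(p ! Suc i, v) \<in> E2" using step i by blast
  then have "u = p ! Suc i" using * sv_converse(3) by (meson converse_iff single_valuedD)
  moreover have "even i \<longleftrightarrow> hd p \<notin> Domain E1" using source_parity[OF i(1)] v i by blast
  ultimately show "\<exists>i. Suc i < length p \<and> u = p ! Suc i \<and> v = p ! i \<and> (even i \<longleftrightarrow> hd p \<notin> Domain E1)"
    using i l by blast
next
  assume "\<exists>i. Suc i < length p \<and> u = p ! Suc i \<and> v = p ! i \<and> (even i \<longleftrightarrow> hd p \<notin> Domain E1)"
  then obtain i where i: "Suc i < length p" "u = p ! Suc i" "v = p ! i"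
    "even i \<longleftrightarrow> hd p \<notin> Domain E1" by blast
  then have "v \<notin> Domain E1 \<union> Domain E2" using source_parity[of i] by auto
  then show "(u, v) \<in> E2 \<and> u \<in> P" using step[OF i(1)] i by auto
qed

lemma vertices_F_P: "net_vertices F0 F1 F2 \<inter> P = Range E0 \<inter> P"
  unfolding net_vertices_def Field_def Ends_F using up_notin by blast

lemma vertices_F_up: "net_vertices F0 F1 F2 \<inter> E0 `` P = {}"
  unfolding net_vertices_def Field_def Ends_F using up_leaf bipartite by blast

lemma vertices_split:
  "net_vertices E0 E1 E2 = (net_vertices F0 F1 F2 - P) \<union> P \<union> E0 `` P"
  unfolding net_vertices_def Field_def Ends_F using P_edge by blast

text \<open>All vertices of the zigzag except the two ends carry a vertical edge.\<close>

lemma length_p: "length p = L + R + 2"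
proof -
  have "P = ((Domain E0 \<inter> P) \<union> (Range E0 \<inter> P)) \<union> {hd p, last p}"
  proof -
    have "v \<in> Domain E0 \<union> Range E0" if "v \<in> P" "v \<noteq> hd p" "v \<noteq> last p" for v
      using has_left[OF that(1,2)] has_right[OF that(1,3)] bipartite sources sinks by blast
    then show ?thesis using P_in by blast
  qed
  moreover have "((Domain E0 \<inter> P) \<union> (Range E0 \<inter> P)) \<inter> {hd p, last p} = {}"
    using P_source P_sink P_in no_left no_right by blast
  ultimately have "card P = card ((Domain E0 \<inter> P) \<union> (Range E0 \<inter> P)) + card {hd p, last p}"
    by (intro card_split) auto
  moreover have "card ((Domain E0 \<inter> P) \<union> (Range E0 \<inter> P)) = L + R"
    unfolding L_def R_def using bipartite by (intro card_Un_disjoint) auto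
  ultimately show ?thesis using hd_neq_last distinct by (simp add: distinct_card)
qed

end

context hexnet_top
begin

text \<open>The remaining net obeys the bound too, so equality leaves no room for any defect. The
  two ends of the top zigzag and \<open>L\<close>, hence by \<open>balance_P\<close> also
  \<open>R\<close> and the length, are then functions of the leaf numbers.\<close>

lemma extremal:
  assumes "int (inner_count E0 E1) = net_area E0 E1 E2"
  shows "int (inner_count F0 F1) = net_area F0 F1 F2" and "sink_leaves E0 E1 = L"
    and "E0 `` P = Range E0 - Range E1" and "inj_on x (Range F0 - Range F1)"
    and "eps1 = (if src_leaves E2 E0 = 0 then 0 else 1)"
    and "eps3 = (if src_leaves E1 E0 = 0 then 0 else 1)"
proof -
  have "int (inner_count F0 F1) \<le> net_area F0 F1 F2" using hexnet_bound[OF hexnet_F] .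
  then have *: "int (inner_count F0 F1) = net_area F0 F1 F2" "2 * (int (sink_leaves E0 E1) - int L) = 0"
    "2 * (1 - int eps1) * int (src_leaves E2 E0) = 0" "2 * (1 - int eps3) * int (src_leaves E1 E0) = 0"
    using assms area_step defects_nonneg by linarith+
  then show "int (inner_count F0 F1) = net_area F0 F1 F2" and l: "sink_leaves E0 E1 = L" by auto
  show up: "E0 `` P = Range E0 - Range E1"
    using card_subset_eq[OF _ up_leaves_subset] l finite_ends card_up by (auto simp: sink_leaves_def)
  \<comment> \<open>No upward leaf hung from elsewhere, so those of the remaining net are the inner
    sinks of the zigzag, and abscissae along a zigzag are distinct.\<close>
  show "inj_on x (Range F0 - Range F1)"
    unfolding up_leaves_F using inj_x up by (auto intro: inj_on_subset)
  show "eps1 = (if src_leaves E2 E0 = 0 then 0 else 1)"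
    using *(3) count_right by (auto simp: eps1_def)
  show "eps3 = (if src_leaves E1 E0 = 0 then 0 else 1)"
    using *(4) count_left by (auto simp: eps3_def)
qed

end

text \<open>A vertical edge has the same abscissa at both ends. Hence an isomorphism of the remaining
  nets that preserves the order of the upward leaves carries the edges hanging from the top zigzag
  to the corresponding ones.\<close>

lemma extend_isomorphism:
  assumes "hexnet_top E0 E1 E2 x h p" and "hexnet_top G0 G1 G2 y k q"
    and len: "length p = length q" and par: "hd p \<in> Domain E1 \<longleftrightarrow> hd q \<in> Domain G1"
    and upE: "E0 `` set p = Range E0 - Range E1" and upG: "G0 `` set q = Range G0 - Range G1"
  defines "D0 \<equiv> hexnet_top.F0 E0 p" and "D1 \<equiv> hexnet_top.F1 E1 p" and "D2 \<equiv> hexnet_top.F2 E2 p"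
    and "H0 \<equiv> hexnet_top.F0 G0 q" and "H1 \<equiv> hexnet_top.F1 G1 q" and "H2 \<equiv> hexnet_top.F2 G2 q"
  assumes bij: "bij_betw f' (net_vertices D0 D1 D2) (net_vertices H0 H1 H2)"
    and im: "map_prod f' f' ` D0 = H0" "map_prod f' f' ` D1 = H1" "map_prod f' f' ` D2 = H2"
    and mono: "\<And>v w. v \<in> Range D0 - Range D1 \<Longrightarrow> w \<in> Range D0 - Range D1 \<Longrightarrow> x v < x w \<Longrightarrow> y (f' v) < y (f' w)"
  shows "\<exists>f. net_iso E0 E1 E2 x G0 G1 G2 y f"
proof -
  interpret A: hexnet_top E0 E1 E2 x h p by fact
  interpret B: hexnet_top G0 G1 G2 y k q by fact
  let ?P = "set p" and ?Q = "set q"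
  define g where "g = (\<lambda>v. the (map_of (zip p q) v))"
  have g: "g (p ! i) = q ! i" if "i < length p" for i
    unfolding g_def using that len A.distinct by (simp add: map_of_zip_nth)
  \<comment> \<open>On the zigzag the position decides, above it the vertical edge is followed,
    elsewhere \<open>f'\<close> is kept. Inner sinks belong both to the zigzag and to the remaining
    net, so agreement with \<open>f'\<close> there has to be proved.\<close>
  define f where "f v = (if v \<in> ?P then g v else if v \<in> E0 `` ?P
      then (THE w. (g (THE u. (u, v) \<in> E0), w) \<in> G0) else f' v)" for v
  have fP: "f (p ! i) = q ! i" if "i < length p" for i
    unfolding f_def using g that by simp
  have gQ: "g u \<in> ?Q" if "u \<in> ?P" for u
    using that g len by (metis in_set_conv_nth)
  have fg: "f u = g u" if "u \<in> ?P" for u using that by (simp add: f_def)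
  have fup: "(f u, f v) \<in> G0" if uv: "(u, v) \<in> E0" "u \<in> ?P" for u v
  proof -
    obtain i where i: "i < length p" "u = p ! i" using uv(2) by (auto simp: in_set_conv_nth)
    have "q ! i \<in> Domain G0" using A.source_nth[OF i(1)] B.source_nth[of i] i uv len par by auto
    then obtain w where w: "(q ! i, w) \<in> G0" by blast
    have "(THE u. (u, v) \<in> E0) = u" using uv A.sv_converse(1)
      by (auto simp: single_valued_def)
    moreover have "(THE w. (q ! i, w) \<in> G0) = w" using w B.single_valued(1)
      by (auto simp: single_valued_def)
    moreover have "v \<in> E0 `` ?P" "v \<notin> ?P" using uv A.up_notin by blast+
    ultimately have "f v = w" using i g by (simp add: f_def)
    then show ?thesis using w fP i by simp
  qed
  have RA: "Range D0 - Range D1 = Range E0 \<inter> ?P"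
    unfolding D0_def D1_def A.up_leaves_F using upE by blast
  have RB: "Range H0 - Range H1 = Range G0 \<inter> ?Q"
    unfolding H0_def H1_def B.up_leaves_F using upG by blast
  have f'img: "f' ` (Range E0 \<inter> ?P) = Range G0 \<inter> ?Q"
  proof -
    have *: "f' ` Range D0 = Range H0" "f' ` Range D1 = Range H1"
      unfolding im(1,2)[symmetric] by (force simp: image_iff)+
    have "inj_on f' (net_vertices D0 D1 D2)" using bij by (rule bij_betw_imp_inj_on)
    then have "f' ` (Range D0 - Range D1) = f' ` Range D0 - f' ` Range D1"
      by (rule inj_on_image_set_diff) (auto simp: net_vertices_def Field_def)
    then show ?thesis using * RA RB by simp
  qed
  \<comment> \<open>By parity both zigzags have their inner sinks at the same positions
    \<open>K\<close>. Read on positions, \<open>f'\<close> is a strictly increasing map from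
    \<open>K\<close> to itself, hence the identity.\<close>
  have f'P: "f' (p ! i) = q ! i" if i: "i < length p" "p ! i \<in> Range E0" for i
  proof -
    define K where "K = {i. i < length p \<and> p ! i \<in> Range E0}"
    have "p ! i \<in> Range E0 \<longleftrightarrow> q ! i \<in> Range G0" if "i < length q" for i
      using A.sink_nth[of i] B.sink_nth[of i] that len par by simp
    then have Kq: "K = {i. i < length q \<and> q ! i \<in> Range G0}"
      unfolding K_def using len by auto
    have "\<exists>j. j \<in> K \<and> f' (p ! i) = q ! j" if "i \<in> K" for i
    proof -
      have "p ! i \<in> Range E0 \<inter> ?P" using that by (auto simp: K_def)
      then have "f' (p ! i) \<in> Range G0 \<inter> ?Q" using f'img by blast
      then obtain j where j: "j < length q" "f' (p ! i) = q ! j" "f' (p ! i) \<in> Range G0"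
        by (metis IntE in_set_conv_nth)
      then have "q ! j \<in> Range G0" by metis
      with j(1,2) show ?thesis unfolding Kq by blast
    qed
    then obtain c where c: "\<And>i. i \<in> K \<Longrightarrow> c i \<in> K \<and> f' (p ! i) = q ! c i" by metis
    have "c i = i"
    proof (rule strict_mono_self_map)
      show "finite K" by (simp add: K_def)
      show "i \<in> K" using i by (simp add: K_def)
      show "c i \<in> K" if "i \<in> K" for i using c that by blast
      show "c i < c j" if "i \<in> K" "j \<in> K" "i < j" for i j
      proof -
        have "x (p ! i) < x (p ! j)" using that A.x_nth by (auto simp: K_def)
        moreover have "p ! i \<in> Range D0 - Range D1" "p ! j \<in> Range D0 - Range D1"
          unfolding RA using that by (auto simp: K_def)
        ultimately have "y (q ! c i) < y (q ! c j)" using mono c that by metis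
        then show ?thesis using B.x_nth c that Kq by auto
      qed
    qed
    then show ?thesis using c[of i] i by (simp add: K_def)
  qed
  have ff': "f v = f' v" if v: "v \<in> net_vertices D0 D1 D2" for v
  proof (cases "v \<in> ?P")
    case True
    then have "v \<in> Range E0 \<inter> ?P" using v A.vertices_F_P unfolding D0_def D1_def D2_def by blast
    then obtain i where "i < length p" "v = p ! i" "p ! i \<in> Range E0" by (auto simp: in_set_conv_nth)
    then show ?thesis using f'P fP by simp
  next
    case False
    then show ?thesis
      using v A.vertices_F_up unfolding f_def D0_def D1_def D2_def by auto
  qed
  have im0: "map_prod f f ` D0 = H0" and im1: "map_prod f f ` D1 = H1" and im2: "map_prod f f ` D2 = H2"
    unfolding im[symmetric]
    by (intro image_cong refl; force simp: net_vertices_def Field_def intro!: ff')+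
  have E0: "map_prod f f ` E0 = G0"
  proof -
    have eE: "E0 = D0 \<union> {(u, v) \<in> E0. u \<in> ?P}" by (auto simp: D0_def A.F0_def)
    have eG: "G0 = H0 \<union> {(u, v) \<in> G0. u \<in> ?Q}" by (auto simp: H0_def B.F0_def)
    have eI: "map_prod f f ` {(u, v) \<in> E0. u \<in> ?P} = {(u, v) \<in> G0. u \<in> ?Q}"
    proof (intro equalityI subsetI)
      fix e assume "e \<in> map_prod f f ` {(u, v) \<in> E0. u \<in> ?P}"
      then show "e \<in> {(u, v) \<in> G0. u \<in> ?Q}" using fup gQ fg by auto
    next
      fix e assume "e \<in> {(u, v) \<in> G0. u \<in> ?Q}"
      then obtain u v where e: "e = (u, v)" "(u, v) \<in> G0" "u \<in> ?Q" by blast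
      then obtain i where i: "i < length q" "u = q ! i" by (auto simp: in_set_conv_nth)
      then have "p ! i \<in> Domain E0" using A.source_nth[of i] B.source_nth[OF i(1)] e len par by auto
      then obtain w where w: "(p ! i, w) \<in> E0" by blast
      have iP: "p ! i \<in> ?P" using i len by simp
      have "(u, f w) \<in> G0" using fup[OF w iP] fP i len by simp
      then have "f w = v" using e B.single_valued(1) by (meson single_valuedD)
      then have "e = map_prod f f (p ! i, w)" using e i fP len by simp
      then show "e \<in> map_prod f f ` {(u, v) \<in> E0. u \<in> ?P}" using w iP by blast
    qed
    show ?thesis by (subst eE, subst eG) (simp only: image_Un im0 eI)
  qed
  have E1: "map_prod f f ` E1 = G1"
  proof -
    have eE: "E1 = D1 \<union> {(u, v). (u, v) \<in> E1 \<and> u \<in> ?P}" by (auto simp: D1_def A.F1_def)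
    have eG: "G1 = H1 \<union> {(u, v). (u, v) \<in> G1 \<and> u \<in> ?Q}" by (auto simp: H1_def B.F1_def)
    have eI: "map_prod f f ` {(u, v). (u, v) \<in> E1 \<and> u \<in> ?P} = {(u, v). (u, v) \<in> G1 \<and> u \<in> ?Q}"
    proof -
      have "{(u, v). (u, v) \<in> E1 \<and> u \<in> ?P} =
          (\<lambda>i. (p ! i, p ! Suc i)) ` {i. Suc i < length p \<and> (even i \<longleftrightarrow> hd p \<in> Domain E1)}"
        unfolding A.edge1_nth by auto
      moreover have "{(u, v). (u, v) \<in> G1 \<and> u \<in> ?Q} =
          (\<lambda>i. (q ! i, q ! Suc i)) ` {i. Suc i < length p \<and> (even i \<longleftrightarrow> hd p \<in> Domain E1)}"
        unfolding B.edge1_nth len par by auto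
      ultimately show ?thesis
        by (simp only: image_image map_prod_simp) (intro image_cong; simp add: fP)
    qed
    show ?thesis by (subst eE, subst eG) (simp only: image_Un im1 eI)
  qed
  have E2: "map_prod f f ` E2 = G2"
  proof -
    have eE: "E2 = D2 \<union> {(u, v). (u, v) \<in> E2 \<and> u \<in> ?P}" by (auto simp: D2_def A.F2_def)
    have eG: "G2 = H2 \<union> {(u, v). (u, v) \<in> G2 \<and> u \<in> ?Q}" by (auto simp: H2_def B.F2_def)
    have eI: "map_prod f f ` {(u, v). (u, v) \<in> E2 \<and> u \<in> ?P} = {(u, v). (u, v) \<in> G2 \<and> u \<in> ?Q}"
    proof -
      have "{(u, v). (u, v) \<in> E2 \<and> u \<in> ?P} =
          (\<lambda>i. (p ! Suc i, p ! i)) ` {i. Suc i < length p \<and> (even i \<longleftrightarrow> hd p \<notin> Domain E1)}"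
        unfolding A.edge2_nth by auto
      moreover have "{(u, v). (u, v) \<in> G2 \<and> u \<in> ?Q} =
          (\<lambda>i. (q ! Suc i, q ! i)) ` {i. Suc i < length p \<and> (even i \<longleftrightarrow> hd p \<notin> Domain E1)}"
        unfolding B.edge2_nth len par by auto
      ultimately show ?thesis
        by (simp only: image_image map_prod_simp) (intro image_cong; simp add: fP)
    qed
    show ?thesis by (subst eE, subst eG) (simp only: image_Un im2 eI)
  qed
  have bP: "bij_betw f ?P ?Q"
  proof -
    have "inj_on f ?P"
      using fP len A.distinct B.distinct
      by (auto simp: inj_on_def in_set_conv_nth nth_eq_iff_index_eq)
    moreover have "f ` ?P = ?Q"
      using fP len by (force simp: set_conv_nth image_iff)
    ultimately show ?thesis by (simp add: bij_betw_def)
  qed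
  have bU: "bij_betw f (E0 `` ?P) (G0 `` ?Q)"
  proof -
    have "inj_on f (E0 `` ?P)"
    proof (rule inj_onI)
      fix v v' assume "v \<in> E0 `` ?P" "v' \<in> E0 `` ?P" and eq: "f v = f v'"
      then obtain u u' where u: "(u, v) \<in> E0" "u \<in> ?P" "(u', v') \<in> E0" "u' \<in> ?P" by blast
      have "f u = f u'" using fup[OF u(1,2)] fup[OF u(3,4)] eq B.sv_converse(1)
        by (metis converse_iff single_valuedD)
      then have "u = u'" using bP u by (auto simp: bij_betw_def dest: inj_onD)
      then show "v = v'" using u A.single_valued(1) by (meson single_valuedD)
    qed
    moreover have "f ` (E0 `` ?P) = G0 `` ?Q"
    proof (intro equalityI subsetI)
      fix w assume "w \<in> f ` (E0 `` ?P)"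
      then show "w \<in> G0 `` ?Q" using fup gQ fg by fastforce
    next
      fix w assume "w \<in> G0 `` ?Q"
      then obtain i where i: "i < length q" "(q ! i, w) \<in> G0" by (auto simp: in_set_conv_nth)
      then have "p ! i \<in> Domain E0" using A.source_nth[of i] B.source_nth[OF i(1)] len par by auto
      then obtain v where v: "(p ! i, v) \<in> E0" by blast
      have iP: "p ! i \<in> ?P" using i len by simp
      have "(q ! i, f v) \<in> G0" using fup[OF v iP] fP i len by simp
      then have "f v = w" using i B.single_valued(1) by (meson single_valuedD)
      then show "w \<in> f ` (E0 `` ?P)" using v iP by blast
    qed
    ultimately show ?thesis by (simp add: bij_betw_def)
  qed
  have bF: "bij_betw f (net_vertices D0 D1 D2 - ?P) (net_vertices H0 H1 H2 - ?Q)"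
  proof -
    have b: "bij_betw f (net_vertices D0 D1 D2) (net_vertices H0 H1 H2)"
      using bij ff' by (simp cong: bij_betw_cong)
    have "f ` (Range E0 \<inter> ?P) = f' ` (Range E0 \<inter> ?P)"
      using ff' A.vertices_F_P unfolding D0_def D1_def D2_def by (intro image_cong) blast+
    then have i: "f ` (Range E0 \<inter> ?P) = Range G0 \<inter> ?Q" using f'img by simp
    have *: "net_vertices D0 D1 D2 - ?P = net_vertices D0 D1 D2 - (Range E0 \<inter> ?P)"
      "Range E0 \<inter> ?P \<subseteq> net_vertices D0 D1 D2"
      using A.vertices_F_P unfolding D0_def D1_def D2_def by blast+
    have **: "net_vertices H0 H1 H2 - ?Q = net_vertices H0 H1 H2 - (Range G0 \<inter> ?Q)"
      using B.vertices_F_P unfolding H0_def H1_def H2_def by blast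
    have "f ` (net_vertices D0 D1 D2 - Range E0 \<inter> ?P) =
        f ` net_vertices D0 D1 D2 - f ` (Range E0 \<inter> ?P)"
      by (rule inj_on_image_set_diff[OF bij_betw_imp_inj_on[OF b] Diff_subset *(2)])
    also have "\<dots> = net_vertices H0 H1 H2 - Range G0 \<inter> ?Q"
      unfolding i bij_betw_imp_surj_on[OF b] ..
    finally have "f ` (net_vertices D0 D1 D2 - Range E0 \<inter> ?P) = net_vertices H0 H1 H2 - Range G0 \<inter> ?Q" .
    then show ?thesis
      using bij_betw_imp_inj_on[OF b] unfolding *(1) ** bij_betw_def
      by (auto intro: inj_on_subset)
  qed
  have "bij_betw f (net_vertices E0 E1 E2) (net_vertices G0 G1 G2)"
    unfolding A.vertices_split B.vertices_split
      D0_def[symmetric] D1_def[symmetric] D2_def[symmetric]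
      H0_def[symmetric] H1_def[symmetric] H2_def[symmetric]
  proof (intro bij_betw_combine[OF bij_betw_combine[OF bF bP] bU])
    show "(net_vertices H0 H1 H2 - ?Q) \<inter> ?Q = {}" by blast
    show "(net_vertices H0 H1 H2 - ?Q \<union> ?Q) \<inter> G0 `` ?Q = {}"
      using B.vertices_F_up B.up_notin unfolding H0_def H1_def H2_def by blast
  qed
  moreover have "y (f v) < y (f w)"
    if vw: "v \<in> Range E0 - Range E1" "w \<in> Range E0 - Range E1" "x v < x w" for v w
  proof -
    obtain u u' where u: "(u, v) \<in> E0" "u \<in> ?P" "(u', w) \<in> E0" "u' \<in> ?P" using vw upE by blast
    obtain i j where ij: "i < length p" "u = p ! i" "j < length p" "u' = p ! j"
      using u by (auto simp: in_set_conv_nth)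
    have "x u < x u'" using vw(3) A.x0[OF u(1)] A.x0[OF u(3)] by simp
    then have "y (q ! i) < y (q ! j)" using A.x_nth B.x_nth ij len by simp
    then show ?thesis using B.x0[OF fup[OF u(1,2)]] B.x0[OF fup[OF u(3,4)]] fP ij by simp
  qed
  ultimately show ?thesis using E0 E1 E2 by blast
qed

text \<open>This makes two nets with equal counts run out of zigzags at the same stage: a top zigzag
  with no inner vertices and no source leaf at an end contradicts \<open>balance_P\<close>.\<close>

lemma all_vertical:
  assumes "A1 \<union> A2 = {}" "hexnet B0 B1 B2 z l" "inner_count B0 B1 = inner_count A0 A1"
    "src_leaves B1 B0 = src_leaves A1 A0" "src_leaves B2 B0 = src_leaves A2 A0"
  shows "B1 \<union> B2 = {}"
proof (rule ccontr)
  interpret M: hexnet B0 B1 B2 z l by fact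
  assume "B1 \<union> B2 \<noteq> {}"
  then obtain r where "hexnet_top B0 B1 B2 z l r" using M.ex_top by blast
  then interpret M: hexnet_top B0 B1 B2 z l r .
  have "A1 = {}" "A2 = {}" using assms(1) by auto
  then have "M.L = 0" "M.R = 0" "M.eps1 = 0" "M.eps3 = 0"
    using assms(3-5) M.count_interior M.count_left M.count_right
    by (auto simp: inner_count_def src_leaves_def)
  then show False using M.balance_P by simp
qed

theorem hexnet_unique:
  assumes "hexnet E0 E1 E2 x h" and "hexnet G0 G1 G2 y k"
    and "src_leaves E2 E0 = src_leaves G2 G0" "sink_leaves E0 E1 = sink_leaves G0 G1"
      "src_leaves E1 E0 = src_leaves G1 G0" "src_leaves E0 E1 = src_leaves G0 G1"
    and "int (inner_count E0 E1) = net_area E0 E1 E2"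
    and "int (inner_count G0 G1) = net_area G0 G1 G2"
    and "inj_on x (Range E0 - Range E1)" "inj_on y (Range G0 - Range G1)"
  shows "\<exists>f. net_iso E0 E1 E2 x G0 G1 G2 y f"
  using assms
proof (induction "card (E1 \<union> E2)" arbitrary: E0 E1 E2 G0 G1 G2 rule: less_induct)
  case less
  note prof = less.prems(3-6) and mE = less.prems(7) and mG = less.prems(8)
    and injE = less.prems(9) and injG = less.prems(10)
  interpret N: hexnet E0 E1 E2 x h by fact
  interpret N': hexnet G0 G1 G2 y k by fact
  have cnt: "inner_count E0 E1 = inner_count G0 G1" using mE mG prof by simp
  show ?case
  proof (cases "E1 \<union> E2 = {}")
    case True
    then have E: "E1 = {}" "E2 = {}" by auto
    have "G1 \<union> G2 = {}" using all_vertical[OF True less.prems(2), of E0] cnt prof by simp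
    then have G: "G1 = {}" "G2 = {}" by auto
    have "card (Range E0) = card (Range G0)" using prof(2) E G by (simp add: sink_leaves_def)
    then obtain g where g: "bij_betw g (Range E0) (Range G0)"
      "\<And>v w. v \<in> Range E0 \<Longrightarrow> w \<in> Range E0 \<Longrightarrow> x v < x w \<Longrightarrow> y (g v) < y (g w)"
      using finite_order_iso[of "Range E0" "Range G0" x y] injE injG E G N.finite_edges N'.finite_edges
      by (auto simp: finite_Range)
    \<comment> \<open>Upper ends correspond in the order of their abscissae; lower ends follow along
      the vertical edges.\<close>
    define f where "f v = (if v \<in> Range E0 then g v else (THE u. (u, g (THE w. (v, w) \<in> E0)) \<in> G0))" for v
    have fe: "(f u, f v) \<in> G0" if uv: "(u, v) \<in> E0" for u v
    proof -
      have "u \<notin> Range E0" "v \<in> Range E0" using uv N.bipartite by blast+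
      moreover have "(THE w. (u, w) \<in> E0) = v" using uv N.single_valued(1)
        by (auto simp: single_valued_def)
      moreover have "g v \<in> Range G0" using \<open>v \<in> Range E0\<close> g(1) by (auto dest: bij_betwE)
      then obtain t where t: "(t, g v) \<in> G0" by blast
      moreover have "(THE u. (u, g v) \<in> G0) = t" using t N'.sv_converse(1)
        by (auto simp: single_valued_def)
      ultimately show ?thesis by (simp add: f_def)
    qed
    have fR: "f v = g v" if "v \<in> Range E0" for v using that by (simp add: f_def)
    have bR: "bij_betw f (Range E0) (Range G0)" using g(1) fR by (simp cong: bij_betw_cong)
    have im: "map_prod f f ` E0 = G0"
    proof (intro equalityI subsetI)
      fix e assume "e \<in> map_prod f f ` E0"
      then show "e \<in> G0" using fe by auto
    next
      fix e assume "e \<in> G0"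
      then obtain s t where e: "e = (s, t)" "(s, t) \<in> G0" by (cases e) auto
      then have "t \<in> f ` Range E0" using bR by (auto simp: bij_betw_def)
      then obtain v where v: "v \<in> Range E0" "f v = t" by (metis imageE)
      then obtain u where u: "(u, v) \<in> E0" by blast
      then have "f u = s" using fe[OF u] v e N'.sv_converse(1)
        by (metis converse_iff single_valuedD)
      then show "e \<in> map_prod f f ` E0" using u v e by force
    qed
    have bD: "bij_betw f (Domain E0) (Domain G0)"
    proof -
      have "inj_on f (Domain E0)"
      proof (rule inj_onI)
        fix u u' assume "u \<in> Domain E0" "u' \<in> Domain E0" and eq: "f u = f u'"
        then obtain v v' where u: "(u, v) \<in> E0" "(u', v') \<in> E0" by blast
        have "f v = f v'" using fe[OF u(1)] fe[OF u(2)] eq N'.single_valued(1) by (metis single_valuedD)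
        then have "v = v'" using bR u by (auto simp: bij_betw_def dest: inj_onD)
        then show "u = u'" using u N.sv_converse(1) by (metis converse_iff single_valuedD)
      qed
      moreover have "f ` Domain E0 = Domain G0" unfolding im[symmetric] by force
      ultimately show ?thesis by (simp add: bij_betw_def)
    qed
    have "bij_betw f (Domain E0 \<union> Range E0) (Domain G0 \<union> Range G0)"
      using N'.bipartite by (intro bij_betw_combine[OF bD bR]) blast
    then have "bij_betw f (net_vertices E0 E1 E2) (net_vertices G0 G1 G2)"
      using E G by (simp add: net_vertices_def Field_def)
    then show ?thesis using im E G g(2) fR by (intro exI[of _ f]) auto
  next
    case False
    then obtain p where "hexnet_top E0 E1 E2 x h p" using N.ex_top by blast
    then interpret A: hexnet_top E0 E1 E2 x h p .
    have "G1 \<union> G2 \<noteq> {}"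
      using all_vertical[OF _ less.prems(1), of G1 G2 G0] False cnt prof by auto
    then obtain q where "hexnet_top G0 G1 G2 y k q" using N'.ex_top by blast
    then interpret B: hexnet_top G0 G1 G2 y k q .
    note EA = A.extremal[OF mE] and EB = B.extremal[OF mG]
    have eps: "A.eps1 = B.eps1" "A.eps3 = B.eps3" using EA(5,6) EB(5,6) prof by simp_all
    have L: "A.L = B.L" using EA(2) EB(2) prof by simp
    have R: "A.R = B.R" using A.balance_P B.balance_P eps L by simp
    have len: "length p = length q" using A.length_p B.length_p L R by simp
    have par: "hd p \<in> Domain E1 \<longleftrightarrow> hd q \<in> Domain G1"
      using eps(2) by (auto simp: A.eps3_def B.eps3_def split: if_splits)
    have "\<exists>f. net_iso A.F0 A.F1 A.F2 x B.F0 B.F1 B.F2 y f"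
    proof (rule less.hyps[OF A.card_decrease A.hexnet_F B.hexnet_F])
      show "src_leaves A.F2 A.F0 = src_leaves B.F2 B.F0"
        using A.count_right B.count_right prof eps by simp
      show "sink_leaves A.F0 A.F1 = sink_leaves B.F0 B.F1"
        using A.count_up B.count_up prof L R by simp
      show "src_leaves A.F1 A.F0 = src_leaves B.F1 B.F0"
        using A.count_left B.count_left prof eps by simp
      show "src_leaves A.F0 A.F1 = src_leaves B.F0 B.F1"
        using A.count_down B.count_down prof by simp
    qed (use EA EB in auto)
    then show ?thesis
    proof (elim exE conjE)
      fix f
      assume f: "bij_betw f (net_vertices A.F0 A.F1 A.F2) (net_vertices B.F0 B.F1 B.F2)"
        "map_prod f f ` A.F0 = B.F0" "map_prod f f ` A.F1 = B.F1" "map_prod f f ` A.F2 = B.F2"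
        "\<forall>v\<in>Range A.F0 - Range A.F1. \<forall>w\<in>Range A.F0 - Range A.F1. x v < x w \<longrightarrow> y (f v) < y (f w)"
      show ?thesis
        by (rule extend_isomorphism[OF A.hexnet_top_axioms B.hexnet_top_axioms len par EA(3) EB(3) f(1-4)])
          (use f(5) in simp)
    qed
  qed
qed

lemma (in hexnet_top) up_inj:
  assumes "E0 `` P = Range E0 - Range E1"
  shows "inj_on x (Range E0 - Range E1)"
proof (rule inj_onI)
  fix v w assume "v \<in> Range E0 - Range E1" "w \<in> Range E0 - Range E1" "x v = x w"
  moreover from this obtain u u' where u: "(u, v) \<in> E0" "u \<in> P" "(u', w) \<in> E0" "u' \<in> P"
    unfolding assms[symmetric] by blast
  ultimately have "x u = x u'" using x0 by metis
  then have "u = u'" using inj_x u by (auto dest: inj_onD)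
  then show "v = w" using u single_valued(1) by (auto dest: single_valuedD)
qed

section \<open>Leaf numbers, the isoperimetric inequality and its near-extremal cases\<close>

definition leaf_count :: "'a rel \<Rightarrow> 'a rel \<Rightarrow> 'a rel \<Rightarrow> nat" where
  "leaf_count E0 E1 E2 = src_leaves E0 E1 + src_leaves E1 E2 + src_leaves E2 E0
    + sink_leaves E0 E1 + sink_leaves E1 E2 + sink_leaves E2 E0"

context hexnet
begin

text \<open>Supplies the injectivity that \<open>hexnet_unique\<close> assumes. An interior vertex
  guarantees a zigzag, and by equality all upward leaves hang from the top one.\<close>

lemma inj_on_x_up_leaves:
  assumes "int (inner_count E0 E1) = net_area E0 E1 E2"
    and "0 < inner_count E0 E1"
  shows "inj_on x (Range E0 - Range E1)"
proof -
  have "E1 \<union> E2 \<noteq> {}" using assms(2) by (auto simp: inner_count_def)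
  then obtain p where "hexnet_top E0 E1 E2 x h p" using ex_top by blast
  then interpret hexnet_top E0 E1 E2 x h p .
  show ?thesis using up_inj extremal(3)[OF assms(1)] .
qed

text \<open>A vertex in two of the domains is in the third, so either of the other two classes can
  be used to recognise a leaf; the same holds for the ranges.\<close>

lemma leaves_rotate: "src_leaves E1 E2 = src_leaves E1 E0" "src_leaves E2 E1 = src_leaves E2 E0"
  "src_leaves E0 E2 = src_leaves E0 E1"
  "sink_leaves E1 E2 = sink_leaves E1 E0" "sink_leaves E2 E1 = sink_leaves E2 E0"
  "sink_leaves E0 E2 = sink_leaves E0 E1"
proof -
  have "Domain E1 - Domain E2 = Domain E1 - Domain E0" "Domain E2 - Domain E1 = Domain E2 - Domain E0"
    "Domain E0 - Domain E2 = Domain E0 - Domain E1"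
    using sources by blast+
  then show "src_leaves E1 E2 = src_leaves E1 E0" "src_leaves E2 E1 = src_leaves E2 E0"
    "src_leaves E0 E2 = src_leaves E0 E1" by (simp_all add: src_leaves_def)
  have "Range E1 - Range E2 = Range E1 - Range E0" "Range E2 - Range E1 = Range E2 - Range E0"
    "Range E0 - Range E2 = Range E0 - Range E1"
    using sinks by blast+
  then show "sink_leaves E1 E2 = sink_leaves E1 E0" "sink_leaves E2 E1 = sink_leaves E2 E0"
    "sink_leaves E0 E2 = sink_leaves E0 E1" by (simp_all add: sink_leaves_def)
qed

text \<open>Each class matches its sources with its sinks, and the inner vertices are common to all
  three classes. So the excess of sink leaves over source leaves is the same in every class; it is
  the \<open>d\<close> of the hexagon.\<close>

lemma balance:
  "card (Domain E0 \<inter> Domain E1) + src_leaves E0 E1 = card (Range E0 \<inter> Range E1) + sink_leaves E0 E1"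
  "card (Domain E0 \<inter> Domain E1) + src_leaves E1 E0 = card (Range E0 \<inter> Range E1) + sink_leaves E1 E0"
  "card (Domain E0 \<inter> Domain E1) + src_leaves E2 E0 = card (Range E0 \<inter> Range E1) + sink_leaves E2 E0"
proof -
  have D: "card A = card (A \<inter> B) + card (A - B)" if "finite A" for A B :: "'a set"
    using that by (rule card_Int_Diff)
  have m: "card (Domain E0) = card (Range E0)" "card (Domain E1) = card (Range E1)"
    "card (Domain E2) = card (Range E2)"
    using single_valued sv_converse by (auto intro: matching_card)
  note d = D[OF finite_ends(1), of "Domain E1"] D[OF finite_ends(2), of "Domain E0"] D[OF finite_ends(3), of "Domain E0"]
     D[OF finite_ends(4), of "Range E1"] D[OF finite_ends(5), of "Range E0"] D[OF finite_ends(6), of "Range E0"]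
  have c: "Domain E1 \<inter> Domain E0 = Domain E0 \<inter> Domain E1" "Domain E2 \<inter> Domain E0 = Domain E0 \<inter> Domain E1"
     "Range E1 \<inter> Range E0 = Range E0 \<inter> Range E1" "Range E2 \<inter> Range E0 = Range E0 \<inter> Range E1"
    using sources sinks by blast+
  show "card (Domain E0 \<inter> Domain E1) + src_leaves E0 E1 = card (Range E0 \<inter> Range E1) + sink_leaves E0 E1"
    "card (Domain E0 \<inter> Domain E1) + src_leaves E1 E0 = card (Range E0 \<inter> Range E1) + sink_leaves E1 E0"
    "card (Domain E0 \<inter> Domain E1) + src_leaves E2 E0 = card (Range E0 \<inter> Range E1) + sink_leaves E2 E0"
    using d m unfolding c src_leaves_def sink_leaves_def by auto
qed

lemma card_leaves:
  "card (net_vertices E0 E1 E2 - (Domain E0 \<inter> Domain E1) - (Range E0 \<inter> Range E1)) = leaf_count E0 E1 E2"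
proof -
  let ?D = "(Domain E0 - Domain E1) \<union> (Domain E1 - Domain E2) \<union> (Domain E2 - Domain E0)"
  let ?R = "(Range E0 - Range E1) \<union> (Range E1 - Range E2) \<union> (Range E2 - Range E0)"
  have v: "net_vertices E0 E1 E2 = (Domain E0 \<union> Domain E1 \<union> Domain E2) \<union> (Range E0 \<union> Range E1 \<union> Range E2)"
    by (auto simp: net_vertices_def Field_def)
  have D: "Domain E0 \<union> Domain E1 \<union> Domain E2 = (Domain E0 \<inter> Domain E1) \<union> ?D" "(Domain E0 \<inter> Domain E1) \<inter> ?D = {}"
    using sources by blast+
  have R: "Range E0 \<union> Range E1 \<union> Range E2 = (Range E0 \<inter> Range E1) \<union> ?R" "(Range E0 \<inter> Range E1) \<inter> ?R = {}"
    using sinks by blast+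
  have *: "A \<union> B - A' - B' = A'' \<union> B''" "A'' \<inter> B'' = {}"
    if "A \<inter> B = {}" "A = A' \<union> A''" "A' \<inter> A'' = {}" "B = B' \<union> B''" "B' \<inter> B'' = {}"
    for A B A' A'' B' B'' :: "'a set"
    using that by blast+
  have "net_vertices E0 E1 E2 - (Domain E0 \<inter> Domain E1) - (Range E0 \<inter> Range E1) = ?D \<union> ?R"
    unfolding v by (rule *(1)[OF bipartite D R])
  moreover have "card (?D \<union> ?R) = card ?D + card ?R"
    using finite_ends by (intro card_Un_disjoint *(2)[OF bipartite D R]) simp_all
  ultimately have "card (net_vertices E0 E1 E2 - (Domain E0 \<inter> Domain E1) - (Range E0 \<inter> Range E1))
      = card ?D + card ?R"
    by simp
  moreover have "card ?D = card ((Domain E0 - Domain E1) \<union> (Domain E1 - Domain E2)) + card (Domain E2 - Domain E0)"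
    using finite_ends sources by (intro card_Un_disjoint; (simp; fail)?) blast
  moreover have "card ((Domain E0 - Domain E1) \<union> (Domain E1 - Domain E2)) = card (Domain E0 - Domain E1) + card (Domain E1 - Domain E2)"
    using finite_ends by (intro card_Un_disjoint; (simp; fail)?) blast
  moreover have "card ?R = card ((Range E0 - Range E1) \<union> (Range E1 - Range E2)) + card (Range E2 - Range E0)"
    using finite_ends sinks by (intro card_Un_disjoint; (simp; fail)?) blast
  moreover have "card ((Range E0 - Range E1) \<union> (Range E1 - Range E2)) = card (Range E0 - Range E1) + card (Range E1 - Range E2)"
    using finite_ends by (intro card_Un_disjoint; (simp; fail)?) blast
  ultimately show ?thesis by (simp add: leaf_count_def src_leaves_def sink_leaves_def)
qed

lemma card_interior:
  "card ((Domain E0 \<inter> Domain E1) \<union> (Range E0 \<inter> Range E1)) = inner_count E0 E1"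
  unfolding inner_count_def using finite_ends bipartite by (intro card_Un_disjoint) auto

text \<open>The leaf number is \<open>2 * (p0 + p1 + p2) + 3 * d\<close>. It has the parity of
  \<open>d\<close>, and so do the area and the number of interior vertices, the latter being
  \<open>d\<close> more than twice the number of inner sinks.\<close>

lemma area_identity:
  defines "p0 \<equiv> int (src_leaves E0 E1)" and "p1 \<equiv> int (src_leaves E1 E0)"
    and "p2 \<equiv> int (src_leaves E2 E0)" and "n \<equiv> int (leaf_count E0 E1 E2)"
    and "d \<equiv> int (sink_leaves E0 E1) - int (src_leaves E0 E1)"
    and "M \<equiv> net_area E0 E1 E2"
  shows "6 * M + (3 * d\<^sup>2 + 2 * ((p0 - p1)\<^sup>2 + (p1 - p2)\<^sup>2 + (p2 - p0)\<^sup>2)) = n\<^sup>2" and "even (M + n)"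
    and "even (int (inner_count E0 E1) + n)"
proof -
  have q: "int (sink_leaves E0 E1) = p0 + d" "int (sink_leaves E1 E0) = p1 + d" "int (sink_leaves E2 E0) = p2 + d"
    using balance by (simp_all add: p0_def p1_def p2_def d_def)
  have n: "n = 2 * (p0 + p1 + p2) + 3 * d"
    unfolding n_def leaf_count_def leaves_rotate of_nat_add q
    by (simp add: p0_def[symmetric] p1_def[symmetric] p2_def[symmetric])
  have M: "M = (p2 + (p0 + d) + p1)\<^sup>2 - p2\<^sup>2 - p1\<^sup>2 - p0\<^sup>2"
    unfolding M_def hexagon_area_def q by (simp add: p0_def p1_def p2_def)
  show "6 * M + (3 * d\<^sup>2 + 2 * ((p0 - p1)\<^sup>2 + (p1 - p2)\<^sup>2 + (p2 - p0)\<^sup>2)) = n\<^sup>2"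
    unfolding M n by (simp add: power2_eq_square algebra_simps)
  show "even (M + n)" unfolding M n by auto
  have "int (card (Domain E0 \<inter> Domain E1)) + p0 = int (card (Range E0 \<inter> Range E1)) + (p0 + d)"
    using balance(1) unfolding q(1)[symmetric] by (simp add: p0_def)
  then have "int (inner_count E0 E1) = 2 * int (card (Range E0 \<inter> Range E1)) + d"
    unfolding inner_count_def by simp
  then show "even (int (inner_count E0 E1) + n)" using n by simp
qed

lemma isoperimetric: "6 * inner_count E0 E1 \<le> (leaf_count E0 E1 E2)\<^sup>2"
proof -
  define M where "M = net_area E0 E1 E2"
  have "int (inner_count E0 E1) \<le> M" unfolding M_def using hexnet_bound hexnet_axioms .
  moreover have "6 * M \<le> (int (leaf_count E0 E1 E2))\<^sup>2"
    using area_identity(1) unfolding M_def by (smt (verit) zero_le_power2)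
  ultimately have "int (6 * inner_count E0 E1) \<le> int ((leaf_count E0 E1 E2)\<^sup>2)" by simp
  then show ?thesis by (simp only: of_nat_le_iff)
qed

lemma parity: "even (inner_count E0 E1 + leaf_count E0 E1 E2)"
proof -
  have "even (int (inner_count E0 E1 + leaf_count E0 E1 E2))"
    using area_identity(3) by simp
  then show ?thesis by (simp only: even_of_nat)
qed

end

text \<open>Here \<open>a\<close>, \<open>b\<close> and \<open>a + b\<close> stand for
  \<open>p0 - p1\<close>, \<open>p1 - p2\<close> and \<open>p0 - p2\<close>. A square of at least 4
  would already contribute 8, or 12 in the case of \<open>d\<close>. If \<open>a\<close> and
  \<open>b\<close> are both nonzero, they must have opposite signs, as otherwise their sum would be
  too large.\<close>

lemma squares_le_7:
  fixes d a b :: int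
  assumes "3 * d\<^sup>2 + 2 * (a\<^sup>2 + b\<^sup>2 + (a + b)\<^sup>2) \<le> 7"
  shows "\<bar>d\<bar> \<le> 1" and "b = 0 \<and> \<bar>a\<bar> \<le> 1 \<or> a = 0 \<and> \<bar>b\<bar> \<le> 1 \<or> a + b = 0 \<and> \<bar>a\<bar> \<le> 1"
proof -
  have sq: "4 \<le> t\<^sup>2" if "2 \<le> \<bar>t\<bar>" for t :: int
    using power_mono[OF that, of 2] by simp
  have nn: "0 \<le> d\<^sup>2" "0 \<le> a\<^sup>2" "0 \<le> b\<^sup>2" "0 \<le> (a + b)\<^sup>2" by simp_all
  have le: "3 * d\<^sup>2 + 2 * a\<^sup>2 + 2 * b\<^sup>2 + 2 * (a + b)\<^sup>2 \<le> 7"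
    using assms by (simp only: distrib_left)
  show "\<bar>d\<bar> \<le> 1" using sq[of d] nn le by (smt (verit))
  have "\<bar>a\<bar> \<le> 1" "\<bar>b\<bar> \<le> 1" using sq[of a] sq[of b] nn le by (smt (verit))+
  moreover have "\<bar>a + b\<bar> \<le> 1" using sq[of "a + b"] nn le by (smt (verit))
  ultimately show "b = 0 \<and> \<bar>a\<bar> \<le> 1 \<or> a = 0 \<and> \<bar>b\<bar> \<le> 1 \<or> a + b = 0 \<and> \<bar>a\<bar> \<le> 1"
    by linarith
qed

text \<open>In the near-extremal case exactly these leaf numbers are left, up to a rotation by a multiple
  of 60 degrees; a rotation by an odd multiple exchanges sources and sinks.\<close>

definition normal_profile :: "'a rel \<Rightarrow> 'a rel \<Rightarrow> 'a rel \<Rightarrow> bool" where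
  "normal_profile E0 E1 E2 \<longleftrightarrow> src_leaves E1 E0 = src_leaves E2 E0 \<and>
    \<bar>int (src_leaves E0 E1) - int (src_leaves E1 E0)\<bar> \<le> 1 \<and>
    (sink_leaves E0 E1 = src_leaves E0 E1 \<or> sink_leaves E0 E1 = Suc (src_leaves E0 E1))"

lemma leaves_converse: "src_leaves (E\<inverse>) (F\<inverse>) = sink_leaves E F" "sink_leaves (E\<inverse>) (F\<inverse>) = src_leaves E F"
  by (simp_all add: src_leaves_def sink_leaves_def)

context hexnet
begin

lemma near_extremal:
  assumes "(leaf_count E0 E1 E2)\<^sup>2 \<le> 6 * inner_count E0 E1 + 7"
  shows "normal_profile E0 E1 E2 \<or> normal_profile E1 E2 E0 \<or> normal_profile E2 E0 E1 \<or>
    normal_profile (E0\<inverse>) (E1\<inverse>) (E2\<inverse>) \<or> normal_profile (E1\<inverse>) (E2\<inverse>) (E0\<inverse>) \<or>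
    normal_profile (E2\<inverse>) (E0\<inverse>) (E1\<inverse>)"
proof -
  define p0 p1 p2 where "p0 = int (src_leaves E0 E1)" and "p1 = int (src_leaves E1 E0)"
    and "p2 = int (src_leaves E2 E0)"
  define d where "d = int (sink_leaves E0 E1) - int (src_leaves E0 E1)"
  define M where "M = net_area E0 E1 E2"
  have "int (inner_count E0 E1) \<le> M" unfolding M_def using hexnet_bound hexnet_axioms .
  moreover have "int ((leaf_count E0 E1 E2)\<^sup>2) \<le> int (6 * inner_count E0 E1 + 7)"
    using assms by (simp only: of_nat_le_iff)
  moreover have "6 * M + (3 * d\<^sup>2 + 2 * ((p0 - p1)\<^sup>2 + (p1 - p2)\<^sup>2 + (p2 - p0)\<^sup>2)) = int ((leaf_count E0 E1 E2)\<^sup>2)"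
    using area_identity(1) unfolding M_def d_def p0_def p1_def p2_def by simp
  ultimately have "3 * d\<^sup>2 + 2 * ((p0 - p1)\<^sup>2 + (p1 - p2)\<^sup>2 + (p2 - p0)\<^sup>2) \<le> 7"
    unfolding of_nat_add of_nat_mult by simp
  moreover have "(p2 - p0)\<^sup>2 = ((p0 - p1) + (p1 - p2))\<^sup>2" by (simp add: power2_eq_square algebra_simps)
  ultimately have le: "3 * d\<^sup>2 + 2 * ((p0 - p1)\<^sup>2 + (p1 - p2)\<^sup>2 + ((p0 - p1) + (p1 - p2))\<^sup>2) \<le> 7" by simp
  have d: "d = 0 \<or> d = 1 \<or> d = -1" using squares_le_7(1)[OF le] by linarith
  have p: "p1 = p2 \<and> \<bar>p0 - p1\<bar> \<le> 1 \<or> p0 = p1 \<and> \<bar>p2 - p0\<bar> \<le> 1 \<or> p0 = p2 \<and> \<bar>p1 - p2\<bar> \<le> 1"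
    using squares_le_7(2)[OF le] by linarith
  have q: "int (sink_leaves E0 E1) = p0 + d" "int (sink_leaves E1 E0) = p1 + d" "int (sink_leaves E2 E0) = p2 + d"
    using balance by (simp_all add: p0_def p1_def p2_def d_def)
  have norm: "normal_profile E0 E1 E2 \<longleftrightarrow> p1 = p2 \<and> \<bar>p0 - p1\<bar> \<le> 1 \<and> (d = 0 \<or> d = 1)"
    "normal_profile E1 E2 E0 \<longleftrightarrow> p2 = p0 \<and> \<bar>p1 - p2\<bar> \<le> 1 \<and> (d = 0 \<or> d = 1)"
    "normal_profile E2 E0 E1 \<longleftrightarrow> p0 = p1 \<and> \<bar>p2 - p0\<bar> \<le> 1 \<and> (d = 0 \<or> d = 1)"
    "normal_profile (E0\<inverse>) (E1\<inverse>) (E2\<inverse>) \<longleftrightarrow> p1 = p2 \<and> \<bar>p0 - p1\<bar> \<le> 1 \<and> (d = 0 \<or> d = -1)"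
    "normal_profile (E1\<inverse>) (E2\<inverse>) (E0\<inverse>) \<longleftrightarrow> p2 = p0 \<and> \<bar>p1 - p2\<bar> \<le> 1 \<and> (d = 0 \<or> d = -1)"
    "normal_profile (E2\<inverse>) (E0\<inverse>) (E1\<inverse>) \<longleftrightarrow> p0 = p1 \<and> \<bar>p2 - p0\<bar> \<le> 1 \<and> (d = 0 \<or> d = -1)"
    using q unfolding normal_profile_def leaves_converse leaves_rotate p0_def p1_def p2_def
    by linarith+
  show ?thesis unfolding norm using d p by (elim disjE conjE) simp_all
qed

end

text \<open>With \<open>p\<close> for the common value of the last two source leaf numbers and \<open>p + e\<close> for the first,
  the total is \<open>6 * p + 2 * e + 3 * d\<close>, and the residue modulo 6 determines \<open>e\<close> and \<open>d\<close>.\<close>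

lemma normal_profile_unique:
  assumes "hexnet E0 E1 E2 x h" "hexnet G0 G1 G2 y k"
    and "normal_profile E0 E1 E2" "normal_profile G0 G1 G2"
    and n: "leaf_count E0 E1 E2 = leaf_count G0 G1 G2"
  shows "src_leaves E2 E0 = src_leaves G2 G0" "sink_leaves E0 E1 = sink_leaves G0 G1"
    "src_leaves E1 E0 = src_leaves G1 G0" "src_leaves E0 E1 = src_leaves G0 G1"
proof -
  interpret A: hexnet E0 E1 E2 x h by fact
  interpret B: hexnet G0 G1 G2 y k by fact
  have arith: "a = a' \<and> p = p' \<and> s = s'"
    if "\<bar>a - p\<bar> \<le> 1" "\<bar>a' - p'\<bar> \<le> 1" "s = a \<or> s = a + 1" "s' = a' \<or> s' = a' + 1"
      "2 * a + 4 * p + 3 * (s - a) = 2 * a' + 4 * p' + 3 * (s' - a')"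
    for a a' p p' s s' :: int
  proof -
    have "a = p - 1 \<or> a = p \<or> a = p + 1" "a' = p' - 1 \<or> a' = p' \<or> a' = p' + 1"
      using that(1,2) by linarith+
    then show ?thesis using that(3,4,5) by (elim disjE; (simp; fail | simp, presburger))
  qed
  define a p s where "a = int (src_leaves E0 E1)" and "p = int (src_leaves E1 E0)" and "s = int (sink_leaves E0 E1)"
  define a' p' s' where "a' = int (src_leaves G0 G1)" and "p' = int (src_leaves G1 G0)" and "s' = int (sink_leaves G0 G1)"
  have E: "src_leaves E2 E0 = src_leaves E1 E0" and G: "src_leaves G2 G0 = src_leaves G1 G0"
    using assms by (simp_all add: normal_profile_def)
  have "int (leaf_count E0 E1 E2) = 2 * a + 4 * p + 3 * (s - a)"
    using A.balance E unfolding leaf_count_def A.leaves_rotate a_def p_def s_def by simp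
  moreover have "int (leaf_count G0 G1 G2) = 2 * a' + 4 * p' + 3 * (s' - a')"
    using B.balance G unfolding leaf_count_def B.leaves_rotate a'_def p'_def s'_def by simp
  ultimately have "a = a' \<and> p = p' \<and> s = s'"
    using assms(3,4) n unfolding normal_profile_def
    by (intro arith) (auto simp: a_def p_def s_def a'_def p'_def s'_def)
  then show "src_leaves E2 E0 = src_leaves G2 G0" "sink_leaves E0 E1 = sink_leaves G0 G1"
    "src_leaves E1 E0 = src_leaves G1 G0" "src_leaves E0 E1 = src_leaves G0 G1"
    using E G by (simp_all add: a_def p_def s_def a'_def p'_def s'_def)
qed

definition extremal_net :: "'a rel \<Rightarrow> 'a rel \<Rightarrow> 'a rel \<Rightarrow> ('a \<Rightarrow> real) \<Rightarrow> bool" where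
  "extremal_net E0 E1 E2 x \<longleftrightarrow> (\<exists>h. hexnet E0 E1 E2 x h) \<and> normal_profile E0 E1 E2 \<and>
    int (inner_count E0 E1) = net_area E0 E1 E2 \<and> inj_on x (Range E0 - Range E1)"

theorem extremal_net_unique:
  assumes "extremal_net E0 E1 E2 x" "extremal_net G0 G1 G2 y"
    and "leaf_count E0 E1 E2 = leaf_count G0 G1 G2"
  shows "\<exists>f. net_iso E0 E1 E2 x G0 G1 G2 y f"
proof -
  obtain h k where hk: "hexnet E0 E1 E2 x h" "hexnet G0 G1 G2 y k"
    using assms by (auto simp: extremal_net_def)
  note normal = normal_profile_unique[OF hk _ _ assms(3)]
  show ?thesis
    using assms(1,2) unfolding extremal_net_def by (intro hexnet_unique[OF hk normal]) blast+
qed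

section \<open>Critical cubic graphs\<close>

definition omega3 :: complex where
  "omega3 = Complex (- 1 / 2) (sqrt 3 / 2)"

lemma omega3_power2: "omega3\<^sup>2 = Complex (- 1 / 2) (- sqrt 3 / 2)"
  by (simp add: omega3_def power2_eq_square complex_eq_iff)

lemma omega3_sum: "1 + omega3 + omega3\<^sup>2 = 0"
  unfolding omega3_power2 by (simp add: omega3_def complex_eq_iff)

lemma omega3_cube: "omega3 ^ 3 = 1"
  unfolding power3_eq_cube omega3_def by (simp add: complex_eq_iff)

lemma norm_omega3: "norm omega3 = 1"
  by (simp add: omega3_def cmod_def power_divide)

lemma cube_root_of_unity:
  assumes "z ^ 3 = (1 :: complex)"
  shows "z = 1 \<or> z = omega3 \<or> z = omega3\<^sup>2"
proof -
  have "(z - 1) * (z - omega3) * (z - omega3\<^sup>2)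
      = z ^ 3 - omega3 ^ 3 - (1 + omega3 + omega3\<^sup>2) * (z\<^sup>2 - omega3 * z)"
    by (simp add: power2_eq_square power3_eq_cube algebra_simps)
  also have "\<dots> = 0" using assms omega3_sum omega3_cube by simp
  finally show ?thesis by auto
qed

text \<open>Divided by \<open>a\<close>, the other two are unit vectors with sum -1, and comparing
  their norms gives the real part -1/2.\<close>

lemma unit_sum_zero:
  assumes "norm a = 1" "norm b = 1" "norm c = 1" "a + b + c = (0 :: complex)"
  shows "b = a * omega3 \<and> c = a * omega3\<^sup>2 \<or> b = a * omega3\<^sup>2 \<and> c = a * omega3"
proof -
  have a: "a \<noteq> 0" using assms(1) by auto
  define p where "p = b / a"
  define q where "q = c / a"
  have bc: "b = a * p" "c = a * q" using a by (simp_all add: p_def q_def)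
  have "a * (1 + p + q) = 0" using assms(4) unfolding bc by (simp add: algebra_simps)
  then have "1 + p + q = 0" using a by simp
  then have q: "q = - 1 - p" by (simp add: add_eq_0_iff)
  have "norm p = 1" "norm q = 1" using assms by (simp_all add: p_def q_def norm_divide)
  then have n: "(Re p)\<^sup>2 + (Im p)\<^sup>2 = 1" "(Re q)\<^sup>2 + (Im q)\<^sup>2 = 1"
    by (simp_all add: cmod_def)
  have re: "Re p = - 1 / 2" using n q by (simp add: power2_eq_square algebra_simps)
  then have "(Im p)\<^sup>2 = (sqrt 3 / 2)\<^sup>2" using n(1) by (simp add: power_divide)
  then have "Im p = sqrt 3 / 2 \<or> Im p = - sqrt 3 / 2" by (auto simp: power2_eq_iff)
  then have "p = omega3 \<or> p = omega3\<^sup>2"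
    unfolding omega3_power2 using re by (auto simp: omega3_def complex_eq_iff)
  moreover have "omega3\<^sup>2 = - 1 - omega3" "omega3 = - 1 - omega3\<^sup>2"
    using omega3_sum by (simp_all add: add_eq_0_iff)
  ultimately show ?thesis unfolding bc using q by metis
qed

text \<open>Each step turns by -120 degrees, so \<open>c = 0, 1, 2\<close> gives 90, -30 and 210
  degrees. These are the cube roots of \<open>- \<i>\<close> and their opposites those of
  \<open>\<i>\<close>. As the directions at a vertex have a common cube, the cube separates sources
  from sinks.\<close>

definition dir :: "nat \<Rightarrow> complex" where
  "dir c = \<i> * omega3 ^ (2 * c)"

lemma dir_0: "dir 0 = \<i>" by (simp add: dir_def)

lemma dir_1: "dir 1 = Complex (sqrt 3 / 2) (- 1 / 2)"
  by (simp add: dir_def omega3_power2 complex_eq_iff)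

lemma omega3_power4: "omega3 ^ 4 = omega3"
  using omega3_cube by (simp add: eval_nat_numeral)

lemma dir_2: "dir 2 = Complex (- sqrt 3 / 2) (- 1 / 2)"
  by (simp add: dir_def omega3_power4) (simp add: omega3_def complex_eq_iff)

lemma dir_3: "dir 3 = dir 0"
proof -
  have "omega3 ^ 6 = (omega3 ^ 3)\<^sup>2" by (simp add: power_mult[symmetric])
  then show ?thesis by (simp add: dir_def omega3_cube)
qed

lemma dir_Suc: "dir (Suc c) * omega3 = dir c"
  using omega3_cube by (simp add: dir_def eval_nat_numeral algebra_simps)

lemma dir_cube: "dir c ^ 3 = - \<i>"
proof -
  have "(omega3 ^ (2 * c)) ^ 3 = (omega3 ^ 3) ^ (2 * c)"
    by (metis power_mult mult.commute)
  then show ?thesis by (simp add: dir_def power_mult_distrib omega3_cube) (simp add: power3_eq_cube)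
qed

lemma dirI:
  assumes "a ^ 3 = - \<i>"
  shows "a = dir 0 \<or> a = dir 1 \<or> a = dir 2"
proof -
  have a: "a = \<i> * (a / \<i>)" by simp
  have "(a / \<i>) ^ 3 = 1" by (simp only: power_divide assms) (simp add: power3_eq_cube)
  then have "a / \<i> = 1 \<or> a / \<i> = omega3 \<or> a / \<i> = omega3\<^sup>2" by (rule cube_root_of_unity)
  then have "a = \<i> * 1 \<or> a = \<i> * omega3 \<or> a = \<i> * omega3\<^sup>2" using a by metis
  moreover have "dir 1 = \<i> * omega3\<^sup>2" "dir 2 = \<i> * omega3"
    using omega3_power4 by (simp_all add: dir_def)
  ultimately show ?thesis unfolding dir_0 by auto
qed

text \<open>\<open>\<beta>\<close> is the rotation into standard position. A factor
  \<open>omega3\<close> permutes the three classes cyclically and a change of sign reverses all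
  edges, so every rotation of the hexagon is a change of \<open>\<beta>\<close>.\<close>

definition dir_rel :: "complex set set \<Rightarrow> complex \<Rightarrow> nat \<Rightarrow> complex rel" where
  "dir_rel E \<beta> c = {(u, v). {u, v} \<in> E \<and> \<beta> * sgn (v - u) = dir c}"

lemma dir_rel_rotate: "dir_rel E (\<beta> * omega3) c = dir_rel E \<beta> (Suc c)"
proof -
  have "\<beta> * omega3 * s = dir c \<longleftrightarrow> \<beta> * s = dir (Suc c)" for s
  proof -
    have "omega3 \<noteq> 0" using norm_omega3 by auto
    then have "\<beta> * s = dir (Suc c) \<longleftrightarrow> (\<beta> * s) * omega3 = dir (Suc c) * omega3" by simp
    then show ?thesis unfolding dir_Suc by (simp add: ac_simps)
  qed
  then show ?thesis by (simp add: dir_rel_def)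
qed

lemma sgn_minus_commute: "sgn (u - v) = - sgn (v - u)" for u v :: complex
  by (metis minus_diff_eq sgn_minus)

lemma dir_rel_converse: "dir_rel E (- \<beta>) c = (dir_rel E \<beta> c)\<inverse>"
proof -
  have "- \<beta> * sgn (v - u) = \<beta> * sgn (u - v)" for u v
    by (simp add: sgn_minus_commute[of u v])
  moreover have "{u, v} = {v, u}" for u v :: complex by blast
  ultimately show ?thesis unfolding dir_rel_def by auto
qed

lemma dir_rel_3: "dir_rel E \<beta> 3 = dir_rel E \<beta> 0"
  by (simp add: dir_rel_def dir_3)

text \<open>The point of the edge with rotated abscissa \<open>t\<close>; it presents an edge that
  is not vertical as a graph over its abscissae, the form that \<open>arcs_rank\<close>
  requires.\<close>

definition dart_point :: "complex \<Rightarrow> complex \<times> complex \<Rightarrow> real \<Rightarrow> complex" where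
  "dart_point \<beta> e t = fst e + ((t - Re (\<beta> * fst e)) / (Re (\<beta> * snd e) - Re (\<beta> * fst e))) *\<^sub>R (snd e - fst e)"

lemma Re_dart_point:
  assumes "Re (\<beta> * fst e) < Re (\<beta> * snd e)"
  shows "Re (\<beta> * dart_point \<beta> e t) = t"
proof -
  have "Re (\<beta> * (fst e + s *\<^sub>R (snd e - fst e))) = Re (\<beta> * fst e) + s * (Re (\<beta> * snd e) - Re (\<beta> * fst e))" for s
    by (simp add: algebra_simps)
  then show ?thesis unfolding dart_point_def using assms by (simp del: times_complex.sel)
qed

lemma dart_point_in:
  assumes "Re (\<beta> * fst e) < Re (\<beta> * snd e)" "t \<in> {Re (\<beta> * fst e)..Re (\<beta> * snd e)}"
  shows "dart_point \<beta> e t \<in> convex hull {fst e, snd e}"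
proof -
  define s where "s = (t - Re (\<beta> * fst e)) / (Re (\<beta> * snd e) - Re (\<beta> * fst e))"
  have "0 \<le> s" "s \<le> 1" using assms by (simp_all add: s_def)
  moreover have "dart_point \<beta> e t = (1 - s) *\<^sub>R fst e + s *\<^sub>R snd e"
    unfolding dart_point_def s_def[symmetric] by (simp add: algebra_simps)
  ultimately show ?thesis unfolding segment_convex_hull[symmetric] in_segment by blast
qed

lemma dart_point_ends:
  assumes "Re (\<beta> * fst e) < Re (\<beta> * snd e)"
  shows "dart_point \<beta> e (Re (\<beta> * fst e)) = fst e" "dart_point \<beta> e (Re (\<beta> * snd e)) = snd e"
  using assms by (simp_all add: dart_point_def del: times_complex.sel)

section \<open>From a critical cubic graph to a net\<close>

locale critical_cubic =
  fixes V E
  assumes crit: "critical V E" and cubic: "three_boundary_regular V E"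
begin

lemma plane: "plane_graph V E" using crit by (simp add: critical_def)

lemma finite_V: "finite V" and finite_E: "finite E"
  using plane_graph_finite[OF plane] by auto

lemma edge: assumes "{u, v} \<in> E" shows "u \<in> V" "v \<in> V" "u \<noteq> v"
proof -
  have "{u, v} \<subseteq> V \<and> card {u, v} = 2" using plane assms by (auto simp: plane_graph_def)
  then show "u \<in> V" "v \<in> V" "u \<noteq> v" by auto
qed

lemma norm_dir: "{u, v} \<in> E \<Longrightarrow> norm (sgn (v - u)) = 1"
  using edge(3)[of u v] by (auto simp: norm_sgn)

lemma no_vertex: "{u, v} \<in> E \<Longrightarrow> open_segment u v \<inter> V = {}"
  using plane by (auto simp: plane_graph_def)

lemma edges_meet: "e \<in> E \<Longrightarrow> e' \<in> E \<Longrightarrow> e \<noteq> e' \<Longrightarrow> convex hull e \<inter> convex hull e' \<subseteq> V"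
proof -
  have "\<forall>e\<in>E. \<forall>e'\<in>E. e \<noteq> e' \<longrightarrow> convex hull e \<inter> convex hull e' \<subseteq> V"
    using plane by (simp add: plane_graph_def)
  then show "e \<in> E \<Longrightarrow> e' \<in> E \<Longrightarrow> e \<noteq> e' \<Longrightarrow> convex hull e \<inter> convex hull e' \<subseteq> V" by blast
qed

text \<open>The shorter of two such edges would end inside the longer one, where no vertex may
  lie.\<close>

lemma same_direction:
  assumes "{u, v} \<in> E" "{u, v'} \<in> E" "sgn (v - u) = sgn (v' - u)"
  shows "v = v'"
proof -
  have *: "v = v'" if e: "{u, v} \<in> E" "{u, v'} \<in> E" and s: "sgn (v - u) = sgn (v' - u)"
    and le: "norm (v - u) \<le> norm (v' - u)" for v v'
  proof (rule ccontr)
    assume ne: "v \<noteq> v'"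
    have uv: "u \<noteq> v" "u \<noteq> v'" using edge(3) e by auto
    define t where "t = norm (v - u) / norm (v' - u)"
    have eq: "x - u = norm (x - u) *\<^sub>R sgn (x - u)" for x
      by (cases "x = u") (simp_all add: sgn_div_norm)
    have "t *\<^sub>R (v' - u) = t *\<^sub>R (norm (v' - u) *\<^sub>R sgn (v' - u))" using eq[of v'] by simp
    also have "\<dots> = norm (v - u) *\<^sub>R sgn (v - u)" using uv by (simp add: t_def s)
    also have "\<dots> = v - u" using eq[of v] by simp
    finally have "v - u = t *\<^sub>R (v' - u)" by simp
    then have v: "v = (1 - t) *\<^sub>R u + t *\<^sub>R v'" by (simp add: algebra_simps)
    have "0 < t" "t \<le> 1" using uv le by (simp_all add: t_def)
    moreover have "t \<noteq> 1" using v ne by auto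
    ultimately have "v \<in> open_segment u v'" unfolding in_segment using v uv by force
    then show False using no_vertex[OF e(2)] edge(2)[OF e(1)] by blast
  qed
  show ?thesis
    using *[OF assms(1,2,3)] *[OF assms(2,1) assms(3)[symmetric]] by (metis nle_le)
qed

lemma card_neighbours: "v \<in> V \<Longrightarrow> card (neighbours E v) = vertex_degree E v"
proof -
  assume "v \<in> V"
  have "inj_on (\<lambda>w. {v, w}) (neighbours E v)" by (auto simp: inj_on_def doubleton_eq_iff)
  moreover have "(\<lambda>w. {v, w}) ` neighbours E v = incident_edges E v"
  proof (intro equalityI subsetI)
    fix e assume "e \<in> incident_edges E v"
    then have e: "e \<in> E" "v \<in> e" by (auto simp: incident_edges_def)
    then have "card e = 2" using plane by (auto simp: plane_graph_def)
    then obtain w where "e = {v, w}" using e(2) by (auto simp: card_2_iff insert_commute)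
    then show "e \<in> (\<lambda>w. {v, w}) ` neighbours E v" using e by (auto simp: neighbours_def)
  qed (auto simp: neighbours_def incident_edges_def)
  ultimately show ?thesis by (metis card_image vertex_degree_def)
qed

abbreviation "B \<equiv> boundary_points V E"

definition "dirs u = (\<lambda>w. sgn (w - u)) ` neighbours E u"

lemma dirs_unit: "a \<in> dirs u \<Longrightarrow> norm a = 1"
  unfolding dirs_def neighbours_def using norm_dir by blast

lemma dirs_boundary: "u \<in> B \<Longrightarrow> a \<in> dirs u \<Longrightarrow> dirs u = {a}"
proof -
  assume u: "u \<in> B" "a \<in> dirs u"
  then have "card (neighbours E u) = 1" using card_neighbours by (auto simp: boundary_points_def)
  then obtain w where "neighbours E u = {w}" by (auto simp: card_1_singleton_iff)
  then show ?thesis using u(2) by (auto simp: dirs_def)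
qed

lemma dirs_interior: 
  assumes u: "u \<in> V" "u \<notin> B" and a: "a \<in> dirs u"
  shows "dirs u = {a, a * omega3, a * omega3\<^sup>2}"
proof -
  have "card (neighbours E u) = 3"
    using card_neighbours[OF u(1)] cubic u by (auto simp: three_boundary_regular_def)
  obtain w where w: "w \<in> neighbours E u" "a = sgn (w - u)" using a by (auto simp: dirs_def)
  have "card (neighbours E u - {w}) = 2" using \<open>card (neighbours E u) = 3\<close> w(1) by simp
  then obtain w' w'' where "neighbours E u - {w} = {w', w''}" "w' \<noteq> w''"
    unfolding card_2_iff by blast
  then have ww: "neighbours E u = {w, w', w''}" "w \<noteq> w'" "w' \<noteq> w''" "w \<noteq> w''"
    using w(1) by blast+
  have "(\<Sum>w\<in>neighbours E u. sgn (w - u)) = 0" using crit u by (simp add: critical_def)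
  then have "sgn (w - u) + sgn (w' - u) + sgn (w'' - u) = 0" using ww by (simp add: add.assoc)
  moreover have "norm (sgn (w - u)) = 1" "norm (sgn (w' - u)) = 1" "norm (sgn (w'' - u)) = 1"
    using norm_dir[of u] ww(1) unfolding neighbours_def by blast+
  ultimately have "sgn (w' - u) = a * omega3 \<and> sgn (w'' - u) = a * omega3\<^sup>2 \<or>
      sgn (w' - u) = a * omega3\<^sup>2 \<and> sgn (w'' - u) = a * omega3"
    using unit_sum_zero w(2) by blast
  then show ?thesis unfolding dirs_def ww(1) using w(2) by auto
qed

lemma dirs_cube: "u \<in> V \<Longrightarrow> a \<in> dirs u \<Longrightarrow> b \<in> dirs u \<Longrightarrow> a ^ 3 = b ^ 3"
proof -
  assume u: "u \<in> V" "a \<in> dirs u" "b \<in> dirs u"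
  have "(omega3\<^sup>2) ^ 3 = (omega3 ^ 3)\<^sup>2" by (simp add: power_mult[symmetric])
  then have "(omega3\<^sup>2) ^ 3 = 1" using omega3_cube by simp
  then show ?thesis
    using dirs_boundary[of u a] dirs_interior[of u a] u omega3_cube
    by (cases "u \<in> B") (auto simp: power_mult_distrib)
qed

lemma two_dirs_interior: "u \<in> V \<Longrightarrow> a \<in> dirs u \<Longrightarrow> b \<in> dirs u \<Longrightarrow> a \<noteq> b \<Longrightarrow> u \<notin> B"
  using dirs_boundary by blast

lemma Domain_dir_rel: "u \<in> Domain (dir_rel E \<beta> c) \<longleftrightarrow> dir c \<in> (*) \<beta> ` dirs u"
  by (auto simp: dir_rel_def dirs_def neighbours_def image_iff)

lemma Range_dir_rel: "u \<in> Range (dir_rel E \<beta> c) \<longleftrightarrow> - dir c \<in> (*) \<beta> ` dirs u"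
proof -
  have "\<beta> * sgn (u - v) = dir c \<longleftrightarrow> - dir c = \<beta> * sgn (v - u)" for v
    unfolding sgn_minus_commute[of u v] by (metis minus_minus mult_minus_right)
  then show ?thesis
    by (auto simp: dir_rel_def dirs_def neighbours_def image_iff insert_commute[of _ u])
qed

lemma edge_dir: "{u, v} \<in> E \<Longrightarrow> sgn (v - u) \<in> dirs u"
  by (auto simp: dirs_def neighbours_def)

abbreviation "rel \<equiv> dir_rel E"

lemma dir_rel_subset: "rel \<beta> c \<subseteq> V \<times> V"
  using edge by (auto simp: dir_rel_def)

lemma finite_dir_rel: "finite (rel \<beta> c)"
  using finite_subset[OF dir_rel_subset] finite_V by blast

lemma single_valued_dir_rel:
  assumes "\<beta> \<noteq> 0"
  shows "single_valued (rel \<beta> c)" and "single_valued ((rel \<beta> c)\<inverse>)"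
proof -
  have *: "single_valued (rel \<gamma> c)" if "\<gamma> \<noteq> 0" for \<gamma>
    unfolding single_valued_def dir_rel_def using that same_direction
    by (auto simp: mult_cancel_left) (metis mult_cancel_left)
  show "single_valued (rel \<beta> c)" using *[OF assms] .
  show "single_valued ((rel \<beta> c)\<inverse>)"
    using *[of "- \<beta>"] assms by (simp add: dir_rel_converse)
qed

lemma dir_neq_minus: "dir c \<in> (*) \<beta> ` dirs u \<Longrightarrow> - dir c' \<in> (*) \<beta> ` dirs u \<Longrightarrow> u \<in> V \<Longrightarrow> False"
proof -
  assume "dir c \<in> (*) \<beta> ` dirs u" "- dir c' \<in> (*) \<beta> ` dirs u" and u: "u \<in> V"
  then obtain a b where ab: "a \<in> dirs u" "dir c = \<beta> * a" "b \<in> dirs u" "- dir c' = \<beta> * b" by blast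
  then have "dir c ^ 3 = (- dir c') ^ 3" using dirs_cube[OF u ab(1,3)] by (simp add: power_mult_distrib)
  moreover have "(- dir c') ^ 3 = \<i>" using dir_cube[of c'] by simp
  ultimately show False using dir_cube[of c] by (simp add: complex_eq_iff)
qed

lemma in_V: "a \<in> dirs u \<Longrightarrow> u \<in> V"
  using edge by (auto simp: dirs_def neighbours_def)

lemma distinct_dirs: "dir 0 \<noteq> dir 1" "dir 1 \<noteq> dir 2" "dir 0 \<noteq> dir 2"
  unfolding dir_0 dir_1 dir_2 by (auto simp: complex_eq_iff)

lemma dirs_closed:
  assumes "s * dir c \<in> (*) \<beta> ` dirs u" "u \<in> V" "u \<notin> B" "c \<le> 2" "c' \<le> 2"
  shows "s * dir c' \<in> (*) \<beta> ` dirs u"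
proof -
  obtain a where a: "a \<in> dirs u" "s * dir c = \<beta> * a" using assms(1) by blast
  have "dirs u = {a, a * omega3, a * omega3\<^sup>2}" using dirs_interior assms a by blast
  then have 1: "s * dir c \<in> (*) \<beta> ` dirs u" "s * dir c * omega3 \<in> (*) \<beta> ` dirs u"
      "s * dir c * omega3\<^sup>2 \<in> (*) \<beta> ` dirs u"
    unfolding a(2) by (auto simp: image_iff)
  have c: "omega3 * (omega3 * omega3) = 1" using omega3_cube by (simp add: power3_eq_cube mult.assoc)
  have "omega3 * omega3\<^sup>2 = 1" "omega3\<^sup>2 * omega3 = 1" "omega3\<^sup>2 * omega3\<^sup>2 = omega3"
    unfolding power2_eq_square using c by (simp_all add: mult.assoc)
  moreover have "dir 0 = \<i>" "dir 1 = \<i> * omega3\<^sup>2" "dir 2 = \<i> * omega3"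
    using omega3_power4 by (simp_all add: dir_def)
  ultimately have 2: "dir 0 * omega3 = dir 2" "dir 0 * omega3\<^sup>2 = dir 1" "dir 1 * omega3 = dir 0"
      "dir 1 * omega3\<^sup>2 = dir 2" "dir 2 * omega3 = dir 1" "dir 2 * omega3\<^sup>2 = dir 0"
    by (simp_all add: mult.assoc power2_eq_square)
  have "c = 0 \<or> c = 1 \<or> c = 2" "c' = 0 \<or> c' = 1 \<or> c' = 2" using assms by linarith+
  then show ?thesis using 1 2 by (elim disjE) (simp_all add: mult.assoc)
qed

lemma sources_closed:
  assumes "u \<in> Domain (rel \<beta> c)" "u \<notin> B" "c \<le> 2" "c' \<le> 2"
  shows "u \<in> Domain (rel \<beta> c')"
  using dirs_closed[of 1 c \<beta> u c'] assms in_V unfolding Domain_dir_rel by auto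

lemma sinks_closed:
  assumes "u \<in> Range (rel \<beta> c)" "u \<notin> B" "c \<le> 2" "c' \<le> 2"
  shows "u \<in> Range (rel \<beta> c')"
  using dirs_closed[of "-1" c \<beta> u c'] assms in_V unfolding Range_dir_rel by auto

lemma two_sources:
  assumes "u \<in> Domain (rel \<beta> c)" "u \<in> Domain (rel \<beta> c')" "dir c \<noteq> dir c'"
  shows "u \<notin> B"
proof -
  obtain a b where "a \<in> dirs u" "dir c = \<beta> * a" "b \<in> dirs u" "dir c' = \<beta> * b"
    using assms(1,2) unfolding Domain_dir_rel by (elim imageE)
  then show ?thesis using assms(3) two_dirs_interior[of u a b] in_V[of a u] by metis
qed

lemma two_sinks:
  assumes "u \<in> Range (rel \<beta> c)" "u \<in> Range (rel \<beta> c')" "dir c \<noteq> dir c'"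
  shows "u \<notin> B"
proof -
  obtain a b where "a \<in> dirs u" "- dir c = \<beta> * a" "b \<in> dirs u" "- dir c' = \<beta> * b"
    using assms(1,2) unfolding Range_dir_rel by (elim imageE)
  then show ?thesis using assms(3) two_dirs_interior[of u a b] in_V[of a u] by (metis minus_minus)
qed

lemma dir_rel_diff:
  assumes "(u, v) \<in> rel \<beta> c"
  shows "\<beta> * v - \<beta> * u = norm (v - u) *\<^sub>R dir c" and "0 < norm (v - u)"
proof -
  have "v - u = norm (v - u) *\<^sub>R sgn (v - u)" by (cases "v = u") (simp_all add: sgn_div_norm)
  then have "\<beta> * v - \<beta> * u = norm (v - u) *\<^sub>R (\<beta> * sgn (v - u))"
    by (metis mult_scaleR_right right_diff_distrib)
  also have "\<beta> * sgn (v - u) = dir c" using assms by (simp add: dir_rel_def)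
  finally show "\<beta> * v - \<beta> * u = norm (v - u) *\<^sub>R dir c" .
  show "0 < norm (v - u)" using assms edge(3)[of u v] by (auto simp: dir_rel_def)
qed

lemma dir_rel_scale:
  assumes "(u, v) \<in> rel \<beta> c"
  shows "Re (\<beta> * v) = Re (\<beta> * u) + norm (v - u) * Re (dir c)"
    and "Im (\<beta> * v) = Im (\<beta> * u) + norm (v - u) * Im (dir c)"
  using arg_cong[OF dir_rel_diff(1)[OF assms], of Re] arg_cong[OF dir_rel_diff(1)[OF assms], of Im]
  by (simp_all del: times_complex.sel)

lemma Re_dir_rel:
  "(u, v) \<in> rel \<beta> 0 \<Longrightarrow> Re (\<beta> * u) = Re (\<beta> * v)"
  "(u, v) \<in> rel \<beta> 1 \<Longrightarrow> Re (\<beta> * u) < Re (\<beta> * v)"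
  "(u, v) \<in> rel \<beta> 2 \<Longrightarrow> Re (\<beta> * v) < Re (\<beta> * u)"
proof -
  show "Re (\<beta> * u) = Re (\<beta> * v)" if "(u, v) \<in> rel \<beta> 0"
    using dir_rel_scale(1)[OF that] by (simp add: dir_0 del: times_complex.sel)
  show "Re (\<beta> * u) < Re (\<beta> * v)" if "(u, v) \<in> rel \<beta> 1"
  proof -
    have "0 < norm (v - u) * Re (dir 1)"
      using dir_rel_diff(2)[OF that] unfolding dir_1 by (intro mult_pos_pos) simp_all
    then show ?thesis using dir_rel_scale(1)[OF that] by linarith
  qed
  show "Re (\<beta> * v) < Re (\<beta> * u)" if "(u, v) \<in> rel \<beta> 2"
  proof -
    have "0 < norm (v - u) * - Re (dir 2)"
      using dir_rel_diff(2)[OF that] unfolding dir_2 by (intro mult_pos_pos) simp_all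
    then show ?thesis using dir_rel_scale(1)[OF that] by linarith
  qed
qed

lemma Im_dir_rel: "(u, v) \<in> rel \<beta> 0 \<Longrightarrow> Im (\<beta> * u) < Im (\<beta> * v)"
  using dir_rel_scale(2)[of u v \<beta> 0] dir_rel_diff(2)[of u v \<beta> 0] by (simp add: dir_0 del: times_complex.sel)

lemma dir_rel_bipartite: "Domain (rel \<beta> c) \<inter> Range (rel \<beta> c') = {}"
  using dir_neq_minus[of c \<beta> _ c'] dir_rel_subset[of \<beta> c] Domain_dir_rel[of _ \<beta> c] Range_dir_rel[of _ \<beta> c']
  by blast

text \<open>Edges in \<open>E1\<close> and reversed edges in \<open>E2\<close> run from left to
  right, and no vertex has two of them on the same side. So \<open>arcs_rank\<close> applies to them
  with concatenation as \<open>J\<close>, and ranks pass from edges to their ends.\<close>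

lemma ex_rank:
  fixes \<beta> :: complex
  assumes \<beta>: "norm \<beta> = 1"
  defines "E0 \<equiv> rel \<beta> 0" and "E1 \<equiv> rel \<beta> 1" and "E2 \<equiv> rel \<beta> 2"
  shows "\<exists>h :: complex \<Rightarrow> real. (\<forall>(u, v)\<in>E1 \<union> E2. h u = h v) \<and>
    (\<forall>(u, v)\<in>E0. u \<in> Domain E1 \<longrightarrow> v \<in> Range E1 \<longrightarrow> h u < h v)"
proof -
  define A where "A = E1 \<union> E2\<inverse>"
  define x where "x v = Re (\<beta> * v)" for v
  define pt where "pt = dart_point \<beta>"
  define f where "f e t = Im (\<beta> * pt e t)" for e t
  define J where "J e e' \<longleftrightarrow> snd e = fst e'" for e e' :: "complex \<times> complex"
  have \<beta>0: "\<beta> \<noteq> 0" using \<beta> by auto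
  have sv: "single_valued E1" "single_valued E2" "single_valued (E1\<inverse>)" "single_valued (E2\<inverse>)"
    unfolding E1_def E2_def using single_valued_dir_rel[OF \<beta>0] by blast+
  have bip12: "Domain E1 \<inter> Range E2 = {}" "Domain E2 \<inter> Range E1 = {}"
    unfolding E1_def E2_def using dir_rel_bipartite by blast+
  have rgt: "v = v'" if "(u, v) \<in> A" "(u, v') \<in> A" for u v v'
    using that sv bip12 unfolding A_def single_valued_def by blast
  have lft: "u = u'" if "(u, v) \<in> A" "(u', v) \<in> A" for u u' v
    using that sv bip12 unfolding A_def single_valued_def by blast
  have xA: "x u < x v" if "(u, v) \<in> A" for u v using that Re_dir_rel(2,3) by (auto simp: A_def E1_def E2_def x_def simp del: times_complex.sel)
  have EA: "{u, v} \<in> E" if "(u, v) \<in> A" for u v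
    using that by (auto simp: A_def E1_def E2_def dir_rel_def insert_commute[of v u])
  have ptx: "Re (\<beta> * pt e t) = t" if "e \<in> A" for e t
    using Re_dart_point[of \<beta> e t] xA[of "fst e" "snd e"] that by (simp add: x_def pt_def del: times_complex.sel)
  have ptin: "pt e t \<in> convex hull {fst e, snd e}" if "e \<in> A" "t \<in> {x (fst e)..x (snd e)}" for e t
    using dart_point_in[of \<beta> e t] xA[of "fst e" "snd e"] that by (simp add: x_def pt_def del: times_complex.sel)
  have ends: "pt e (x (fst e)) = fst e" "pt e (x (snd e)) = snd e" if "e \<in> A" for e
    using dart_point_ends[of \<beta> e] xA[of "fst e" "snd e"] that by (simp_all add: x_def pt_def del: times_complex.sel)
  have hull_V: "z = fst e \<or> z = snd e" if "e \<in> A" "z \<in> convex hull {fst e, snd e}" "z \<in> V" for e z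
    using no_vertex[OF EA[of "fst e" "snd e"]] that
    by (auto simp: segment_convex_hull[symmetric] open_segment_def)
  \<comment> \<open>Equal heights over \<open>t\<close> mean a common point. It is a vertex because
    distinct edges meet only in vertices, and it is an end of both arcs. Two left ends or two right
    ends never coincide, so one arc continues the other.\<close>
  have touch: "t = x (snd e) \<and> J e e' \<or> t = x (snd e') \<and> J e' e"
    if e: "e \<in> A" "e' \<in> A" "e \<noteq> e'" and t: "t \<in> {x (fst e)..x (snd e)}" "t \<in> {x (fst e')..x (snd e')}"
      and eq: "f e t = f e' t" for e e' t
  proof -
    define z where "z = pt e t"
    have "\<beta> * z = \<beta> * pt e' t" using ptx[OF e(1)] ptx[OF e(2)] eq
      by (intro complex_eqI) (simp_all add: f_def z_def del: times_complex.sel)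
    then have z': "z = pt e' t" using \<beta>0 by simp
    have "{fst e, snd e} \<noteq> {fst e', snd e'}"
      using e xA[of "fst e" "snd e"] xA[of "fst e'" "snd e'"]
      by (metis doubleton_eq_iff less_asym prod.collapse)
    moreover have "{fst e, snd e} \<in> E" "{fst e', snd e'} \<in> E" using EA e by simp_all
    ultimately have "convex hull {fst e, snd e} \<inter> convex hull {fst e', snd e'} \<subseteq> V"
      using edges_meet by simp
    then have zV: "z \<in> V" using ptin[OF e(1) t(1)] ptin[OF e(2) t(2)] z' by (auto simp: z_def)
    have xz: "x z = t" using ptx[OF e(1)] by (simp add: x_def z_def)
    have "z = fst e \<or> z = snd e" "z = fst e' \<or> z = snd e'"
      using hull_V[OF e(1) _ zV] hull_V[OF e(2) _ zV] ptin[OF e(1) t(1)] ptin[OF e(2) t(2)] z'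
      by (simp_all add: z_def)
    moreover have "fst e \<noteq> fst e'" using rgt[of "fst e" "snd e" "snd e'"] e by (metis prod.collapse)
    moreover have "snd e \<noteq> snd e'" using lft[of "fst e" "snd e" "fst e'"] e by (metis prod.collapse)
    ultimately show ?thesis using xz by (auto simp: J_def)
  qed
  have "\<exists>k :: complex \<times> complex \<Rightarrow> real. (\<forall>e\<in>A. \<forall>e'\<in>A. J e e' \<longrightarrow> k e = k e') \<and>
    (\<forall>e\<in>A. \<forall>e'\<in>A. \<forall>t\<in>{x (fst e)..x (snd e)} \<inter> {x (fst e')..x (snd e')}. f e t < f e' t \<longrightarrow> k e < k e')"
  proof (rule arcs_rank)
    show "finite A" using finite_dir_rel by (simp add: A_def E1_def E2_def)
    show "x (fst e) < x (snd e)" if "e \<in> A" for e using xA[of "fst e" "snd e"] that by simp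
    show "continuous_on {x (fst e)..x (snd e)} (f e)" for e
      unfolding f_def pt_def dart_point_def divide_inverse by (intro continuous_intros)
    show "x (snd e) = x (fst e') \<and> f e (x (snd e)) = f e' (x (snd e))" if "e \<in> A" "e' \<in> A" "J e e'" for e e'
      using ends(2)[OF that(1)] ends(1)[OF that(2)] that(3) by (simp add: J_def f_def)
    show "e' = e''" if "e \<in> A" "e' \<in> A" "e'' \<in> A" "J e e'" "J e e''" for e e' e''
      using rgt[of "fst e'" "snd e'" "snd e''"] that by (auto simp: J_def prod_eq_iff)
  qed (use touch in blast)
  then obtain k where kJ: "\<And>e e'. e \<in> A \<Longrightarrow> e' \<in> A \<Longrightarrow> J e e' \<Longrightarrow> k e = k e'" and
    kl: "\<And>e e' t. e \<in> A \<Longrightarrow> e' \<in> A \<Longrightarrow> t \<in> {x (fst e)..x (snd e)} \<Longrightarrow> t \<in> {x (fst e')..x (snd e')} \<Longrightarrow>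
      f e t < f e' t \<Longrightarrow> (k e :: real) < k e'"
    by (metis (no_types, lifting) IntI)
  define inc where "inc v e \<longleftrightarrow> e \<in> A \<and> (fst e = v \<or> snd e = v)" for v e
  have kinc: "k e = k e'" if "inc v e" "inc v e'" for v e e'
    using that kJ[of e e'] kJ[of e' e] rgt[of v "snd e" "snd e'"] lft[of "fst e" v "fst e'"]
    unfolding inc_def J_def by (metis prod.collapse)
  \<comment> \<open>All arcs at a vertex have the same rank, so the choice is immaterial. A vertex
    on no arc gets an arbitrary value, and the inequality to be shown never compares such
    vertices.\<close>
  define h where "h v = k (SOME e. inc v e)" for v
  have h: "h v = k e" if "inc v e" for v e
    unfolding h_def using kinc someI[of "inc v", OF that] that by blast
  have hA: "h u = h v" if "(u, v) \<in> A" for u v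
    using h[of u "(u, v)"] h[of v "(u, v)"] that by (simp add: inc_def)
  have "h u < h v" if uv: "(u, v) \<in> E0" "u \<in> Domain E1" "v \<in> Range E1" for u v
  proof -
    \<comment> \<open>The arc leaving \<open>u\<close> to the right and the arc reaching
      \<open>v\<close> from the left both cover the abscissa common to \<open>u\<close> and
      \<open>v\<close>, and are compared there.\<close>
    obtain w z where w: "(u, w) \<in> E1" "(z, v) \<in> E1" using uv by blast
    then have A: "(u, w) \<in> A" "(z, v) \<in> A" by (auto simp: A_def)
    have xuv: "x u = x v" using Re_dir_rel(1) uv(1) unfolding E0_def x_def by blast
    have "Im (\<beta> * u) < Im (\<beta> * v)" using Im_dir_rel uv(1) unfolding E0_def by blast
    then have "f (u, w) (x u) < f (z, v) (x u)"
      using ends(1)[OF A(1)] ends(2)[OF A(2)] xuv by (simp add: f_def)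
    then have "k (u, w) < k (z, v)"
      using kl[OF A, of "x u"] xA[OF A(1)] xA[OF A(2)] xuv by simp
    then show ?thesis using h[of u "(u, w)"] h[of v "(z, v)"] A by (simp add: inc_def)
  qed
  moreover have "h u = h v" if "(u, v) \<in> E1 \<union> E2" for u v
    using hA[of u v] hA[of v u] that by (auto simp: A_def)
  ultimately show ?thesis by (intro exI[of _ h]) blast
qed

lemma hexnet_dir_rel:
  assumes \<beta>: "norm \<beta> = 1"
  obtains h where "hexnet (rel \<beta> 0) (rel \<beta> 1) (rel \<beta> 2) (\<lambda>v. Re (\<beta> * v)) h"
proof -
  let ?E = "rel \<beta>"
  obtain h :: "complex \<Rightarrow> real" where h: "\<forall>(u, v)\<in>?E 1 \<union> ?E 2. h u = h v"
    "\<forall>(u, v)\<in>?E 0. u \<in> Domain (?E 1) \<longrightarrow> v \<in> Range (?E 1) \<longrightarrow> h u < h v"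
    using ex_rank[OF \<beta>] by blast
  have \<beta>0: "\<beta> \<noteq> 0" using \<beta> by auto
  have D: "Domain (?E c) \<inter> Domain (?E c') \<subseteq> Domain (?E d)"
    if "dir c \<noteq> dir c'" "c \<le> 2" "d \<le> 2" for c c' d
    using two_sources[OF _ _ that(1)] sources_closed[OF _ _ that(2,3)] by blast
  have R: "Range (?E c) \<inter> Range (?E c') \<subseteq> Range (?E d)"
    if "dir c \<noteq> dir c'" "c \<le> 2" "d \<le> 2" for c c' d
    using two_sinks[OF _ _ that(1)] sinks_closed[OF _ _ that(2,3)] by blast
  have "hexnet (?E 0) (?E 1) (?E 2) (\<lambda>v. Re (\<beta> * v)) h"
  proof
    show "(Domain (?E 0) \<union> Domain (?E 1) \<union> Domain (?E 2)) \<inter> (Range (?E 0) \<union> Range (?E 1) \<union> Range (?E 2)) = {}"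
      using dir_rel_bipartite by blast
    show "Domain (?E 0) \<inter> Domain (?E 1) = Domain (?E 1) \<inter> Domain (?E 2)"
      using D[of 0 1 2] D[of 1 2 0] distinct_dirs by auto
    show "Domain (?E 0) \<inter> Domain (?E 2) = Domain (?E 1) \<inter> Domain (?E 2)"
      using D[of 0 2 1] D[of 1 2 0] distinct_dirs by auto
    show "Range (?E 0) \<inter> Range (?E 1) = Range (?E 1) \<inter> Range (?E 2)"
      using R[of 0 1 2] R[of 1 2 0] distinct_dirs by auto
    show "Range (?E 0) \<inter> Range (?E 2) = Range (?E 1) \<inter> Range (?E 2)"
      using R[of 0 2 1] R[of 1 2 0] distinct_dirs by auto
  qed (use h Re_dir_rel single_valued_dir_rel[OF \<beta>0] finite_dir_rel in \<open>blast+\<close>)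
  then show ?thesis using that by blast
qed

end

section \<open>Splitting a graph by the orientation of its edges\<close>

lemma sum_squares_le: "finite X \<Longrightarrow> (\<Sum>i\<in>X. (f i :: nat)\<^sup>2) \<le> (\<Sum>i\<in>X. f i)\<^sup>2"
proof (induction X rule: finite_induct)
  case (insert a X)
  then show ?case by (simp add: power2_sum)
qed simp

text \<open>The six directions of a net, namely the cube roots of \<open>- \<i>\<close> and their
  opposites, are the sixth roots of -1; this describes a frame by a single equation.\<close>

lemma sixth_power: "a ^ 6 = - 1 \<longleftrightarrow> a ^ 3 = - \<i> \<or> (- a) ^ 3 = - \<i>" for a :: complex
proof -
  have "a ^ 6 = (a ^ 3)\<^sup>2" by (simp add: power_mult[symmetric])
  moreover have "(- 1 :: complex) = (- \<i>)\<^sup>2" by simp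
  ultimately have "a ^ 6 = - 1 \<longleftrightarrow> (a ^ 3)\<^sup>2 = (- \<i>)\<^sup>2" by simp
  also have "\<dots> \<longleftrightarrow> a ^ 3 = - \<i> \<or> (- a) ^ 3 = - \<i>" unfolding power2_eq_iff by auto
  finally show ?thesis .
qed

context critical_cubic
begin

text \<open>The vertices whose edges point in the six directions \<open>\<plusminus> dir c\<close> after rotation by \<open>\<beta>\<close>.
  Different components may need different rotations.\<close>

definition frame :: "complex \<Rightarrow> complex set" where
  "frame \<beta> = {u. \<exists>a\<in>dirs u. (\<beta> * a) ^ 6 = - 1}"

lemma frame_iff: "a \<in> dirs u \<Longrightarrow> u \<in> frame \<beta> \<longleftrightarrow> (\<beta> * a) ^ 6 = - 1"
proof -
  have eq: "(\<beta> * b) ^ 6 = \<beta> ^ 6 * (b ^ 3)\<^sup>2" for b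
    by (simp add: power_mult_distrib power_mult[symmetric])
  assume a: "a \<in> dirs u"
  have "(\<beta> * b) ^ 6 = (\<beta> * a) ^ 6" if "b \<in> dirs u" for b
    using dirs_cube[OF in_V[OF a] that a] by (simp only: eq)
  then have "(\<exists>b\<in>dirs u. (\<beta> * b) ^ 6 = - 1) \<longleftrightarrow> (\<beta> * a) ^ 6 = - 1"
    using a by metis
  then show "u \<in> frame \<beta> \<longleftrightarrow> (\<beta> * a) ^ 6 = - 1" by (simp only: frame_def mem_Collect_eq)
qed

lemma frame_subset: "frame \<beta> \<subseteq> V"
  using in_V by (auto simp: frame_def)

lemma frame_vertices: "net_vertices (rel \<beta> 0) (rel \<beta> 1) (rel \<beta> 2) = frame \<beta>"
proof (intro equalityI subsetI)
  fix u assume "u \<in> net_vertices (rel \<beta> 0) (rel \<beta> 1) (rel \<beta> 2)"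
  then obtain c where "u \<in> Domain (rel \<beta> c) \<or> u \<in> Range (rel \<beta> c)"
    unfolding net_vertices_def Field_def by blast
  then obtain a where "a \<in> dirs u" "dir c = \<beta> * a \<or> - dir c = \<beta> * a"
    unfolding Domain_dir_rel Range_dir_rel by blast
  moreover from this have "(\<beta> * a) ^ 3 = - \<i> \<or> (- (\<beta> * a)) ^ 3 = - \<i>"
    using dir_cube[of c] by (metis minus_minus)
  ultimately show "u \<in> frame \<beta>" using sixth_power unfolding frame_def by blast
next
  fix u assume "u \<in> frame \<beta>"
  then obtain a where a: "a \<in> dirs u" "(\<beta> * a) ^ 6 = - 1" by (auto simp: frame_def)
  then have "(\<beta> * a) ^ 3 = - \<i> \<or> (- (\<beta> * a)) ^ 3 = - \<i>" by (simp only: sixth_power)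
  then obtain c where c: "c \<in> {0, 1, 2}" "dir c = \<beta> * a \<or> - dir c = \<beta> * a"
    using dirI[of "\<beta> * a"] dirI[of "- (\<beta> * a)"] by (metis insertI1 insertI2 minus_minus)
  then have "u \<in> Domain (rel \<beta> c) \<or> u \<in> Range (rel \<beta> c)"
    unfolding Domain_dir_rel Range_dir_rel using a(1) by blast
  then show "u \<in> net_vertices (rel \<beta> 0) (rel \<beta> 1) (rel \<beta> 2)"
    unfolding net_vertices_def Field_def using c(1) by blast
qed

definition "frame_interior \<beta> = inner_count (rel \<beta> 0) (rel \<beta> 1)"
definition "frame_leaves \<beta> = leaf_count (rel \<beta> 0) (rel \<beta> 1) (rel \<beta> 2)"

lemma frame_inner:
  "(Domain (rel \<beta> 0) \<inter> Domain (rel \<beta> 1)) \<union> (Range (rel \<beta> 0) \<inter> Range (rel \<beta> 1))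
    = frame \<beta> - B"
proof (intro equalityI subsetI)
  fix u assume u: "u \<in> (Domain (rel \<beta> 0) \<inter> Domain (rel \<beta> 1)) \<union>
    (Range (rel \<beta> 0) \<inter> Range (rel \<beta> 1))"
  then have "u \<in> frame \<beta>"
    unfolding frame_vertices[symmetric] net_vertices_def Field_def by blast
  moreover have "u \<notin> B"
    using u two_sources[of u \<beta> 0 1] two_sinks[of u \<beta> 0 1] distinct_dirs(1) by blast
  ultimately show "u \<in> frame \<beta> - B" by blast
next
  fix u assume u: "u \<in> frame \<beta> - B"
  then have "u \<in> net_vertices (rel \<beta> 0) (rel \<beta> 1) (rel \<beta> 2)"
    unfolding frame_vertices by blast
  then obtain c where "c \<in> {0, 1, 2}" "u \<in> Domain (rel \<beta> c) \<or> u \<in> Range (rel \<beta> c)"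
    unfolding net_vertices_def Field_def by blast
  moreover from this have "c \<le> 2" by auto
  ultimately show "u \<in> (Domain (rel \<beta> 0) \<inter> Domain (rel \<beta> 1)) \<union>
    (Range (rel \<beta> 0) \<inter> Range (rel \<beta> 1))"
    using sources_closed[of u \<beta> c 0] sources_closed[of u \<beta> c 1]
      sinks_closed[of u \<beta> c 0] sinks_closed[of u \<beta> c 1] u by auto
qed

lemma frame_counts:
  assumes "norm \<beta> = 1"
  shows "frame_interior \<beta> = card (frame \<beta> - B)" and "frame_leaves \<beta> = card (frame \<beta> \<inter> B)"
    and "6 * frame_interior \<beta> \<le> (frame_leaves \<beta>)\<^sup>2" and "even (frame_interior \<beta> + frame_leaves \<beta>)"
proof -
  obtain h where "hexnet (rel \<beta> 0) (rel \<beta> 1) (rel \<beta> 2) (\<lambda>v. Re (\<beta> * v)) h"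
    using hexnet_dir_rel[OF assms] by blast
  then interpret hexnet "rel \<beta> 0" "rel \<beta> 1" "rel \<beta> 2" "\<lambda>v. Re (\<beta> * v)" h .
  show "frame_interior \<beta> = card (frame \<beta> - B)"
    unfolding frame_interior_def card_interior[symmetric] frame_inner ..
  have "frame \<beta> - X - Y = frame \<beta> \<inter> B" if "X \<union> Y = frame \<beta> - B" for X Y
    using that by blast
  from this[OF frame_inner] show "frame_leaves \<beta> = card (frame \<beta> \<inter> B)"
    unfolding frame_leaves_def card_leaves[symmetric] frame_vertices by (rule arg_cong)
  show "6 * frame_interior \<beta> \<le> (frame_leaves \<beta>)\<^sup>2" "even (frame_interior \<beta> + frame_leaves \<beta>)"
    using isoperimetric parity by (simp_all add: frame_interior_def frame_leaves_def)
qed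

text \<open>With at most one leaf the isoperimetric inequality allows no interior vertex, parity
  then excludes the single leaf, and nothing remains.\<close>

lemma frame_leaves_ge_2:
  assumes "norm \<beta> = 1" "frame \<beta> \<noteq> {}"
  shows "2 \<le> frame_leaves \<beta>"
proof (rule ccontr)
  assume "\<not> 2 \<le> frame_leaves \<beta>"
  then have l: "frame_leaves \<beta> = 0 \<or> frame_leaves \<beta> = 1" by linarith
  then have "(frame_leaves \<beta>)\<^sup>2 \<le> 1" by auto
  then have "frame_interior \<beta> = 0" using frame_counts(3)[OF assms(1)] by linarith
  then have "frame_leaves \<beta> = 0" using l frame_counts(4)[OF assms(1)] by auto
  have "finite (frame \<beta>)" using finite_subset[OF frame_subset finite_V] .
  then have "frame \<beta> - B = {}" "frame \<beta> \<inter> B = {}"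
    using frame_counts(1,2)[OF assms(1)] \<open>frame_interior \<beta> = 0\<close> \<open>frame_leaves \<beta> = 0\<close> by auto
  then show False using assms(2) by blast
qed

lemma dirs_nonempty: "u \<in> V \<Longrightarrow> dirs u \<noteq> {}"
proof -
  assume u: "u \<in> V"
  have "vertex_degree E u = 1 \<or> vertex_degree E u = 3"
  proof (cases "u \<in> B")
    case True
    then show ?thesis by (simp add: boundary_points_def)
  next
    case False
    then show ?thesis using u cubic by (simp add: three_boundary_regular_def)
  qed
  then have "card (neighbours E u) \<noteq> 0" using card_neighbours[OF u] by auto
  then show ?thesis unfolding dirs_def by (metis card.empty image_is_empty)
qed

text \<open>The rotation that turns some edge at \<open>u\<close> into the direction
  \<open>dir 0\<close>.\<close>

definition "vframe u = (\<i> / (SOME a. a \<in> dirs u))"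

lemma frames_partition:
  assumes "u \<in> V"
  shows "norm (vframe u) = 1" "u \<in> frame (vframe u)"
    and "v \<in> frame (vframe u) \<Longrightarrow> frame (vframe v) = frame (vframe u)"
proof -
  have some: "(SOME a. a \<in> dirs v) \<in> dirs v" if "v \<in> V" for v
    using dirs_nonempty[OF that] some_in_eq by blast
  have i6: "\<i> ^ 6 = - 1" by (simp add: eval_nat_numeral)
  show "norm (vframe u) = 1" using dirs_unit[OF some[OF assms]] by (simp add: vframe_def norm_divide)
  have ne: "(SOME a. a \<in> dirs v) \<noteq> 0" if "v \<in> V" for v
    using dirs_unit[OF some[OF that]] by auto
  show uf: "u \<in> frame (vframe u)"
    using frame_iff[OF some[OF assms]] ne[OF assms] i6 by (simp add: vframe_def)
  assume v: "v \<in> frame (vframe u)"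
  then have vV: "v \<in> V" using frame_subset by blast
  have eq: "(\<beta> * a) ^ 6 = \<beta> ^ 6 * a ^ 6" for \<beta> a :: complex by (simp add: power_mult_distrib)
  have "(vframe u) ^ 6 * (SOME a. a \<in> dirs v) ^ 6 = - 1"
    using v frame_iff[OF some[OF vV]] eq by metis
  moreover have "(vframe v) ^ 6 * (SOME a. a \<in> dirs v) ^ 6 = - 1"
    using ne[OF vV] i6 by (simp add: vframe_def power_divide)
  ultimately have "(vframe u) ^ 6 = (vframe v) ^ 6"
    using ne[OF vV] by (metis mult_right_cancel power_not_zero)
  then show "frame (vframe v) = frame (vframe u)" unfolding frame_def eq by simp
qed

text \<open>Frames of vertices are equal or disjoint. One frame may contain several components of
  the same orientation, which is harmless because nets need not be connected.\<close>

lemma frame_sums: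
  obtains \<Phi> b where "finite \<Phi>" "\<And>F. F \<in> \<Phi> \<Longrightarrow> norm (b F) = 1 \<and> frame (b F) = F \<and> F \<noteq> {}"
    "card (V - B) = (\<Sum>F\<in>\<Phi>. frame_interior (b F))" "card B = (\<Sum>F\<in>\<Phi>. frame_leaves (b F))"
    "\<Phi> = (\<lambda>u. frame (vframe u)) ` V"
proof -
  define \<Phi> where "\<Phi> = (\<lambda>u. frame (vframe u)) ` V"
  define b where "b F = vframe (SOME u. u \<in> V \<and> frame (vframe u) = F)" for F
  have fin: "finite \<Phi>" using finite_V by (simp add: \<Phi>_def)
  have b: "norm (b F) = 1 \<and> frame (b F) = F \<and> F \<noteq> {}" if "F \<in> \<Phi>" for F
  proof -
    have "\<exists>u. u \<in> V \<and> frame (vframe u) = F" using that by (auto simp: \<Phi>_def)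
    then have u: "(SOME u. u \<in> V \<and> frame (vframe u) = F) \<in> V \<and> frame (b F) = F"
      unfolding b_def by (rule someI_ex)
    then show ?thesis using frames_partition(1,2) unfolding b_def by blast
  qed
  have mem: "{u \<in> S. frame (vframe u) = F} = F \<inter> S" if "F \<in> \<Phi>" "S \<subseteq> V" for S F
    using that frames_partition unfolding \<Phi>_def by blast
  have sum: "card S = (\<Sum>F\<in>\<Phi>. card (F \<inter> S))" if "S \<subseteq> V" for S
  proof -
    have "finite S" using that finite_V finite_subset by blast
    then have "card S = (\<Sum>F\<in>\<Phi>. \<Sum>u\<in>{u \<in> S. frame (vframe u) = F}. 1)"
      using fin that by (subst sum.group) (auto simp: \<Phi>_def)
    also have "\<dots> = (\<Sum>F\<in>\<Phi>. card (F \<inter> S))"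
      by (intro sum.cong refl) (simp add: mem[OF _ that])
    finally show ?thesis .
  qed
  have "card (V - B) = (\<Sum>F\<in>\<Phi>. card (F \<inter> (V - B)))" by (rule sum) blast
  also have "\<dots> = (\<Sum>F\<in>\<Phi>. frame_interior (b F))"
  proof (intro sum.cong refl)
    fix F assume F: "F \<in> \<Phi>"
    then have "F \<subseteq> V" using b frame_subset by metis
    then have "F \<inter> (V - B) = frame (b F) - B" using b[OF F] by blast
    then show "card (F \<inter> (V - B)) = frame_interior (b F)" using frame_counts(1) b[OF F] by metis
  qed
  finally have inner: "card (V - B) = (\<Sum>F\<in>\<Phi>. frame_interior (b F))" .
  have "card B = (\<Sum>F\<in>\<Phi>. card (F \<inter> B))" by (rule sum) (auto simp: boundary_points_def)
  also have "\<dots> = (\<Sum>F\<in>\<Phi>. frame_leaves (b F))"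
    using frame_counts(2) b by (intro sum.cong refl) metis
  finally have "card B = (\<Sum>F\<in>\<Phi>. frame_leaves (b F))" .
  then show ?thesis using that fin b inner \<Phi>_def by blast
qed

theorem vertices_bound: "6 * card (V - B) \<le> (card B)\<^sup>2" and vertices_parity: "even (card (V - B) + card B)"
proof -
  obtain \<Phi> b where *: "finite \<Phi>" "\<And>F. F \<in> \<Phi> \<Longrightarrow> norm (b F) = 1 \<and> frame (b F) = F \<and> F \<noteq> {}"
    "card (V - B) = (\<Sum>F\<in>\<Phi>. frame_interior (b F))" "card B = (\<Sum>F\<in>\<Phi>. frame_leaves (b F))"
    "\<Phi> = (\<lambda>u. frame (vframe u)) ` V"
    using frame_sums by blast
  have "6 * card (V - B) = (\<Sum>F\<in>\<Phi>. 6 * frame_interior (b F))" by (simp add: *(3) sum_distrib_left)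
  also have "\<dots> \<le> (\<Sum>F\<in>\<Phi>. (frame_leaves (b F))\<^sup>2)" using *(2) frame_counts(3) by (intro sum_mono) blast
  also have "\<dots> \<le> (card B)\<^sup>2" unfolding *(4) using *(1) by (rule sum_squares_le)
  finally show "6 * card (V - B) \<le> (card B)\<^sup>2" .
  have "card (V - B) + card B = (\<Sum>F\<in>\<Phi>. frame_interior (b F) + frame_leaves (b F))"
    by (simp add: *(3,4) sum.distrib)
  moreover have "even \<dots>" using *(2) frame_counts(4) by (intro dvd_sum) blast
  ultimately show "even (card (V - B) + card B)" by simp
qed

text \<open>Dividing the leaves into \<open>a\<close> and \<open>r\<close> loses the mixed term
  \<open>2 * a * r\<close> of the square. Every frame has at least two leaves, so the loss is at
  least 8, and only 7 is available.\<close>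

lemma single_frame:
  assumes "(card B)\<^sup>2 \<le> 6 * card (V - B) + 7" "V \<noteq> {}"
  obtains \<beta> where "norm \<beta> = 1" "frame \<beta> = V"
proof -
  obtain \<Phi> b where *: "finite \<Phi>" "\<And>F. F \<in> \<Phi> \<Longrightarrow> norm (b F) = 1 \<and> frame (b F) = F \<and> F \<noteq> {}"
    "card (V - B) = (\<Sum>F\<in>\<Phi>. frame_interior (b F))" "card B = (\<Sum>F\<in>\<Phi>. frame_leaves (b F))"
    "\<Phi> = (\<lambda>u. frame (vframe u)) ` V"
    using frame_sums by blast
  obtain u where u: "u \<in> V" using assms(2) by blast
  define F where "F = frame (vframe u)"
  have F: "F \<in> \<Phi>" using u unfolding *(5) F_def by blast
  have "\<Phi> = {F}"
  proof (rule ccontr)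
    assume "\<Phi> \<noteq> {F}"
    then obtain G where G: "G \<in> \<Phi> - {F}" using F by blast
    let ?r = "\<Sum>F\<in>\<Phi> - {F}. frame_leaves (b F)"
    let ?a = "frame_leaves (b F)"
    have B: "card B = ?a + ?r" unfolding *(4) using *(1) F by (rule sum.remove)
    have "2 \<le> frame_leaves (b G)" using frame_leaves_ge_2[of "b G"] *(2)[of G] G by auto
    also have "\<dots> \<le> ?r" using *(1) G by (intro member_le_sum) auto
    finally have r: "2 \<le> ?r" .
    have a: "2 \<le> ?a" using frame_leaves_ge_2[of "b F"] *(2)[OF F] by auto
    have "6 * card (V - B) = (\<Sum>F\<in>\<Phi>. 6 * frame_interior (b F))" by (simp add: *(3) sum_distrib_left)
    also have "\<dots> \<le> (\<Sum>F\<in>\<Phi>. (frame_leaves (b F))\<^sup>2)" using *(2) frame_counts(3) by (intro sum_mono) blast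
    also have "\<dots> = ?a\<^sup>2 + (\<Sum>F\<in>\<Phi> - {F}. (frame_leaves (b F))\<^sup>2)" using *(1) F by (rule sum.remove)
    also have "\<dots> \<le> ?a\<^sup>2 + ?r\<^sup>2" using *(1) by (intro add_left_mono sum_squares_le) simp
    finally have "6 * card (V - B) \<le> ?a\<^sup>2 + ?r\<^sup>2" .
    moreover have "(card B)\<^sup>2 = ?a\<^sup>2 + ?r\<^sup>2 + 2 * ?a * ?r" unfolding B by (simp add: power2_sum)
    moreover have "2 * 2 \<le> ?a * ?r" using a r by (rule mult_le_mono)
    ultimately show False using assms(1) by linarith
  qed
  then have "v \<in> F" if "v \<in> V" for v
    using frames_partition(2)[OF that] that unfolding *(5) by blast
  then have "frame (vframe u) = V" using frame_subset unfolding F_def by blast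
  then show ?thesis using that frames_partition(1)[OF u] by blast
qed

lemma frame_rotate: "frame (\<beta> * omega3) = frame \<beta>" "frame (- \<beta>) = frame \<beta>"
proof -
  have "omega3 ^ 6 = (omega3 ^ 3)\<^sup>2" by (simp add: power_mult[symmetric])
  then show "frame (\<beta> * omega3) = frame \<beta>" "frame (- \<beta>) = frame \<beta>"
    by (simp_all add: frame_def power_mult_distrib omega3_cube)
qed

lemma normal_frame:
  assumes "(card B)\<^sup>2 \<le> 6 * card (V - B) + 7" "V \<noteq> {}"
  obtains \<beta> where "norm \<beta> = 1" "frame \<beta> = V"
    "normal_profile (rel \<beta> 0) (rel \<beta> 1) (rel \<beta> 2)"
proof -
  obtain \<beta> where \<beta>: "norm \<beta> = 1" "frame \<beta> = V" using single_frame[OF assms] by blast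
  obtain h where "hexnet (rel \<beta> 0) (rel \<beta> 1) (rel \<beta> 2) (\<lambda>v. Re (\<beta> * v)) h"
    using hexnet_dir_rel[OF \<beta>(1)] by blast
  then interpret hexnet "rel \<beta> 0" "rel \<beta> 1" "rel \<beta> 2" "\<lambda>v. Re (\<beta> * v)" h .
  have BV: "B \<subseteq> V" by (auto simp: boundary_points_def)
  have "frame_interior \<beta> = card (V - B)" "frame_leaves \<beta> = card B"
    using frame_counts(1,2)[OF \<beta>(1)] \<beta>(2) BV by (simp_all add: Int_absorb1)
  then have le: "(frame_leaves \<beta>)\<^sup>2 \<le> 6 * frame_interior \<beta> + 7" using assms(1) by simp
  let ?N = "\<lambda>\<beta>. normal_profile (rel \<beta> 0) (rel \<beta> 1) (rel \<beta> 2)"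
  have rot: "rel (\<gamma> * omega3) 0 = rel \<gamma> 1" "rel (\<gamma> * omega3) 1 = rel \<gamma> 2"
    "rel (\<gamma> * omega3) 2 = rel \<gamma> 0" for \<gamma>
    using dir_rel_3 by (simp_all add: dir_rel_rotate numeral_2_eq_2 numeral_3_eq_3)
  \<comment> \<open>The six alternatives of \<open>near_extremal\<close> are the six rotations by
    multiples of 60 degrees, realised by factors \<open>omega3\<close> and a sign.\<close>
  have "?N \<beta> \<or> ?N (\<beta> * omega3) \<or> ?N (\<beta> * omega3 * omega3) \<or>
      ?N (- \<beta>) \<or> ?N ((- \<beta>) * omega3) \<or> ?N ((- \<beta>) * omega3 * omega3)"
    using near_extremal[OF le[unfolded frame_leaves_def frame_interior_def]]
    unfolding rot dir_rel_converse .
  moreover have ok: "norm (\<gamma> * omega3) = 1" "frame (\<gamma> * omega3) = V" if "norm \<gamma> = 1" "frame \<gamma> = V" for \<gamma>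
    using that by (simp_all add: norm_mult norm_omega3 frame_rotate)
  moreover have neg: "norm (- \<beta>) = 1" "frame (- \<beta>) = V" using \<beta> by (simp_all add: frame_rotate)
  ultimately show ?thesis
    using that[OF \<beta>] that[OF ok[OF \<beta>]] that[OF ok[OF ok[OF \<beta>]]]
      that[OF neg] that[OF ok[OF neg]] that[OF ok[OF ok[OF neg]]]
    by (elim disjE)
qed

end

lemma (in critical_cubic) frame_edges:
  assumes "frame \<beta> = V"
  shows "{u, v} \<in> E \<longleftrightarrow> (\<exists>c\<in>{0, 1, 2}. (u, v) \<in> rel \<beta> c \<or> (v, u) \<in> rel \<beta> c)"
proof
  assume uv: "{u, v} \<in> E"
  have a: "sgn (v - u) \<in> dirs u" using edge_dir[OF uv] .
  have "u \<in> frame \<beta>" using edge(1)[OF uv] assms by blast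
  then have "(\<beta> * sgn (v - u)) ^ 6 = - 1" using frame_iff[OF a] by blast
  then have "(\<beta> * sgn (v - u)) ^ 3 = - \<i> \<or> (- (\<beta> * sgn (v - u))) ^ 3 = - \<i>"
    by (simp only: sixth_power)
  moreover have "- (\<beta> * sgn (v - u)) = \<beta> * sgn (u - v)"
    by (simp add: sgn_minus_commute[of u v])
  ultimately obtain c where "c \<in> {0, 1, 2}" "\<beta> * sgn (v - u) = dir c \<or> \<beta> * sgn (u - v) = dir c"
    using dirI by (metis insertI1 insertI2)
  then show "\<exists>c\<in>{0, 1, 2}. (u, v) \<in> rel \<beta> c \<or> (v, u) \<in> rel \<beta> c"
    using uv unfolding dir_rel_def by (auto simp: insert_commute[of v u])
next
  assume "\<exists>c\<in>{0, 1, 2}. (u, v) \<in> rel \<beta> c \<or> (v, u) \<in> rel \<beta> c"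
  then show "{u, v} \<in> E" unfolding dir_rel_def by (auto simp: insert_commute[of v u])
qed

text \<open>The area of the hexagon satisfies the two conditions in \<open>max\<close>, so it does
  not exceed the number of interior vertices. With \<open>hexnet_bound\<close> this is equality, and
  the area need not be computed.\<close>

lemma (in critical_cubic) extremal_frame:
  assumes pos: "0 < card (V - B)"
    and max: "\<And>m. 6 * m \<le> (card B)\<^sup>2 \<Longrightarrow> even (m + card B) \<Longrightarrow> m \<le> card (V - B)"
    and near: "(card B)\<^sup>2 \<le> 6 * card (V - B) + 7"
  obtains \<beta> where "frame \<beta> = V"
    "extremal_net (rel \<beta> 0) (rel \<beta> 1) (rel \<beta> 2) (\<lambda>v. Re (\<beta> * v))"
    "leaf_count (rel \<beta> 0) (rel \<beta> 1) (rel \<beta> 2) = card B"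
proof -
  have "V \<noteq> {}" using pos by auto
  then obtain \<beta> where \<beta>: "norm \<beta> = 1" "frame \<beta> = V"
    "normal_profile (rel \<beta> 0) (rel \<beta> 1) (rel \<beta> 2)"
    using normal_frame[OF near] by blast
  obtain h where h: "hexnet (rel \<beta> 0) (rel \<beta> 1) (rel \<beta> 2) (\<lambda>v. Re (\<beta> * v)) h"
    using hexnet_dir_rel[OF \<beta>(1)] by blast
  interpret hexnet "rel \<beta> 0" "rel \<beta> 1" "rel \<beta> 2" "\<lambda>v. Re (\<beta> * v)" h by fact
  have BV: "B \<subseteq> V" by (auto simp: boundary_points_def)
  have m: "inner_count (rel \<beta> 0) (rel \<beta> 1) = card (V - B)"
    and n: "leaf_count (rel \<beta> 0) (rel \<beta> 1) (rel \<beta> 2) = card B"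
    using frame_counts(1,2)[OF \<beta>(1)] \<beta>(2) BV
    by (simp_all add: Int_absorb1 frame_interior_def frame_leaves_def)
  define M where "M = net_area (rel \<beta> 0) (rel \<beta> 1) (rel \<beta> 2)"
  have le: "int (card (V - B)) \<le> M" unfolding M_def m[symmetric] using hexnet_bound h .
  have M6: "6 * M \<le> (int (card B))\<^sup>2"
    using area_identity(1) unfolding M_def n by (smt (verit) zero_le_power2)
  have ev: "even (M + int (card B))" using area_identity(2) unfolding M_def n .
  have M: "M = int (nat M)" using le by simp
  have "int (6 * nat M) \<le> int ((card B)\<^sup>2)" using M6 M by simp
  then have "6 * nat M \<le> (card B)\<^sup>2" by (simp only: of_nat_le_iff)
  moreover have "even (int (nat M + card B))" using ev M by simp
  then have "even (nat M + card B)" by (simp only: even_of_nat)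
  ultimately have "nat M \<le> card (V - B)" by (rule max)
  then have eq: "int (inner_count (rel \<beta> 0) (rel \<beta> 1)) = M" unfolding m using le by linarith
  have "0 < inner_count (rel \<beta> 0) (rel \<beta> 1)" using pos m by simp
  from inj_on_x_up_leaves[OF eq[unfolded M_def] this]
  have "inj_on (\<lambda>v. Re (\<beta> * v)) (Range (rel \<beta> 0) - Range (rel \<beta> 1))" .
  then have "extremal_net (rel \<beta> 0) (rel \<beta> 1) (rel \<beta> 2) (\<lambda>v. Re (\<beta> * v))"
    unfolding extremal_net_def using h \<beta>(3) eq[unfolded M_def] by blast
  then show ?thesis using that[OF \<beta>(2) _ n] by blast
qed

text \<open>Each graph is put into normal position by its own rotation. The total number of leaves
  then determines the six leaf numbers of both nets, and the resulting isomorphism of nets respects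
  undirected edges as well.\<close>

theorem extremal_isomorphic:
  assumes "critical_cubic V E" "critical_cubic V' E'"
    and n: "card (boundary_points V E) = n" "card (boundary_points V' E') = n"
    and m: "card (V - boundary_points V E) = m" "card (V' - boundary_points V' E') = m"
    and "0 < m" and "\<And>k. 6 * k \<le> n\<^sup>2 \<Longrightarrow> even (k + n) \<Longrightarrow> k \<le> m" and "n\<^sup>2 \<le> 6 * m + 7"
  shows "graph_isomorphic (V, E) (V', E')"
proof -
  interpret A: critical_cubic V E by fact
  interpret A': critical_cubic V' E' by fact
  have c: "0 < card (V - A.B)" "(card A.B)\<^sup>2 \<le> 6 * card (V - A.B) + 7"
    "\<And>k. 6 * k \<le> (card A.B)\<^sup>2 \<Longrightarrow> even (k + card A.B) \<Longrightarrow> k \<le> card (V - A.B)"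
    using assms by simp_all
  have c': "0 < card (V' - A'.B)" "(card A'.B)\<^sup>2 \<le> 6 * card (V' - A'.B) + 7"
    "\<And>k. 6 * k \<le> (card A'.B)\<^sup>2 \<Longrightarrow> even (k + card A'.B) \<Longrightarrow> k \<le> card (V' - A'.B)"
    using assms by simp_all
  obtain \<beta> where X: "A.frame \<beta> = V"
    "extremal_net (dir_rel E \<beta> 0) (dir_rel E \<beta> 1) (dir_rel E \<beta> 2) (\<lambda>v. Re (\<beta> * v))"
    "leaf_count (dir_rel E \<beta> 0) (dir_rel E \<beta> 1) (dir_rel E \<beta> 2) = card A.B"
    by (rule A.extremal_frame[OF c(1,3,2)])
  obtain \<gamma> where Y: "A'.frame \<gamma> = V'"
    "extremal_net (dir_rel E' \<gamma> 0) (dir_rel E' \<gamma> 1) (dir_rel E' \<gamma> 2) (\<lambda>v. Re (\<gamma> * v))"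
    "leaf_count (dir_rel E' \<gamma> 0) (dir_rel E' \<gamma> 1) (dir_rel E' \<gamma> 2) = card A'.B"
    by (rule A'.extremal_frame[OF c'(1,3,2)])
  have "leaf_count (dir_rel E \<beta> 0) (dir_rel E \<beta> 1) (dir_rel E \<beta> 2) =
      leaf_count (dir_rel E' \<gamma> 0) (dir_rel E' \<gamma> 1) (dir_rel E' \<gamma> 2)"
    using X(3) Y(3) n by simp
  from extremal_net_unique[OF X(2) Y(2) this] show ?thesis
    unfolding A.frame_vertices A'.frame_vertices X(1) Y(1)
  proof (elim exE conjE)
    fix f
    assume f: "bij_betw f V V'" "map_prod f f ` dir_rel E \<beta> 0 = dir_rel E' \<gamma> 0"
      "map_prod f f ` dir_rel E \<beta> 1 = dir_rel E' \<gamma> 1" "map_prod f f ` dir_rel E \<beta> 2 = dir_rel E' \<gamma> 2"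
    note bij = f(1)
    have im: "map_prod f f ` dir_rel E \<beta> c = dir_rel E' \<gamma> c" if "c \<in> {0, 1, 2}" for c
      using f that by auto
    have iff: "(u, v) \<in> dir_rel E \<beta> c \<longleftrightarrow> (f u, f v) \<in> dir_rel E' \<gamma> c"
      if uv: "u \<in> V" "v \<in> V" and c: "c \<in> {0, 1, 2}" for u v c
    proof
      assume "(u, v) \<in> dir_rel E \<beta> c"
      then show "(f u, f v) \<in> dir_rel E' \<gamma> c" unfolding im[OF c, symmetric] by force
    next
      assume "(f u, f v) \<in> dir_rel E' \<gamma> c"
      then obtain a b where ab: "(a, b) \<in> dir_rel E \<beta> c" "f a = f u" "f b = f v"
        unfolding im[OF c, symmetric] by auto
      then have "a \<in> V" "b \<in> V" using A.dir_rel_subset[of \<beta> c] by auto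
      then have "a = u" "b = v" using ab uv bij_betw_imp_inj_on[OF bij] by (auto dest: inj_onD)
      then show "(u, v) \<in> dir_rel E \<beta> c" using ab by simp
    qed
    have "{u, v} \<in> E \<longleftrightarrow> {f u, f v} \<in> E'" if "u \<in> V" "v \<in> V" for u v
      unfolding A.frame_edges[OF X(1)] A'.frame_edges[OF Y(1)]
      using iff[OF that] iff[OF that(2,1)] by (intro bex_cong refl) blast
    then show ?thesis using bij unfolding graph_isomorphic_def by auto
  qed
qed

section \<open>Honeycomb patches\<close>

text \<open>The honeycomb consists of the points of the cubic lattice with coordinate sum \<open>\<tau>\<close> (sources) or
  \<open>\<tau> + 1\<close> (sinks), projected along the main diagonal.\<close>

definition hpos :: "int \<times> int \<times> int \<Rightarrow> complex" where
  "hpos = (\<lambda>(a, b, c). of_int a + of_int b * omega3 + of_int c * omega3\<^sup>2)"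

definition hstep :: "int \<times> int \<times> int \<Rightarrow> nat \<Rightarrow> int \<times> int \<times> int" where
  "hstep = (\<lambda>(a, b, c) i. (a + of_bool (i = 0), b + of_bool (i = 1), c + of_bool (i = 2)))"

definition hsum :: "int \<times> int \<times> int \<Rightarrow> int" where
  "hsum = (\<lambda>(a, b, c). a + b + c)"

definition hbox :: "int \<Rightarrow> int \<Rightarrow> int \<Rightarrow> (int \<times> int \<times> int) set" where
  "hbox A B C = {1..A} \<times> {1..B} \<times> {1..C}"

lemma three_cases: "i < 3 \<Longrightarrow> i = 0 \<or> i = 1 \<or> i = (2::nat)"
  by linarith

lemma hpos_step:
  assumes "i < 3"
  shows "hpos (hstep p i) = hpos p + omega3 ^ i"
  using three_cases[OF assms]
  by (cases p) (auto simp: hpos_def hstep_def algebra_simps)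

lemma hsum_step: "i < 3 \<Longrightarrow> hsum (hstep p i) = hsum p + 1"
  using three_cases[of i] by (cases p) (auto simp: hsum_def hstep_def)

text \<open>The kernel of the projection is the main diagonal.\<close>

lemma omega3_independent:
  fixes a b c :: real
  assumes "of_real a + of_real b * omega3 + of_real c * omega3\<^sup>2 = 0"
  shows "a = c" "b = c"
proof -
  have "a - b / 2 - c / 2 = 0" "b * (sqrt 3 / 2) - c * (sqrt 3 / 2) = 0"
    using assms unfolding omega3_power2 by (simp_all add: omega3_def complex_eq_iff)
  then have "a - b / 2 - c / 2 = 0" "(b - c) * (sqrt 3 / 2) = 0" by (simp_all add: left_diff_distrib)
  then show "b = c" "a = c" by auto
qed

text \<open>The coordinates of the two points differ by a multiple of the diagonal, while the base
  points have equal sums. This makes three times an integer equal to \<open>s - s'\<close>, so the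
  integer is 0. For parallel edges everything then agrees, otherwise \<open>s\<close> itself turns
  out to be an integer.\<close>

lemma edge_crossing:
  fixes s s' :: real
  assumes i: "i < 3" "i' < 3" and sum: "hsum p = hsum p'"
    and s: "0 \<le> s" "s \<le> 1" "0 \<le> s'" "s' \<le> 1"
    and eq: "hpos p + of_real s * omega3 ^ i = hpos p' + of_real s' * omega3 ^ i'"
  shows "s = s' \<and> p = p' \<and> i = i' \<or> s \<in> {0, 1}"
proof -
  obtain a b c a' b' c' where p: "p = (a, b, c)" "p' = (a', b', c')" by (cases p, cases p')
  let ?f = "\<lambda>j. s * of_bool (i = j) - s' * of_bool (i' = j)"
  have "of_real (of_int (a - a') + ?f 0) + of_real (of_int (b - b') + ?f 1) * omega3
      + of_real (of_int (c - c') + ?f 2) * omega3\<^sup>2 = 0"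
    using eq three_cases[OF i(1)] three_cases[OF i(2)]
    by (elim disjE) (simp_all add: p hpos_def algebra_simps)
  note co = omega3_independent[OF this]
  have "of_int (a - a') + of_int (b - b') + of_int (c - c') = (0 :: real)"
    using sum unfolding p hsum_def
    by (metis (mono_tags, lifting) case_prod_conv add_diff_add diff_self of_int_0 of_int_add)
  moreover define x y z where "x = a - a'" and "y = b - b'" and "z = c - c'"
  ultimately have xyz: "of_int x + of_int y + of_int z = (0 :: real)"
    "of_int x + ?f 0 = of_int z + ?f 2" "of_int y + ?f 1 = of_int z + ?f 2"
    using co by (simp_all add: x_def y_def z_def)
  have small: "w = 0" if "\<bar>3 * real_of_int w\<bar> \<le> 1" for w :: int
    using that by linarith
  have int01: "s \<in> {0, 1}" if "s = real_of_int w" for w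
  proof -
    have "0 \<le> w" "w \<le> 1" using that s(1,2) by simp_all
    then have "w = 0 \<or> w = 1" by linarith
    then show ?thesis using that by auto
  qed
  show ?thesis
  proof (cases "i = i'")
    case True
    then have "\<bar>3 * real_of_int x\<bar> \<le> 1 \<and> \<bar>3 * real_of_int y\<bar> \<le> 1 \<or> \<bar>3 * real_of_int x\<bar> \<le> 1 \<and> \<bar>3 * real_of_int z\<bar> \<le> 1
      \<or> \<bar>3 * real_of_int y\<bar> \<le> 1 \<and> \<bar>3 * real_of_int z\<bar> \<le> 1"
      using xyz s three_cases[OF i(1)] by (elim disjE) (simp_all, linarith+)
    then have "x = 0 \<and> y = 0 \<and> z = 0" using small[of x] small[of y] small[of z] xyz(1) by auto
    moreover from this have "s = s'" using xyz True three_cases[OF i(1)] by (elim disjE) simp_all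
    ultimately show ?thesis using True by (simp add: p x_def y_def z_def)
  next
    case False
    have key: "s \<in> {0, 1}" if "of_int u + s = of_int w" "of_int v - s' = of_int w"
      "of_int u + of_int v + of_int w = (0 :: real)" for u v w :: int
    proof -
      have "\<bar>3 * real_of_int w\<bar> \<le> 1" using that s by linarith
      then have "w = 0" by (rule small)
      then have "s = real_of_int (- u)" using that(1) by simp
      then show ?thesis by (rule int01)
    qed
    consider (c01) "i = 0" "i' = 1" | (c02) "i = 0" "i' = 2" | (c10) "i = 1" "i' = 0" | (c12) "i = 1" "i' = 2" | (c20) "i = 2" "i' = 0" | (c21) "i = 2" "i' = 1"
      using False three_cases[OF i(1)] three_cases[OF i(2)] by blast
    then have "s \<in> {0, 1}"
    proof cases
      case c01
      with xyz show ?thesis by (intro key[of x z y]) simp_all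
    next
      case c02
      with xyz show ?thesis by (intro key[of x y z]) simp_all
    next
      case c10
      with xyz show ?thesis by (intro key[of y z x]) simp_all
    next
      case c12
      with xyz show ?thesis by (intro key[of y x z]) simp_all
    next
      case c20
      with xyz show ?thesis by (intro key[of z y x]) simp_all
    next
      case c21
      with xyz show ?thesis by (intro key[of z x y]) simp_all
    qed
    then show ?thesis by blast
  qed
qed

lemma omega3_distinct: "omega3 \<noteq> 1" "omega3\<^sup>2 \<noteq> 1" "omega3 \<noteq> omega3\<^sup>2"
  unfolding omega3_power2 by (auto simp: omega3_def complex_eq_iff)

lemma sgn_omega3: "sgn omega3 = omega3" "sgn (omega3\<^sup>2) = omega3\<^sup>2"
  using norm_omega3 by (simp_all add: sgn_div_norm norm_power)

text \<open>The interior vertices will be the box points with coordinate sum \<open>T + 1\<close> or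
  \<open>T + 2\<close>. The inequalities make the sides of the dual hexagon nonnegative:
  \<open>N1 + N2 - T\<close> and its analogues are the numbers of source leaves,
  \<open>T - N0\<close> and its analogues those of sink leaves.\<close>

locale honeycomb_patch =
  fixes N0 N1 N2 T :: int
  assumes pos: "1 \<le> N0" "1 \<le> N1" "1 \<le> N2"
    and le_T: "N0 \<le> T" "N1 \<le> T" "N2 \<le> T"
    and T_le: "T \<le> N0 + N1" "T \<le> N1 + N2" "T \<le> N0 + N2"
begin

abbreviation "Box \<equiv> hbox N0 N1 N2"

definition "Src = {p. hsum p = T + 1}"

definition "Edges = {(p, i). p \<in> Src \<and> i < 3 \<and> (p \<in> Box \<or> hstep p i \<in> Box)}"

definition "Verts = (fst ` Edges) \<union> ((\<lambda>(p, i). hstep p i) ` Edges)"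

definition "V = hpos ` Verts"

definition "E = (\<lambda>(p, i). {hpos p, hpos (hstep p i)}) ` Edges"

lemma finite_Edges: "finite Edges"
proof -
  have "Edges \<subseteq> ({0..N0} \<times> {0..N1} \<times> {0..N2}) \<times> {..<3}"
    by (auto simp: Edges_def hbox_def hstep_def of_bool_def split: if_splits)
  then show ?thesis by (rule finite_subset) simp
qed

lemma EdgesD: "(p, i) \<in> Edges \<Longrightarrow> hsum p = T + 1 \<and> i < 3 \<and> hsum (hstep p i) = T + 2"
  using hsum_step by (auto simp: Edges_def Src_def)

lemma Verts_sum: "p \<in> Verts \<Longrightarrow> hsum p = T + 1 \<or> hsum p = T + 2"
  using EdgesD by (auto simp: Verts_def)

lemma pos_inj: "inj_on hpos Verts"
proof (rule inj_onI)
  fix p q assume pq: "p \<in> Verts" "q \<in> Verts" and eq: "hpos p = hpos q"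
  obtain a b c a' b' c' where p: "p = (a, b, c)" "q = (a', b', c')" by (cases p, cases q)
  have "of_real (of_int (a - a')) + of_real (of_int (b - b')) * omega3 + of_real (of_int (c - c')) * omega3\<^sup>2 = 0"
    using eq by (simp add: p hpos_def algebra_simps)
  from omega3_independent[OF this] have "a - a' = c - c'" "b - b' = c - c'" by linarith+
  moreover have "\<bar>(a + b + c) - (a' + b' + c')\<bar> \<le> 1"
    using Verts_sum[OF pq(1)] Verts_sum[OF pq(2)] by (auto simp: p hsum_def)
  ultimately have "a = a'" "b = b'" "c = c'" by linarith+
  then show "p = q" by (simp add: p)
qed

lemma pos_eq_iff: "p \<in> Verts \<Longrightarrow> q \<in> Verts \<Longrightarrow> hpos p = hpos q \<longleftrightarrow> p = q"
  using pos_inj by (auto dest: inj_onD)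

lemma Edge_Verts: "(p, i) \<in> Edges \<Longrightarrow> p \<in> Verts \<and> hstep p i \<in> Verts"
  by (force simp: Verts_def)

lemma step_neq: "(p, i) \<in> Edges \<Longrightarrow> (q, j) \<in> Edges \<Longrightarrow> p \<noteq> hstep q j"
  using EdgesD[of p i] EdgesD[of q j] by auto

lemma step_inj: "(p, i) \<in> Edges \<Longrightarrow> (p, j) \<in> Edges \<Longrightarrow> hstep p i = hstep p j \<Longrightarrow> i = j"
  using three_cases[of i] three_cases[of j]
  by (cases p) (auto simp: Edges_def hstep_def)

lemma step_inj2: "hstep p i = hstep q i \<Longrightarrow> p = q"
  by (cases p, cases q) (auto simp: hstep_def)

lemma edge_eq_iff:
  assumes "(p, i) \<in> Edges" "(q, j) \<in> Edges"
  shows "{hpos p, hpos (hstep p i)} = {hpos q, hpos (hstep q j)}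
    \<longleftrightarrow> p = q \<and> i = j"
proof
  assume "{hpos p, hpos (hstep p i)} = {hpos q, hpos (hstep q j)}"
  then have "p = q \<and> hstep p i = hstep q j"
    using pos_eq_iff Edge_Verts[OF assms(1)] Edge_Verts[OF assms(2)] step_neq assms
    by (metis doubleton_eq_iff)
  then show "p = q \<and> i = j" using step_inj assms by metis
qed auto

lemma edge_iff: "{u, v} \<in> E \<longleftrightarrow> (\<exists>(p, i)\<in>Edges.
    u = hpos p \<and> v = hpos (hstep p i) \<or> v = hpos p \<and> u = hpos (hstep p i))"
  by (auto simp: E_def doubleton_eq_iff image_iff Bex_def)

definition "out p = {i. (p, i) \<in> Edges}"
definition "inn q = {(p, i) \<in> Edges. hstep p i = q}"

lemma out_source: "p \<in> fst ` Edges \<Longrightarrow> p \<in> Box \<Longrightarrow> out p = {0, 1, 2}"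
proof -
  assume p: "p \<in> fst ` Edges" "p \<in> Box"
  then have "p \<in> Src" by (auto simp: Edges_def)
  then have "out p = {i. i < 3}" using p(2) by (simp add: out_def Edges_def)
  also have "\<dots> = {0, 1, 2}" by auto
  finally show ?thesis .
qed

lemma card_out:
  assumes "p \<in> fst ` Edges"
  shows "card (out p) = (if p \<in> Box then 3 else 1)"
proof (cases "p \<in> Box")
  case True
  then show ?thesis using out_source[OF assms] by simp
next
  case False
  obtain i where i: "(p, i) \<in> Edges" using assms by force
  \<comment> \<open>A source outside the box misses it in one coordinate only, which is 0; raising
    that coordinate is the only step into the box.\<close>
  have "j = i" if "(p, j) \<in> Edges" for j
    using three_cases[of i] three_cases[of j] that i False
    by (cases p) (auto simp: Edges_def hstep_def hbox_def)
  then have "out p = {i}" unfolding out_def using i by blast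
  then show ?thesis using False by simp
qed

definition unstep :: "int \<times> int \<times> int \<Rightarrow> nat \<Rightarrow> int \<times> int \<times> int" where
  "unstep = (\<lambda>(a, b, c) i. (a - of_bool (i = 0), b - of_bool (i = 1), c - of_bool (i = 2)))"

lemma step_unstep: "hstep (unstep q i) i = q" "unstep (hstep q i) i = q"
  by (cases q; simp add: hstep_def unstep_def)+

lemma inn_sink: "q \<in> (\<lambda>(p, i). hstep p i) ` Edges \<Longrightarrow> q \<in> Box \<Longrightarrow> inn q = (\<lambda>i. (unstep q i, i)) ` {0, 1, 2}"
proof -
  assume "q \<in> (\<lambda>(p, i). hstep p i) ` Edges" and q: "q \<in> Box"
  then have sum: "hsum q = T + 2" using EdgesD by auto
  have "(unstep q i, i) \<in> Edges" if "i < 3" for i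
    using hsum_step[OF that, of "unstep q i"] sum that q
    by (simp add: Edges_def Src_def step_unstep)
  then have "(\<lambda>i. (unstep q i, i)) ` {0, 1, 2} \<subseteq> inn q"
    by (auto simp: inn_def step_unstep)
  moreover have "(p, i) \<in> (\<lambda>i. (unstep q i, i)) ` {0, 1, 2}" if "(p, i) \<in> inn q" for p i
    using that EdgesD[of p i] three_cases[of i] step_unstep(2)[of p i] by (auto simp: inn_def)
  ultimately show ?thesis by auto
qed

lemma card_inn:
  assumes "q \<in> (\<lambda>(p, i). hstep p i) ` Edges"
  shows "card (inn q) = (if q \<in> Box then 3 else 1)"
proof (cases "q \<in> Box")
  case True
  have "inj_on (\<lambda>i. (unstep q i, i)) {0, 1, 2 :: nat}" by (auto simp: inj_on_def)
  then have "card ((\<lambda>i. (unstep q i, i)) ` {0, 1, 2 :: nat}) = card {0, 1, 2 :: nat}" by (rule card_image)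
  then show ?thesis using inn_sink[OF assms True] True by simp
next
  case False
  obtain p i where i: "(p, i) \<in> Edges" "hstep p i = q" using assms by force
  have "p' = p \<and> j = i" if "(p', j) \<in> Edges" "hstep p' j = q" for p' j
  proof -
    have "p \<in> Box" "p' \<in> Box" using i that False by (auto simp: Edges_def)
    moreover have "i < 3" "j < 3" using i that EdgesD by blast+
    ultimately have "j = i"
      using three_cases[of i] three_cases[of j] False that(2) i(2)
      by (cases p, cases p') (auto simp: hstep_def hbox_def)
    then show ?thesis using that i step_inj2 by metis
  qed
  then have "inn q = {(p, i)}" unfolding inn_def using i by blast
  then show ?thesis using False by simp
qed

lemma degree_source:
  assumes "p \<in> fst ` Edges"
  shows "vertex_degree E (hpos p) = (if p \<in> Box then 3 else 1)"
    and "neighbours E (hpos p) = (\<lambda>i. hpos p + omega3 ^ i) ` out p"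
proof -
  have p: "p \<in> Verts" using assms by (simp add: Verts_def)
  have nb: "p = q" if "(q, i) \<in> Edges" "hpos p = hpos q" for q i
    using pos_eq_iff[OF p] Edge_Verts that by blast
  obtain j where j: "(p, j) \<in> Edges" using assms by force
  have ns: False if "(q, i) \<in> Edges" "hpos p = hpos (hstep q i)" for q i
    using pos_eq_iff[OF p] Edge_Verts[OF that(1)] that(2) step_neq[OF j that(1)] by blast
  have "incident_edges E (hpos p) = (\<lambda>i. {hpos p, hpos (hstep p i)}) ` out p"
  proof (intro equalityI subsetI)
    fix e assume "e \<in> incident_edges E (hpos p)"
    then obtain q i where q: "(q, i) \<in> Edges" "e = {hpos q, hpos (hstep q i)}" "hpos p \<in> e"
      by (auto simp: incident_edges_def E_def)
    then have "p = q" using nb ns by blast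
    then show "e \<in> (\<lambda>i. {hpos p, hpos (hstep p i)}) ` out p"
      using q unfolding out_def by blast
  qed (force simp: incident_edges_def E_def out_def)
  moreover have "inj_on (\<lambda>i. {hpos p, hpos (hstep p i)}) (out p)"
    using edge_eq_iff by (auto simp: inj_on_def out_def)
  ultimately show "vertex_degree E (hpos p) = (if p \<in> Box then 3 else 1)"
    using card_out[OF assms] by (simp add: vertex_degree_def card_image)
  have "neighbours E (hpos p) = (\<lambda>i. hpos (hstep p i)) ` out p"
  proof (intro equalityI subsetI)
    fix w assume "w \<in> neighbours E (hpos p)"
    then obtain q i where q: "(q, i) \<in> Edges" "hpos p = hpos q \<and> w = hpos (hstep q i) \<or>
        w = hpos q \<and> hpos p = hpos (hstep q i)"
      unfolding neighbours_def edge_iff by blast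
    then have "p = q" "w = hpos (hstep q i)" using nb ns by blast+
    then show "w \<in> (\<lambda>i. hpos (hstep p i)) ` out p"
      using q unfolding out_def by blast
  qed (auto simp: neighbours_def edge_iff out_def)
  then show "neighbours E (hpos p) = (\<lambda>i. hpos p + omega3 ^ i) ` out p"
    using hpos_step EdgesD by (auto simp: out_def image_iff)
qed

lemma degree_sink:
  assumes "q \<in> (\<lambda>(p, i). hstep p i) ` Edges"
  shows "vertex_degree E (hpos q) = (if q \<in> Box then 3 else 1)"
    and "neighbours E (hpos q) = (\<lambda>(p, i). hpos q - omega3 ^ i) ` inn q"
proof -
  have q: "q \<in> Verts" using assms by (simp add: Verts_def)
  have nb: "q = hstep p i" if "(p, i) \<in> Edges" "hpos q = hpos (hstep p i)" for p i
    using pos_eq_iff[OF q] Edge_Verts that by blast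
  obtain p' j where j: "(p', j) \<in> Edges" "q = hstep p' j" using assms by force
  have ns: False if "(p, i) \<in> Edges" "hpos q = hpos p" for p i
    using pos_eq_iff[OF q] Edge_Verts[OF that(1)] that(2) step_neq[OF that(1) j(1)] j(2) by metis
  have "incident_edges E (hpos q) = (\<lambda>(p, i). {hpos p, hpos (hstep p i)}) ` inn q"
  proof (intro equalityI subsetI)
    fix e assume "e \<in> incident_edges E (hpos q)"
    then obtain p i where p: "(p, i) \<in> Edges" "e = {hpos p, hpos (hstep p i)}" "hpos q \<in> e"
      by (auto simp: incident_edges_def E_def)
    then have "q = hstep p i" using nb ns by blast
    then have "(p, i) \<in> inn q" using p by (simp add: inn_def)
    then show "e \<in> (\<lambda>(p, i). {hpos p, hpos (hstep p i)}) ` inn q"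
      using p(2) by force
  qed (force simp: incident_edges_def E_def inn_def)
  moreover have "inj_on (\<lambda>(p, i). {hpos p, hpos (hstep p i)}) (inn q)"
  proof (rule inj_onI)
    fix e e' assume e: "e \<in> inn q" "e' \<in> inn q"
      and eq: "(\<lambda>(p, i). {hpos p, hpos (hstep p i)}) e = (\<lambda>(p, i). {hpos p, hpos (hstep p i)}) e'"
    obtain p i p' i' where "e = (p, i)" "e' = (p', i')" by (cases e, cases e')
    then show "e = e'" using edge_eq_iff[of p i p' i'] e eq by (simp add: inn_def)
  qed
  ultimately show "vertex_degree E (hpos q) = (if q \<in> Box then 3 else 1)"
    using card_inn[OF assms] by (simp add: vertex_degree_def card_image)
  have "neighbours E (hpos q) = (\<lambda>(p, i). hpos p) ` inn q"
  proof (intro equalityI subsetI)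
    fix w assume "w \<in> neighbours E (hpos q)"
    then obtain p i where p: "(p, i) \<in> Edges" "hpos q = hpos p \<and> w = hpos (hstep p i) \<or>
        w = hpos p \<and> hpos q = hpos (hstep p i)"
      unfolding neighbours_def edge_iff by blast
    then have "q = hstep p i" "w = hpos p" using nb ns by blast+
    then have "(p, i) \<in> inn q" using p by (simp add: inn_def)
    then show "w \<in> (\<lambda>(p, i). hpos p) ` inn q"
      using \<open>w = hpos p\<close> by force
  qed (auto simp: neighbours_def edge_iff inn_def)
  also have "\<dots> = (\<lambda>(p, i). hpos q - omega3 ^ i) ` inn q"
    using hpos_step EdgesD by (intro image_cong refl) (auto simp: inn_def)
  finally show "neighbours E (hpos q) = (\<lambda>(p, i). hpos q - omega3 ^ i) ` inn q" .
qed

lemma V_cases: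
  assumes "v \<in> V"
  obtains (source) p where "v = hpos p" "p \<in> fst ` Edges"
    | (sink) q where "v = hpos q" "q \<in> (\<lambda>(p, i). hstep p i) ` Edges"
  using assms unfolding V_def Verts_def by blast

lemma degree: "p \<in> Verts \<Longrightarrow> vertex_degree E (hpos p) = (if p \<in> Box then 3 else 1)"
  using degree_source(1) degree_sink(1) unfolding Verts_def by blast

lemma boundary: "boundary_points V E = hpos ` (Verts - Box)"
  using degree unfolding boundary_points_def V_def by (auto split: if_splits)

lemma finite_Verts: "finite Verts"
  using finite_Edges by (simp add: Verts_def)

lemma edge_point:
  assumes "(p, i) \<in> Edges" "z \<in> convex hull {hpos p, hpos (hstep p i)}"
  obtains s where "0 \<le> s" "s \<le> 1" "z = hpos p + of_real s * omega3 ^ i"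
proof -
  have "i < 3" using EdgesD assms(1) by blast
  obtain s where s: "0 \<le> s" "s \<le> 1" "z = (1 - s) *\<^sub>R hpos p + s *\<^sub>R hpos (hstep p i)"
    using assms(2) unfolding segment_convex_hull[symmetric] in_segment by blast
  then have "z = hpos p + of_real s * omega3 ^ i"
    unfolding hpos_step[OF \<open>i < 3\<close>] by (simp add: scaleR_conv_of_real algebra_simps)
  then show ?thesis using that s by blast
qed

lemma patch_edges_meet:
  assumes "(p, i) \<in> Edges" "(q, j) \<in> Edges" "(p, i) \<noteq> (q, j)"
    and "z \<in> convex hull {hpos p, hpos (hstep p i)}"
    and "z \<in> convex hull {hpos q, hpos (hstep q j)}"
  shows "z \<in> V"
proof -
  obtain s t where s: "0 \<le> s" "s \<le> 1" "z = hpos p + of_real s * omega3 ^ i"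
    and t: "0 \<le> t" "t \<le> 1" "z = hpos q + of_real t * omega3 ^ j"
    using edge_point assms by metis
  have ij: "i < 3" "j < 3" "hsum p = hsum q" using EdgesD[OF assms(1)] EdgesD[OF assms(2)] by auto
  have "s \<in> {0, 1}"
    using edge_crossing[OF ij s(1,2) t(1,2)] s(3) t(3) assms(3) by auto
  then have "z = hpos p \<or> z = hpos (hstep p i)"
    using s(3) hpos_step[OF ij(1)] by auto
  then show ?thesis using Edge_Verts[OF assms(1)] by (auto simp: V_def)
qed

lemma patch_open_segment:
  assumes "(p, i) \<in> Edges"
  shows "open_segment (hpos p) (hpos (hstep p i)) \<inter> V = {}"
proof -
  have False if z: "z \<in> open_segment (hpos p) (hpos (hstep p i))" "z \<in> V" for z
  proof -
    have "i < 3" using EdgesD assms by blast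
    obtain s where s: "0 < s" "s < 1" "z = (1 - s) *\<^sub>R hpos p + s *\<^sub>R hpos (hstep p i)"
      using z(1) unfolding in_segment by blast
    then have zs: "z = hpos p + of_real s * omega3 ^ i"
      unfolding hpos_step[OF \<open>i < 3\<close>] by (simp add: scaleR_conv_of_real algebra_simps)
    \<comment> \<open>A vertex is the point with parameter 0 or 1 on some edge, so that
      \<open>edge_crossing\<close> applies to it too.\<close>
    obtain q j t where q: "(q, j) \<in> Edges" "t \<in> {0, 1 :: real}" "z = hpos q + of_real t * omega3 ^ j"
      using z(2)
    proof (cases rule: V_cases)
      case (source q)
      then obtain j where "(q, j) \<in> Edges" by force
      then show ?thesis using that[of q j 0] source by simp
    next
      case (sink r)
      then obtain q j where "(q, j) \<in> Edges" "r = hstep q j" by force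
      then show ?thesis using that[of q j 1] sink hpos_step[of j q] EdgesD by auto
    qed
    have ij: "i < 3" "j < 3" "hsum p = hsum q" using EdgesD[OF assms(1)] EdgesD[OF q(1)] by auto
    show False
      using edge_crossing[OF ij, of s t] s(1,2) q(2,3) zs by auto
  qed
  then show ?thesis by blast
qed

lemma plane_patch: "plane_graph V E"
  unfolding plane_graph_def
proof (intro conjI)
  have fV: "finite V" using finite_Verts by (simp add: V_def)
  then show "countable V" "\<forall>p. \<not> p islimpt V" by (simp_all add: countable_finite islimpt_finite)
  show "finite (boundary_points V E)" using fV by (simp add: boundary_points_def)
  show "\<forall>e\<in>E. e \<subseteq> V \<and> card e = 2"
  proof
    fix e assume "e \<in> E"
    then obtain p i where e: "(p, i) \<in> Edges" "e = {hpos p, hpos (hstep p i)}"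
      by (auto simp: E_def)
    then have "hpos p \<noteq> hpos (hstep p i)"
      using pos_eq_iff Edge_Verts[OF e(1)] step_neq[OF e(1,1)] by blast
    then show "e \<subseteq> V \<and> card e = 2" using e(2) Edge_Verts[OF e(1)] by (simp add: V_def)
  qed
  show "\<forall>u v. {u, v} \<in> E \<longrightarrow> open_segment u v \<inter> V = {}"
  proof (intro allI impI)
    fix u v assume "{u, v} \<in> E"
    then obtain p i where "(p, i) \<in> Edges" "open_segment u v = open_segment (hpos p) (hpos (hstep p i))"
      unfolding edge_iff using open_segment_commute by blast
    then show "open_segment u v \<inter> V = {}" using patch_open_segment by metis
  qed
  show "\<forall>e\<in>E. \<forall>e'\<in>E. e \<noteq> e' \<longrightarrow> convex hull e \<inter> convex hull e' \<subseteq> V"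
  proof (intro ballI impI subsetI)
    fix e e' z assume e: "e \<in> E" "e' \<in> E" "e \<noteq> e'" "z \<in> convex hull e \<inter> convex hull e'"
    obtain p i q j where "(p, i) \<in> Edges" "e = {hpos p, hpos (hstep p i)}"
      "(q, j) \<in> Edges" "e' = {hpos q, hpos (hstep q j)}"
      using e(1,2) by (auto simp: E_def)
    then show "z \<in> V" using patch_edges_meet[of p i q j z] e(3,4) by auto
  qed
  show "bounded (drawing V E)"
    unfolding drawing_def bounded_Un
  proof
    show "bounded V" using fV by (rule finite_imp_bounded)
    have "finite E" using finite_Edges by (simp add: E_def)
    then show "bounded (\<Union>e\<in>E. convex hull e)"
      by (intro bounded_UN) (auto simp: E_def intro: bounded_convex_hull)
  qed
  show "\<forall>v\<in>V. vertex_degree E v \<noteq> 2" using degree by (auto simp: V_def)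
qed

lemma critical_patch: "critical V E"
  unfolding critical_def
proof (intro conjI ballI)
  show "plane_graph V E" by (rule plane_patch)
  fix v assume v: "v \<in> V - boundary_points V E"
  then have "v \<in> V" by simp
  then show "(\<Sum>w\<in>neighbours E v. sgn (w - v)) = 0"
  proof (cases rule: V_cases)
    case (source p)
    then have "p \<in> Verts" by (simp add: Verts_def)
    then have "p \<in> Box" using v source(1) unfolding boundary by blast
    then have "neighbours E v = {v + 1, v + omega3, v + omega3\<^sup>2}"
      using degree_source(2)[OF source(2)] out_source[OF source(2)] source(1) by simp
    then show ?thesis using omega3_distinct omega3_sum by (simp add: sgn_omega3 add.assoc)
  next
    case (sink q)
    then have "q \<in> Verts" by (simp add: Verts_def)
    then have "q \<in> Box" using v sink(1) unfolding boundary by blast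
    then have "neighbours E v = {v - 1, v - omega3, v - omega3\<^sup>2}"
      using degree_sink(2)[OF sink(2)] inn_sink[OF sink(2)] sink(1) by simp
    moreover have "- (omega3 + omega3\<^sup>2) = 1" using omega3_sum by (simp add: add_eq_0_iff)
    ultimately show ?thesis using omega3_distinct by (simp add: sgn_omega3 sgn_minus)
  qed
qed

lemma cubic_patch: "three_boundary_regular V E"
  unfolding three_boundary_regular_def boundary using degree by (auto simp: V_def)

end

section \<open>Counting the vertices of a patch\<close>

definition corner :: "int \<Rightarrow> (int \<times> int \<times> int) set" where
  "corner S = {(a, b, c). 1 \<le> a \<and> 1 \<le> b \<and> 1 \<le> c \<and> (a + b + c = S + 1 \<or> a + b + c = S + 2)}"

text \<open>The points of \<open>corner S\<close> with coordinate sum \<open>S + 1\<close> project to the part of the square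
  below the diagonal, those with sum \<open>S + 2\<close>, rotated by 180 degrees, to the rest.\<close>

lemma bij_corner:
  "bij_betw (\<lambda>(a, b, c). if a + b + c = S + 1 then (a, b) else (S + 1 - a, S + 1 - b))
    (corner S) ({1..S} \<times> {1..S})"
proof (rule bij_betw_byWitness[where
    f' = "\<lambda>(i, j). if i + j \<le> S then (i, j, S + 1 - i - j) else (S + 1 - i, S + 1 - j, i + j - S)"])
qed (auto simp: corner_def split: if_splits)

lemma card_corner:
  assumes "0 \<le> S"
  shows "card (corner S) = nat (S * S)" "finite (corner S)"
proof -
  show "card (corner S) = nat (S * S)"
    using bij_betw_same_card[OF bij_corner[of S]] assms by (simp add: card_cartesian_product nat_mult_distrib)
  show "finite (corner S)" using bij_betw_finite[OF bij_corner[of S]] by simp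
qed

lemma card_image_int: "inj f \<Longrightarrow> card (f ` {x..y :: int}) = nat (y + 1 - x)"
  by (simp add: card_image inj_on_subset[of f UNIV])

context honeycomb_patch
begin

lemma mem_inner: "p \<in> Verts \<inter> Box \<longleftrightarrow> p \<in> Box \<and> (hsum p = T + 1 \<or> hsum p = T + 2)"
proof
  assume p: "p \<in> Box \<and> (hsum p = T + 1 \<or> hsum p = T + 2)"
  have "p \<in> Verts"
  proof (cases "hsum p = T + 1")
    case True
    then have "(p, 0) \<in> Edges" using p by (simp add: Edges_def Src_def)
    then show ?thesis using Edge_Verts by blast
  next
    case False
    then have "(unstep p 0, 0) \<in> Edges"
      using p hsum_step[of 0 "unstep p 0"] by (simp add: Edges_def Src_def step_unstep)
    then show ?thesis using Edge_Verts step_unstep(1) by metis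
  qed
  then show "p \<in> Verts \<inter> Box" using p by blast
qed (use Verts_sum in blast)

text \<open>Without the upper bounds of the box the points form a corner with \<open>T * T\<close>
  elements. The parts violating one bound are translated corners, and they are disjoint: two
  violated bounds and a positive third coordinate give a sum of at least
  \<open>T + 3\<close>.\<close>

lemma card_inner: "int (card (Verts \<inter> Box)) = T\<^sup>2 - (T - N0)\<^sup>2 - (T - N1)\<^sup>2 - (T - N2)\<^sup>2"
proof -
  let ?c0 = "(\<lambda>(a, b, c). (a + N0, b, c)) ` corner (T - N0)"
  let ?c1 = "(\<lambda>(a, b, c). (a, b + N1, c)) ` corner (T - N1)"
  let ?c2 = "(\<lambda>(a, b, c). (a, b, c + N2)) ` corner (T - N2)"
  have c0: "(a, b, c) \<in> ?c0 \<longleftrightarrow> N0 < a \<and> 1 \<le> b \<and> 1 \<le> c \<and> (a + b + c = T + 1 \<or> a + b + c = T + 2)" for a b c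
    by (auto simp: corner_def image_iff) presburger+
  have c1: "(a, b, c) \<in> ?c1 \<longleftrightarrow> 1 \<le> a \<and> N1 < b \<and> 1 \<le> c \<and> (a + b + c = T + 1 \<or> a + b + c = T + 2)" for a b c
    by (auto simp: corner_def image_iff) presburger+
  have c2: "(a, b, c) \<in> ?c2 \<longleftrightarrow> 1 \<le> a \<and> 1 \<le> b \<and> N2 < c \<and> (a + b + c = T + 1 \<or> a + b + c = T + 2)" for a b c
    by (auto simp: corner_def image_iff) presburger+
  have N: "0 \<le> N0" "0 \<le> N1" "0 \<le> N2" "0 \<le> T" using le_T T_le by linarith+
  have X: "corner T = (Verts \<inter> Box) \<union> (?c0 \<union> (?c1 \<union> ?c2))"
    unfolding set_eq_iff Un_iff mem_inner split_paired_All c0 c1 c2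
    using N by (auto simp: corner_def hbox_def hsum_def)
  have d: "(Verts \<inter> Box) \<inter> (?c0 \<union> (?c1 \<union> ?c2)) = {}" "?c0 \<inter> (?c1 \<union> ?c2) = {}" "?c1 \<inter> ?c2 = {}"
    unfolding set_eq_iff Un_iff Int_iff[of _ "Verts \<inter> Box"] Int_iff[of _ ?c0] Int_iff[of _ ?c1] mem_inner split_paired_All c0 c1 c2
    using T_le by (auto simp: hbox_def)
  have f: "finite ?c0" "finite ?c1" "finite ?c2" "finite (Verts \<inter> Box)"
    using card_corner(2) le_T finite_Verts by simp_all
  have "card (corner T) = card (Verts \<inter> Box) + (card ?c0 + (card ?c1 + card ?c2))"
    unfolding X using f d by (simp add: card_Un_disjoint)
  moreover have "card ?c0 = card (corner (T - N0))" by (rule card_image) (auto simp: inj_on_def)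
  moreover have "card ?c1 = card (corner (T - N1))" by (rule card_image) (auto simp: inj_on_def)
  moreover have "card ?c2 = card (corner (T - N2))" by (rule card_image) (auto simp: inj_on_def)
  ultimately have "int (card (corner T)) = int (card (Verts \<inter> Box)) +
      (int (card (corner (T - N0))) + (int (card (corner (T - N1))) + int (card (corner (T - N2)))))"
    by simp
  moreover have "int (card (corner S)) = S\<^sup>2" if "0 \<le> S" for S
    using card_corner(1)[OF that] that by (simp add: power2_eq_square)
  note this[of T] this[of "T - N0"] this[of "T - N1"] this[of "T - N2"]
  ultimately show ?thesis using le_T N by simp
qed

text \<open>An edge changes one coordinate by 1, so its end outside the box lies just beyond one
  face: a source at a lower face, a sink at an upper one.\<close>

lemma mem_leaf: "(a, b, c) \<in> Verts - Box \<longleftrightarrow>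
    a + b + c = T + 1 \<and> (a = 0 \<and> b \<in> {1..N1} \<and> c \<in> {1..N2} \<or> b = 0 \<and> a \<in> {1..N0} \<and> c \<in> {1..N2} \<or>
      c = 0 \<and> a \<in> {1..N0} \<and> b \<in> {1..N1}) \<or>
    a + b + c = T + 2 \<and> (a = N0 + 1 \<and> b \<in> {1..N1} \<and> c \<in> {1..N2} \<or> b = N1 + 1 \<and> a \<in> {1..N0} \<and> c \<in> {1..N2} \<or>
      c = N2 + 1 \<and> a \<in> {1..N0} \<and> b \<in> {1..N1})" (is "?l \<longleftrightarrow> ?r")
proof
  have N: "0 \<le> N0" "0 \<le> N1" "0 \<le> N2" using pos by linarith+
  assume ?l
  then consider i where "((a, b, c), i) \<in> Edges" "(a, b, c) \<notin> Box"
    | p i where "(p, i) \<in> Edges" "(a, b, c) = hstep p i" "(a, b, c) \<notin> Box"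
    unfolding Verts_def by force
  then show ?r
  proof cases
    case 1
    then have "i < 3" "hstep (a, b, c) i \<in> Box" "a + b + c = T + 1"
      by (auto simp: Edges_def Src_def hsum_def)
    with 1(2) three_cases[OF this(1)] show ?thesis
      by (elim disjE; simp add: hstep_def hbox_def; linarith)
  next
    case 2
    have i3: "i < 3" and sum: "hsum (a, b, c) = T + 2" using EdgesD[OF 2(1)] 2(2) by simp_all
    have "p \<in> Box" using 2 by (auto simp: Edges_def)
    then have "unstep (a, b, c) i \<in> Box" using step_unstep(2)[of p i] 2(2) by simp
    with three_cases[OF i3] 2(3) sum N show ?thesis
      by (elim disjE; simp add: unstep_def hbox_def hsum_def; linarith)
  qed
next
  assume r: ?r
  have "(\<exists>i. ((a, b, c), i) \<in> Edges) \<or> (\<exists>i. (unstep (a, b, c) i, i) \<in> Edges)"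
  proof (cases "a + b + c = T + 1")
    case True
    then have "hstep (a, b, c) 0 \<in> Box \<or> hstep (a, b, c) 1 \<in> Box \<or> hstep (a, b, c) 2 \<in> Box"
      using r le_T T_le pos by (auto simp: hstep_def hbox_def)
    then have "((a, b, c), 0) \<in> Edges \<or> ((a, b, c), 1) \<in> Edges \<or> ((a, b, c), 2) \<in> Edges"
      using True by (auto simp: Edges_def Src_def hsum_def)
    then show ?thesis by blast
  next
    case False
    then have "unstep (a, b, c) 0 \<in> Box \<or> unstep (a, b, c) 1 \<in> Box \<or> unstep (a, b, c) 2 \<in> Box"
      using r le_T T_le pos by (auto simp: unstep_def hbox_def)
    moreover have "unstep (a, b, c) i \<in> Src" if "i < 3" for i
      using False r three_cases[OF that] by (auto simp: unstep_def Src_def hsum_def)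
    ultimately have "(unstep (a, b, c) 0, 0) \<in> Edges \<or> (unstep (a, b, c) 1, 1) \<in> Edges \<or> (unstep (a, b, c) 2, 2) \<in> Edges"
      by (auto simp: Edges_def)
    then show ?thesis by blast
  qed
  then have "(a, b, c) \<in> Verts" using Edge_Verts step_unstep(1) by metis
  moreover have "(a, b, c) \<notin> Box" using r by (auto simp: hbox_def)
  ultimately show ?l by blast
qed

text \<open>On each of the six faces the prescribed sum leaves an interval for one coordinate, and
  \<open>T\<close> cancels in the sum of the six lengths.\<close>

lemma card_leaf: "int (card (Verts - Box)) = N0 + N1 + N2"
proof -
  define A0 where "A0 = {(a, b, c). a + b + c = T + 1 \<and> a = 0 \<and> b \<in> {1..N1} \<and> c \<in> {1..N2}}"
  define A1 where "A1 = {(a, b, c). a + b + c = T + 1 \<and> b = 0 \<and> a \<in> {1..N0} \<and> c \<in> {1..N2}}"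
  define A2 where "A2 = {(a, b, c). a + b + c = T + 1 \<and> c = 0 \<and> a \<in> {1..N0} \<and> b \<in> {1..N1}}"
  define B0 where "B0 = {(a, b, c). a + b + c = T + 2 \<and> a = N0 + 1 \<and> b \<in> {1..N1} \<and> c \<in> {1..N2}}"
  define B1 where "B1 = {(a, b, c). a + b + c = T + 2 \<and> b = N1 + 1 \<and> a \<in> {1..N0} \<and> c \<in> {1..N2}}"
  define B2 where "B2 = {(a, b, c). a + b + c = T + 2 \<and> c = N2 + 1 \<and> a \<in> {1..N0} \<and> b \<in> {1..N1}}"
  have "A0 = (\<lambda>b. (0, b, T + 1 - b)) ` {T + 1 - N2..N1}"
    unfolding A0_def using le_T T_le by (auto simp: image_iff)
  then have A0: "card A0 = nat (N1 + 1 - (T + 1 - N2))" "finite A0"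
    by (simp_all only: finite_imageI finite_atLeastAtMost_int) (intro card_image_int injI; simp)
  have "A1 = (\<lambda>a. (a, 0, T + 1 - a)) ` {T + 1 - N2..N0}"
    unfolding A1_def using le_T T_le by (auto simp: image_iff)
  then have A1: "card A1 = nat (N0 + 1 - (T + 1 - N2))" "finite A1"
    by (simp_all only: finite_imageI finite_atLeastAtMost_int) (intro card_image_int injI; simp)
  have "A2 = (\<lambda>a. (a, T + 1 - a, 0)) ` {T + 1 - N1..N0}"
    unfolding A2_def using le_T T_le by (auto simp: image_iff)
  then have A2: "card A2 = nat (N0 + 1 - (T + 1 - N1))" "finite A2"
    by (simp_all only: finite_imageI finite_atLeastAtMost_int) (intro card_image_int injI; simp)
  have "B0 = (\<lambda>b. (N0 + 1, b, T + 1 - N0 - b)) ` {1..T - N0}"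
    unfolding B0_def using le_T T_le by (auto simp: image_iff)
  then have B0: "card B0 = nat (T - N0 + 1 - 1)" "finite B0"
    by (simp_all only: finite_imageI finite_atLeastAtMost_int) (intro card_image_int injI; simp)
  have "B1 = (\<lambda>a. (a, N1 + 1, T + 1 - N1 - a)) ` {1..T - N1}"
    unfolding B1_def using le_T T_le by (auto simp: image_iff)
  then have B1: "card B1 = nat (T - N1 + 1 - 1)" "finite B1"
    by (simp_all only: finite_imageI finite_atLeastAtMost_int) (intro card_image_int injI; simp)
  have "B2 = (\<lambda>a. (a, T + 1 - N2 - a, N2 + 1)) ` {1..T - N2}"
    unfolding B2_def using le_T T_le by (auto simp: image_iff)
  then have B2: "card B2 = nat (T - N2 + 1 - 1)" "finite B2"
    by (simp_all only: finite_imageI finite_atLeastAtMost_int) (intro card_image_int injI; simp)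
  have eq: "Verts - Box = A0 \<union> (A1 \<union> (A2 \<union> (B0 \<union> (B1 \<union> B2))))"
    unfolding set_eq_iff split_paired_All mem_leaf A0_def A1_def A2_def B0_def B1_def B2_def
      Un_iff mem_Collect_eq prod.case by blast
  have d0: "A0 \<inter> (A1 \<union> (A2 \<union> (B0 \<union> (B1 \<union> B2)))) = {}"
    using le_T T_le by (auto simp: A0_def A1_def A2_def B0_def B1_def B2_def)
  have d1: "A1 \<inter> (A2 \<union> (B0 \<union> (B1 \<union> B2))) = {}"
    using le_T T_le by (auto simp: A1_def A2_def B0_def B1_def B2_def)
  have d2: "A2 \<inter> (B0 \<union> (B1 \<union> B2)) = {}"
    using le_T T_le by (auto simp: A2_def B0_def B1_def B2_def)
  have d3: "B0 \<inter> (B1 \<union> B2) = {}"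
    using le_T T_le by (auto simp: B0_def B1_def B2_def)
  have d4: "B1 \<inter> (B2) = {}"
    using le_T T_le by (auto simp: B1_def B2_def)
  have "card (Verts - Box) = card A0 + (card A1 + (card A2 + (card B0 + (card B1 + card B2))))"
    unfolding eq using A0(2) A1(2) A2(2) B0(2) B1(2) B2(2) d0 d1 d2 d3 d4
    by (simp only: card_Un_disjoint finite_Un)
  then show ?thesis using A0(1) A1(1) A2(1) B0(1) B1(1) B2(1) le_T T_le by simp
qed

theorem patch_counts:
  "int (card (boundary_points V E)) = N0 + N1 + N2"
  "int (card V) = N0 + N1 + N2 + (T\<^sup>2 - (T - N0)\<^sup>2 - (T - N1)\<^sup>2 - (T - N2)\<^sup>2)"
proof -
  have "card (boundary_points V E) = card (Verts - Box)"
    unfolding boundary by (intro card_image inj_on_subset[OF pos_inj]) blast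
  then show "int (card (boundary_points V E)) = N0 + N1 + N2" using card_leaf by simp
  have "card V = card Verts" unfolding V_def by (intro card_image pos_inj)
  also have "\<dots> = card (Verts \<inter> Box) + card (Verts - Box)" using finite_Verts by (rule card_Int_Diff)
  finally show "int (card V) = N0 + N1 + N2 + (T\<^sup>2 - (T - N0)\<^sup>2 - (T - N1)\<^sup>2 - (T - N2)\<^sup>2)"
    using card_leaf card_inner by simp
qed

end

section \<open>The maximum\<close>

definition max_vertices :: "nat \<Rightarrow> nat" where
  "max_vertices n = (let k = n div 6; l = n - 6 * k in
    6 * k\<^sup>2 + 6 * k + 2 * l * (k + 1) - (if n mod 6 = 0 then 0 else 2))"

lemma residue_cases:
  obtains k l :: nat where "n = 6 * k + l" "l \<in> {0, 1, 2, 3, 4, 5}" "n div 6 = k" "n - 6 * k = l" "n mod 6 = l"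
proof -
  have "n = 6 * (n div 6) + n mod 6" "n mod 6 < 6" by simp_all
  moreover from this have "n - 6 * (n div 6) = n mod 6" by linarith
  moreover have "j < 6 \<Longrightarrow> j \<in> {0, 1, 2, 3, 4, 5}" for j :: nat by auto
  ultimately show ?thesis using that[of "n div 6" "n mod 6"] by blast
qed

lemma max_vertices_upper:
  assumes "6 * m \<le> n\<^sup>2" "even (m + n)"
  shows "m + n \<le> max_vertices n"
proof -
  obtain k l where n: "n = 6 * k + l" and l: "l \<in> {0, 1, 2, 3, 4, 5}"
    and d: "n div 6 = k" "n - 6 * k = l" "n mod 6 = l"
    by (rule residue_cases)
  \<comment> \<open>With \<open>k * k\<close> hidden behind a name, each residue leaves a linear
    problem with a parity condition.\<close>
  define X where "X = k * k"
  have sq: "n\<^sup>2 = 36 * X + 12 * (k * l) + l * l" unfolding n X_def by (simp add: power2_eq_square algebra_simps)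
  have M: "max_vertices n = 6 * X + 6 * k + 2 * l * (k + 1) - (if l = 0 then 0 else 2)"
    unfolding max_vertices_def Let_def d X_def by (simp add: power2_eq_square)
  have "even (m + (6 * k + l))" using assms(2) n by simp
  moreover have "6 * m \<le> 36 * X + 12 * (k * l) + l * l" using assms(1) sq by simp
  ultimately show ?thesis unfolding M unfolding n using l by auto presburger+
qed

text \<open>With \<open>m = max_vertices n - n\<close>, the difference \<open>n^2 - 6 * m\<close> is
  0, 7, 4, 3, 4, 7 for the residues 0 to 5; this is the origin of the 7. The assumption on
  \<open>n\<close> ensures that there are interior vertices.\<close>

lemma max_vertices_lower:
  assumes "3 \<le> n"
  shows "n < max_vertices n" "n\<^sup>2 \<le> 6 * (max_vertices n - n) + 7"
proof -
  obtain k l where n: "n = 6 * k + l" and l: "l \<in> {0, 1, 2, 3, 4, 5}"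
    and d: "n div 6 = k" "n - 6 * k = l" "n mod 6 = l"
    by (rule residue_cases)
  define X where "X = k * k"
  have sq: "n\<^sup>2 = 36 * X + 12 * (k * l) + l * l" unfolding n X_def by (simp add: power2_eq_square algebra_simps)
  have M: "max_vertices n = 6 * X + 6 * k + 2 * l * (k + 1) - (if l = 0 then 0 else 2)"
    unfolding max_vertices_def Let_def d X_def by (simp add: power2_eq_square)
  have k: "k = 0 \<or> k \<le> X" by (simp add: X_def)
  show "n < max_vertices n" unfolding M unfolding n using l k assms[unfolded n] by (auto simp: X_def)
  then show "n\<^sup>2 \<le> 6 * (max_vertices n - n) + 7" unfolding M sq unfolding n using l by auto
qed

lemma ex_extremal:
  assumes "3 \<le> n"
  obtains V E where "critical V E" "three_boundary_regular V E" "card (boundary_points V E) = n"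
    "card V = max_vertices n"
proof -
  \<comment> \<open>By \<open>patch_counts\<close> the interior vertices number
    \<open>2 * T * n - 2 * T^2 - (N0^2 + N1^2 + N2^2)\<close> with \<open>n = N0 + N1 + N2\<close>.
    Over the reals this is largest for \<open>T = n / 2\<close> and all sides \<open>n / 3\<close>;
    the rounding keeps the sum equal to \<open>n\<close>.\<close>
  define N0 N1 N2 T where "N0 = (n + 2) div 3" and "N1 = (n + 1) div 3" and "N2 = n div 3" and "T = n div 2"
  obtain k l where n: "n = 6 * k + l" and l: "l \<in> {0, 1, 2, 3, 4, 5}"
    and d: "n div 6 = k" "n - 6 * k = l" "n mod 6 = l"
    by (rule residue_cases)
  have N: "N0 = 2 * k + (l + 2) div 3" "N1 = 2 * k + (l + 1) div 3" "N2 = 2 * k + l div 3" "T = 3 * k + l div 2"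
    unfolding N0_def N1_def N2_def T_def n by presburger+
  have "3 \<le> 6 * k + l" using assms n by simp
  then have "honeycomb_patch (int N0) (int N1) (int N2) (int T)"
    unfolding N by unfold_locales (use l in \<open>elim insertE; simp; linarith?\<close>)+
  then interpret honeycomb_patch "int N0" "int N1" "int N2" "int T" .
  have sum: "N0 + N1 + N2 = n" unfolding N unfolding n using l by (elim insertE) simp_all
  have "int N0 + int N1 + int N2 + ((int T)\<^sup>2 - (int T - int N0)\<^sup>2 - (int T - int N1)\<^sup>2 - (int T - int N2)\<^sup>2)
      = int (max_vertices n)"
  proof -
    have "max_vertices n = 6 * (k * k) + 6 * k + 2 * l * (k + 1) - (if l = 0 then 0 else 2)"
      unfolding max_vertices_def Let_def d by (simp add: power2_eq_square)
    \<comment> \<open>The subtraction in \<open>max_vertices\<close> is not truncated, so it can be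
      carried over to the integers.\<close>
    moreover have "(if l = 0 then 0 else 2 :: nat) \<le> 6 * (k * k) + 6 * k + 2 * l * (k + 1)" by (cases l) auto
    ultimately have M: "int (max_vertices n) = 6 * (int k * int k) + 6 * int k + 2 * int l * (int k + 1) - (if l = 0 then 0 else 2)"
      by (simp add: of_nat_diff algebra_simps)
    show ?thesis unfolding M N using l
      by (elim insertE) (simp_all add: power2_eq_square algebra_simps)
  qed
  then have "int (card V) = int (max_vertices n)" using patch_counts(2) by simp
  moreover have "int (card (boundary_points V E)) = int n" using patch_counts(1) sum by simp
  ultimately show ?thesis using that critical_patch cubic_patch by simp
qed

lemma critical3_cubic: "(V, E) \<in> critical3 n \<longleftrightarrow> critical_cubic V E \<and> card (boundary_points V E) = n"
  by (auto simp: critical3_def critical_cubic_def)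

lemma (in critical_cubic) card_V: "card V = card (V - B) + card B"
proof -
  have "B \<subseteq> V" by (auto simp: boundary_points_def)
  then show ?thesis using finite_V by (simp add: card_Diff_subset card_mono finite_subset)
qed

theorem theorem1:
  fixes n k l r :: nat
  assumes "n \<ge> 3"
    and "k = n div 6"
    and "l = n - 6 * k"
    and "r = (if n mod 6 = 0 then 0 else 2)"
  shows "f3 n = enat (6 * k\<^sup>2 + 6 * k + 2 * l * (k + 1) - r) \<and>
         (\<exists>G. G \<in> maximisers3 n) \<and>
         (\<forall>G \<in> maximisers3 n. \<forall>H \<in> maximisers3 n. graph_isomorphic G H)"
proof -
  have M: "6 * k\<^sup>2 + 6 * k + 2 * l * (k + 1) - r = max_vertices n"
    using assms by (simp add: max_vertices_def Let_def)
  have num: "num_vertices (V, E) = enat (card V)" if "(V, E) \<in> critical3 n" for V E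
  proof -
    interpret critical_cubic V E using that critical3_cubic by blast
    show ?thesis using finite_V by (simp add: num_vertices_def)
  qed
  have upper: "card V \<le> max_vertices n" if "(V, E) \<in> critical3 n" for V E
  proof -
    interpret critical_cubic V E using that critical3_cubic by blast
    have "card B = n" using that critical3_cubic by blast
    then show ?thesis using max_vertices_upper[of "card (V - B)" n] vertices_bound vertices_parity card_V by simp
  qed
  obtain V0 E0 where G0: "(V0, E0) \<in> critical3 n" "card V0 = max_vertices n"
    unfolding critical3_def mem_Collect_eq prod.case using ex_extremal[OF assms(1)] by blast
  have f3: "f3 n = enat (max_vertices n)"
    unfolding f3_def
  proof (rule antisym)
    show "(SUP G\<in>critical3 n. num_vertices G) \<le> enat (max_vertices n)"
      using num upper by (intro SUP_least) (metis enat_ord_simps(1) prod.collapse)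
    show "enat (max_vertices n) \<le> (SUP G\<in>critical3 n. num_vertices G)"
      using G0 num by (metis SUP_upper)
  qed
  have iso: "graph_isomorphic (V, E) (V', E')" if G: "(V, E) \<in> maximisers3 n" "(V', E') \<in> maximisers3 n" for V E V' E'
  proof -
    have mem: "(V, E) \<in> critical3 n" "(V', E') \<in> critical3 n"
      and card: "card V = max_vertices n" "card V' = max_vertices n"
      using G num f3 by (auto simp: maximisers3_def)
    interpret A: critical_cubic V E using mem critical3_cubic by blast
    interpret A': critical_cubic V' E' using mem critical3_cubic by blast
    have B: "card A.B = n" "card A'.B = n" using mem critical3_cubic by blast+
    show ?thesis
    proof (rule extremal_isomorphic[OF A.critical_cubic_axioms A'.critical_cubic_axioms B])
      show "card (V - A.B) = max_vertices n - n" "card (V' - A'.B) = max_vertices n - n"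
        using A.card_V A'.card_V B card by simp_all
      show "0 < max_vertices n - n" "n\<^sup>2 \<le> 6 * (max_vertices n - n) + 7"
        using max_vertices_lower[OF assms(1)] by simp_all
      show "m \<le> max_vertices n - n" if "6 * m \<le> n\<^sup>2" "even (m + n)" for m
        using max_vertices_upper[OF that] by simp
    qed
  qed
  moreover have "(V0, E0) \<in> maximisers3 n" using G0 num f3 by (simp add: maximisers3_def)
  ultimately show ?thesis using f3 unfolding M by fast
qed

end
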